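(* Let $\gamma$ be a $\tau$-admissible Borel probability measure on $\mathcal O$. Then the Bourguignon-Li-Yau map $\Psi_\gamma:X=G/K\to\mathfrak p$ extends to a continuous map on the Satake compactification $\overline X^S_\tau$ (still denoted $\Psi_\gamma$, with $X$ identified with $i_\tau(X)\subset\overline X^S_\tau$), and $\Psi_\gamma(\partial\overline X^S_\tau)\subseteq\partial\mathcal E$. Moreover $\Psi_\gamma(\overline X^S_\tau)=\mathcal E$ and $\Psi_\gamma(X)=\mathrm{Int}(\mathcal E)$.
   Context: Setting: $G$ is a connected noncompact real semisimple Lie group with finite center, $K\subset G$ a maximal compact subgroup, $\mathfrak g=\mathfrak k\oplus\mathfrak p$ the corresponding Cartan decomposition, $X=G/K$, and $\tau:G\to \mathrm{SL}(V)$ an irreducible representation with finite kernel on a finite-dimensional complex vector space $V$. $h$ is a Hermitian scalar product on $V$ such that $\tau(G)$ is compatible with $\mathrm{SU}(V,h)^{\mathbb C}$, i.e. $\tau(K)\subset \mathrm{SU}(V,h)$, $\tau(\mathfrak p)\subset i\,\mathfrak{su}(V,h)$ and $\tau(G)=\tau(K)\exp(\tau(\mathfrak p))$. $G$ is identified with $\tau(G)$ and acts on $\mathbb P(V)$. Gradient map: fix an $\mathrm{Ad}(K)$-invariant scalar product $\langle\cdot,\cdot\rangle$ on $\mathfrak p$. The $G$-gradient map $\mu_{\mathfrak p}:\mathbb P(V)\to\mathfrak p$ is determined by $\langle\mu_{\mathfrak p}([v]),\beta\rangle=h(\beta v,v)/h(v,v)$ for all $\beta\in\mathfrak p$. The orbit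 $\mathcal O$: let $U^{\mathbb C}$ be the Zariski closure of $\tau(G)$ in $\mathrm{SL}(V)$; it is complex semisimple, acts irreducibly on $V$, and has a unique closed orbit $\mathcal O'$ in $\mathbb P(V)$. $\mathcal O$ is the unique closed $G$-orbit contained in $\mathcal O'$; it is a $K$-orbit. $\mathcal E=\mathrm{conv}(\mu_{\mathfrak p}(\mathcal O))\subset\mathfrak p$; $\mathrm{Int}$ and $\partial$ of $\mathcal E$ are taken in $\mathfrak p$. Satake compactification: $\mathcal H(V)$ is the real vector space of $h$-Hermitian endomorphisms of $V$ and $g^*$ the $h$-adjoint; $i_\tau:X\to\mathbb P(\mathcal H(V))$, $gK\mapsto[gg^*]$, is injective; $\overline X^S_\tau$ is the closure of $i_\tau(X)$ in $\mathbb P(\mathcal H(V))$ and $\partial\overline X^S_\tau=\overline X^S_\tau\setminus i_\tau(X)$. Bourguignon-Li-Yau map: $\rho(g)=\sqrt{gg^*}\in\exp(\mathfrak p)$ is the positive Hermitian square root and $\Psi_\gamma(gK)=\int_{\mathcal O}\mu_{\mathfrak p}(\rho(g)x)\,d\gamma(x)$. $\gamma$ is $\tau$-admissible if $\gamma(\mathcal O\cap H)=0$ for every complex projective hyperplane $H\subset\mathbb P(V)$. *)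

theory Defs
  imports
    "HOL-Analysis.Analysis"
    "HOL-Probability.Probability_Measure"
    "HOL-Algebra.Left_Coset"
begin

text \<open>For open \<open>S\<close>: \<open>f\<close> is \<open>k\<close> times continuously differentiable on \<open>S\<close>.\<close>

primrec ck_on :: "nat \<Rightarrow> 'a::euclidean_space set \<Rightarrow> ('a \<Rightarrow> 'b::real_normed_vector) \<Rightarrow> bool" where
  "ck_on 0 S f \<longleftrightarrow> continuous_on S f"
| "ck_on (Suc k) S f \<longleftrightarrow> (\<forall>x\<in>S. f differentiable (at x)) \<and>
     (\<forall>v. ck_on k S (\<lambda>x. frechet_derivative f (at x) v))"

definition smooth_on :: "'a::euclidean_space set \<Rightarrow> ('a \<Rightarrow> 'b::real_normed_vector) \<Rightarrow> bool" where
  "smooth_on S f \<longleftrightarrow> (\<forall>k. ck_on k S f)"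

text \<open>A chart is a pair of its domain and its coordinate map; the latter is only meaningful
  on the domain.\<close>

type_synonym ('g, 'e) chart = "'g set \<times> ('g \<Rightarrow> 'e)"

definition chart_inv :: "('g, 'e) chart \<Rightarrow> 'e \<Rightarrow> 'g" where
  "chart_inv c = inv_into (fst c) (snd c)"

definition chart_range :: "('g, 'e) chart \<Rightarrow> 'e set" where
  "chart_range c = snd c ` fst c"

definition is_chart :: "'g topology \<Rightarrow> ('g, 'e::euclidean_space) chart \<Rightarrow> bool" where
  "is_chart T c \<longleftrightarrow> openin T (fst c) \<and> open (chart_range c) \<and>
     homeomorphic_map (subtopology T (fst c)) (top_of_set (chart_range c)) (snd c)"

definition smooth_manifold :: "'g topology \<Rightarrow> ('g, 'e::euclidean_space) chart set \<Rightarrow> bool" where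
  "smooth_manifold T A \<longleftrightarrow>
     Hausdorff_space T \<and> second_countable T \<and>
     (\<forall>c\<in>A. is_chart T c) \<and> (\<Union>c\<in>A. fst c) = topspace T \<and>
     (\<forall>c\<in>A. \<forall>d\<in>A. smooth_on (snd c ` (fst c \<inter> fst d)) (snd d \<circ> chart_inv c))"

definition lie_group ::
  "('g, 'm) monoid_scheme \<Rightarrow> 'g topology \<Rightarrow> ('g, 'e::euclidean_space) chart set \<Rightarrow> bool" where
  "lie_group G T A \<longleftrightarrow>
     group G \<and> topspace T = carrier G \<and> smooth_manifold T A \<and>
     continuous_map (prod_topology T T) T (\<lambda>(x, y). x \<otimes>\<^bsub>G\<^esub> y) \<and>
     continuous_map T T (\<lambda>x. inv\<^bsub>G\<^esub> x) \<and>
     (\<forall>c\<in>A. \<forall>d\<in>A. \<forall>e\<in>A.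
        smooth_on {(x, y). x \<in> chart_range c \<and> y \<in> chart_range d \<and>
                      chart_inv c x \<otimes>\<^bsub>G\<^esub> chart_inv d y \<in> fst e}
          (\<lambda>(x, y). snd e (chart_inv c x \<otimes>\<^bsub>G\<^esub> chart_inv d y))) \<and>
     (\<forall>c\<in>A. \<forall>d\<in>A.
        smooth_on {x \<in> chart_range c. inv\<^bsub>G\<^esub> (chart_inv c x) \<in> fst d}
          (\<lambda>x. snd d (inv\<^bsub>G\<^esub> (chart_inv c x))))"

definition group_center :: "('g, 'm) monoid_scheme \<Rightarrow> 'g set" where
  "group_center G = {z \<in> carrier G. \<forall>g\<in>carrier G. z \<otimes>\<^bsub>G\<^esub> g = g \<otimes>\<^bsub>G\<^esub> z}"

definition maximal_compact_subgroup ::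
  "('g, 'm) monoid_scheme \<Rightarrow> 'g topology \<Rightarrow> 'g set \<Rightarrow> bool" where
  "maximal_compact_subgroup G T K \<longleftrightarrow> subgroup K G \<and> compactin T K \<and>
     (\<forall>L. subgroup L G \<and> compactin T L \<and> K \<subseteq> L \<longrightarrow> L = K)"

text \<open>In what follows \<open>c\<close> is a chart around the identity, and the Lie algebra, i.e. the tangent
  space at the identity, is identified with the coordinate space \<open>'e\<close> through the
  differential of \<open>c\<close>.\<close>

definition chart_at_one ::
  "('g, 'm) monoid_scheme \<Rightarrow> ('g, 'e::euclidean_space) chart set \<Rightarrow> ('g, 'e) chart \<Rightarrow> bool" where
  "chart_at_one G A c \<longleftrightarrow> c \<in> A \<and> \<one>\<^bsub>G\<^esub> \<in> fst c"

definition Ad ::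
  "('g, 'm) monoid_scheme \<Rightarrow> ('g, 'e::euclidean_space) chart \<Rightarrow> 'g \<Rightarrow> 'e \<Rightarrow> 'e" where
  "Ad G c g = frechet_derivative (\<lambda>z. snd c (g \<otimes>\<^bsub>G\<^esub> chart_inv c z \<otimes>\<^bsub>G\<^esub> inv\<^bsub>G\<^esub> g)) (at (snd c \<one>\<^bsub>G\<^esub>))"

text \<open>The bracket is \<open>[x, y] = ad x y\<close>, where \<open>ad\<close> is the differential of \<open>Ad\<close> at the identity.\<close>

definition lie_bracket ::
  "('g, 'm) monoid_scheme \<Rightarrow> ('g, 'e::euclidean_space) chart \<Rightarrow> 'e \<Rightarrow> 'e \<Rightarrow> 'e" where
  "lie_bracket G c x y = frechet_derivative (\<lambda>z. Ad G c (chart_inv c z) y) (at (snd c \<one>\<^bsub>G\<^esub>)) x"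

definition killing_form ::
  "('g, 'm) monoid_scheme \<Rightarrow> ('g, 'e::euclidean_space) chart \<Rightarrow> 'e \<Rightarrow> 'e \<Rightarrow> real" where
  "killing_form G c x y = (\<Sum>b\<in>Basis. lie_bracket G c x (lie_bracket G c y b) \<bullet> b)"

definition semisimple_lie_algebra ::
  "('g, 'm) monoid_scheme \<Rightarrow> ('g, 'e::euclidean_space) chart \<Rightarrow> bool" where
  "semisimple_lie_algebra G c \<longleftrightarrow>
     (\<forall>I. subspace I \<and> (\<forall>x. \<forall>y\<in>I. lie_bracket G c x y \<in> I) \<and>
          (\<forall>x\<in>I. \<forall>y\<in>I. lie_bracket G c x y = 0) \<longrightarrow> I = {0})"

text \<open>The Lie algebra of a closed subgroup \<open>H\<close>: the initial velocities of the one-parameter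
  subgroups that stay in \<open>H\<close>.\<close>

definition lie_algebra_of ::
  "('g, 'm) monoid_scheme \<Rightarrow> 'g topology \<Rightarrow> ('g, 'e::euclidean_space) chart \<Rightarrow> 'g set \<Rightarrow> 'e set" where
  "lie_algebra_of G T c H =
     {x. \<exists>\<sigma>::real \<Rightarrow> 'g. continuous_map euclideanreal T \<sigma> \<and>
           (\<forall>s t. \<sigma> (s + t) = \<sigma> s \<otimes>\<^bsub>G\<^esub> \<sigma> t) \<and> (\<forall>t. \<sigma> t \<in> H) \<and>
           ((\<lambda>t. snd c (\<sigma> t)) has_vector_derivative x) (at 0)}"

definition cartan_decomposition ::
  "('g, 'm) monoid_scheme \<Rightarrow> ('g, 'e::euclidean_space) chart \<Rightarrow> 'e set \<Rightarrow> 'e set \<Rightarrow> bool" where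
  "cartan_decomposition G c \<kk> \<pp> \<longleftrightarrow>
     subspace \<kk> \<and> subspace \<pp> \<and> \<kk> \<inter> \<pp> = {0} \<and> (\<forall>z. \<exists>x\<in>\<kk>. \<exists>y\<in>\<pp>. z = x + y) \<and>
     (\<forall>x\<in>\<kk>. \<forall>y\<in>\<kk>. lie_bracket G c x y \<in> \<kk>) \<and>
     (\<forall>x\<in>\<kk>. \<forall>y\<in>\<pp>. lie_bracket G c x y \<in> \<pp>) \<and>
     (\<forall>x\<in>\<pp>. \<forall>y\<in>\<pp>. lie_bracket G c x y \<in> \<kk>) \<and>
     (\<forall>x\<in>\<kk>. x \<noteq> 0 \<longrightarrow> killing_form G c x x < 0) \<and>
     (\<forall>x\<in>\<pp>. x \<noteq> 0 \<longrightarrow> killing_form G c x x > 0)"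

definition Ad_invariant_scalar_product ::
  "('g, 'm) monoid_scheme \<Rightarrow> ('g, 'e::euclidean_space) chart \<Rightarrow> 'g set \<Rightarrow> 'e set \<Rightarrow>
    ('e \<Rightarrow> 'e \<Rightarrow> real) \<Rightarrow> bool" where
  "Ad_invariant_scalar_product G c K \<pp> ip \<longleftrightarrow>
     (\<forall>x\<in>\<pp>. \<forall>y\<in>\<pp>. \<forall>z\<in>\<pp>. ip (x + y) z = ip x z + ip y z) \<and>
     (\<forall>r. \<forall>x\<in>\<pp>. \<forall>y\<in>\<pp>. ip (r *\<^sub>R x) y = r * ip x y) \<and>
     (\<forall>x\<in>\<pp>. \<forall>y\<in>\<pp>. ip x y = ip y x) \<and>
     (\<forall>x\<in>\<pp>. x \<noteq> 0 \<longrightarrow> ip x x > 0) \<and>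
     (\<forall>k\<in>K. \<forall>x\<in>\<pp>. \<forall>y\<in>\<pp>. ip (Ad G c k x) (Ad G c k y) = ip x y)"

definition sl_representation ::
  "('g, 'm) monoid_scheme \<Rightarrow> ('g, 'e::euclidean_space) chart set \<Rightarrow>
    ('g \<Rightarrow> complex^'n^'n) \<Rightarrow> bool" where
  "sl_representation G A \<tau> \<longleftrightarrow>
     (\<forall>g\<in>carrier G. det (\<tau> g) = 1) \<and>
     (\<forall>g\<in>carrier G. \<forall>g'\<in>carrier G. \<tau> (g \<otimes>\<^bsub>G\<^esub> g') = \<tau> g ** \<tau> g') \<and>
     (\<forall>c\<in>A. smooth_on (chart_range c) (\<tau> \<circ> chart_inv c))"

definition irreducible_representation ::
  "('g, 'm) monoid_scheme \<Rightarrow> ('g \<Rightarrow> complex^'n^'n) \<Rightarrow> bool" where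
  "irreducible_representation G \<tau> \<longleftrightarrow>
     (\<forall>W. vec.subspace W \<and> (\<forall>g\<in>carrier G. \<forall>w\<in>W. \<tau> g *v w \<in> W) \<longrightarrow> W = {0} \<or> W = UNIV)"

definition representation_kernel ::
  "('g, 'm) monoid_scheme \<Rightarrow> ('g \<Rightarrow> complex^'n^'n) \<Rightarrow> 'g set" where
  "representation_kernel G \<tau> = {g \<in> carrier G. \<tau> g = mat 1}"

definition differential ::
  "('g, 'm) monoid_scheme \<Rightarrow> ('g, 'e::euclidean_space) chart \<Rightarrow>
    ('g \<Rightarrow> complex^'n^'n) \<Rightarrow> 'e \<Rightarrow> complex^'n^'n" where
  "differential G c \<tau> = frechet_derivative (\<tau> \<circ> chart_inv c) (at (snd c \<one>\<^bsub>G\<^esub>))"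

definition mat_exp :: "complex^'n^'n \<Rightarrow> complex^'n^'n" where
  "mat_exp A = (\<Sum>k. (1 / fact k) *\<^sub>R (((**) A ^^ k) (mat 1)))"

text \<open>Hermitian scalar products are complex linear in the first argument.\<close>

definition hermitian_scalar_product :: "(complex^'n \<Rightarrow> complex^'n \<Rightarrow> complex) \<Rightarrow> bool" where
  "hermitian_scalar_product h \<longleftrightarrow>
     (\<forall>u v w. h (u + v) w = h u w + h v w) \<and> (\<forall>a u v. h (a *s u) v = a * h u v) \<and>
     (\<forall>u v. h u v = cnj (h v u)) \<and> (\<forall>u. u \<noteq> 0 \<longrightarrow> Re (h u u) > 0)"

definition special_unitary :: "(complex^'n \<Rightarrow> complex^'n \<Rightarrow> complex) \<Rightarrow> (complex^'n^'n) set" where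
  "special_unitary h = {A. det A = 1 \<and> (\<forall>v w. h (A *v v) (A *v w) = h v w)}"

definition special_unitary_lie ::
  "(complex^'n \<Rightarrow> complex^'n \<Rightarrow> complex) \<Rightarrow> (complex^'n^'n) set" where
  "special_unitary_lie h = {A. trace A = 0 \<and> (\<forall>v w. h (A *v v) w + h v (A *v w) = 0)}"

definition compatible ::
  "('g, 'm) monoid_scheme \<Rightarrow> ('g, 'e::euclidean_space) chart \<Rightarrow> 'g set \<Rightarrow> 'e set \<Rightarrow>
    ('g \<Rightarrow> complex^'n^'n) \<Rightarrow> (complex^'n \<Rightarrow> complex^'n \<Rightarrow> complex) \<Rightarrow> bool" where
  "compatible G c K \<pp> \<tau> h \<longleftrightarrow>
     \<tau> ` K \<subseteq> special_unitary h \<and>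
     differential G c \<tau> ` \<pp> \<subseteq> (\<lambda>B. map_matrix ((*) \<i>) B) ` special_unitary_lie h \<and>
     \<tau> ` carrier G = {\<tau> k ** mat_exp (differential G c \<tau> \<beta>) | k \<beta>. k \<in> K \<and> \<beta> \<in> \<pp>}"

inductive matrix_polynomial :: "(complex^'n^'n \<Rightarrow> complex) \<Rightarrow> bool" where
  "matrix_polynomial (\<lambda>A. a)"
| "matrix_polynomial (\<lambda>A. A $ i $ j)"
| "matrix_polynomial p \<Longrightarrow> matrix_polynomial q \<Longrightarrow> matrix_polynomial (\<lambda>A. p A + q A)"
| "matrix_polynomial p \<Longrightarrow> matrix_polynomial q \<Longrightarrow> matrix_polynomial (\<lambda>A. p A * q A)"

definition zariski_closure_SL :: "(complex^'n^'n) set \<Rightarrow> (complex^'n^'n) set" where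
  "zariski_closure_SL S =
     {B. det B = 1 \<and> (\<forall>p. matrix_polynomial p \<and> (\<forall>A\<in>S. p A = 0) \<longrightarrow> p B = 0)}"

definition quotient_topology :: "'a topology \<Rightarrow> ('a \<Rightarrow> 'b) \<Rightarrow> 'b topology" where
  "quotient_topology T f = topology (\<lambda>U. U \<subseteq> f ` topspace T \<and> openin T {x \<in> topspace T. f x \<in> U})"

lemma openin_quotient_topology:
  "openin (quotient_topology T f) U \<longleftrightarrow>
     U \<subseteq> f ` topspace T \<and> openin T {x \<in> topspace T. f x \<in> U}"
proof -
  let ?P = "\<lambda>U. U \<subseteq> f ` topspace T \<and> openin T {x \<in> topspace T. f x \<in> U}"
  have "istopology ?P"
    unfolding istopology_def
  proof (intro conjI allI impI)
    fix S S' assume "?P S" "?P S'"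
    moreover have "{x \<in> topspace T. f x \<in> S \<inter> S'} =
        {x \<in> topspace T. f x \<in> S} \<inter> {x \<in> topspace T. f x \<in> S'}" by auto
    ultimately show "S \<inter> S' \<subseteq> f ` topspace T" "openin T {x \<in> topspace T. f x \<in> S \<inter> S'}"
      by auto
  next
    fix \<K> assume "\<forall>S\<in>\<K>. ?P S"
    moreover have "{x \<in> topspace T. f x \<in> \<Union>\<K>} = (\<Union>S\<in>\<K>. {x \<in> topspace T. f x \<in> S})" by auto
    ultimately show "\<Union>\<K> \<subseteq> f ` topspace T" "openin T {x \<in> topspace T. f x \<in> \<Union>\<K>}"
      by auto
  qed
  then show ?thesis
    by (simp add: quotient_topology_def topology_inverse')
qed

text \<open>Points of projective space are the one-dimensional complex subspaces.\<close>

definition proj_space :: "(complex^'n) set topology" where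
  "proj_space = quotient_topology (top_of_set (UNIV - {0})) (\<lambda>v. vec.span {v})"

text \<open>The image of a line is a line, for invertible \<open>A\<close>.\<close>

definition proj_act :: "complex^'n^'n \<Rightarrow> (complex^'n) set \<Rightarrow> (complex^'n) set" where
  "proj_act A x = (*v) A ` x"

definition proj_hyperplane :: "(complex^'n) set set \<Rightarrow> bool" where
  "proj_hyperplane H \<longleftrightarrow>
     (\<exists>a::complex^'n. a \<noteq> 0 \<and> H = {x \<in> topspace proj_space. \<forall>v\<in>x. (\<Sum>i\<in>UNIV. a $ i * v $ i) = 0})"

definition closed_proj_orbit :: "(complex^'n^'n) set \<Rightarrow> (complex^'n) set set \<Rightarrow> bool" where
  "closed_proj_orbit S \<O> \<longleftrightarrow>
     (\<exists>x\<in>topspace proj_space. \<O> = (\<lambda>A. proj_act A x) ` S) \<and> closedin proj_space \<O>"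

definition borel_probability_on :: "(complex^'n) set set \<Rightarrow> (complex^'n) set measure \<Rightarrow> bool" where
  "borel_probability_on \<O> \<gamma> \<longleftrightarrow> prob_space \<gamma> \<and> space \<gamma> = \<O> \<and>
     sets \<gamma> = sigma_sets \<O> {U. openin (subtopology proj_space \<O>) U}"

definition admissible :: "(complex^'n) set set \<Rightarrow> (complex^'n) set measure \<Rightarrow> bool" where
  "admissible \<O> \<gamma> \<longleftrightarrow> (\<forall>H. proj_hyperplane H \<longrightarrow> emeasure \<gamma> (\<O> \<inter> H) = 0)"

definition herm_endos :: "(complex^'n \<Rightarrow> complex^'n \<Rightarrow> complex) \<Rightarrow> (complex^'n^'n) set" where
  "herm_endos h = {A. \<forall>v w. h (A *v v) w = h v (A *v w)}"

text \<open>\<open>span\<close> is the real span (and \<open>vec.span\<close> above the complex one), so the points are real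
  lines.\<close>

definition herm_proj_space ::
  "(complex^'n \<Rightarrow> complex^'n \<Rightarrow> complex) \<Rightarrow> (complex^'n^'n) set topology" where
  "herm_proj_space h = quotient_topology (top_of_set (herm_endos h - {0})) (\<lambda>A. span {A})"

definition h_adjoint ::
  "(complex^'n \<Rightarrow> complex^'n \<Rightarrow> complex) \<Rightarrow> complex^'n^'n \<Rightarrow> complex^'n^'n" where
  "h_adjoint h A = (THE B. \<forall>v w. h (A *v v) w = h v (B *v w))"

definition pos_sqrt ::
  "(complex^'n \<Rightarrow> complex^'n \<Rightarrow> complex) \<Rightarrow> complex^'n^'n \<Rightarrow> complex^'n^'n" where
  "pos_sqrt h A =
     (THE P. P \<in> herm_endos h \<and> (\<forall>v. v \<noteq> 0 \<longrightarrow> Re (h (P *v v) v) > 0) \<and> P ** P = A)"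

text \<open>Here \<open>d\<close> is the action of the Lie algebra, i.e. the differential of the representation.\<close>

definition gradient_map ::
  "(complex^'n \<Rightarrow> complex^'n \<Rightarrow> complex) \<Rightarrow> ('e \<Rightarrow> 'e \<Rightarrow> real) \<Rightarrow> 'e set \<Rightarrow>
    ('e \<Rightarrow> complex^'n^'n) \<Rightarrow> (complex^'n) set \<Rightarrow> 'e" where
  "gradient_map h ip \<pp> d x =
     (THE \<mu>. \<mu> \<in> \<pp> \<and> (\<forall>v\<in>x - {0}. \<forall>\<beta>\<in>\<pp>. complex_of_real (ip \<mu> \<beta>) = h (d \<beta> *v v) v / h v v))"

text \<open>\<open>C\<close> is a left coset of \<open>K\<close>, here and in \<open>bly_map\<close>; if \<open>\<tau>\<close> is unitary on \<open>K\<close>, then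
  \<open>\<tau> g\<close> times its adjoint does not depend on the representative \<open>g\<close>.\<close>

definition satake_embedding ::
  "(complex^'n \<Rightarrow> complex^'n \<Rightarrow> complex) \<Rightarrow> ('g \<Rightarrow> complex^'n^'n) \<Rightarrow> 'g set \<Rightarrow>
    (complex^'n^'n) set" where
  "satake_embedding h \<tau> C = the_elem ((\<lambda>g. span {\<tau> g ** h_adjoint h (\<tau> g)}) ` C)"

definition satake_compactification ::
  "('g, 'm) monoid_scheme \<Rightarrow> 'g set \<Rightarrow> (complex^'n \<Rightarrow> complex^'n \<Rightarrow> complex) \<Rightarrow>
    ('g \<Rightarrow> complex^'n^'n) \<Rightarrow> (complex^'n^'n) set set" where
  "satake_compactification G K h \<tau> =
     herm_proj_space h closure_of (satake_embedding h \<tau> ` (lcosets\<^bsub>G\<^esub> K))"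

definition satake_boundary ::
  "('g, 'm) monoid_scheme \<Rightarrow> 'g set \<Rightarrow> (complex^'n \<Rightarrow> complex^'n \<Rightarrow> complex) \<Rightarrow>
    ('g \<Rightarrow> complex^'n^'n) \<Rightarrow> (complex^'n^'n) set set" where
  "satake_boundary G K h \<tau> =
     satake_compactification G K h \<tau> - satake_embedding h \<tau> ` (lcosets\<^bsub>G\<^esub> K)"

definition bly_map ::
  "(complex^'n \<Rightarrow> complex^'n \<Rightarrow> complex) \<Rightarrow> ('g \<Rightarrow> complex^'n^'n) \<Rightarrow>
    ((complex^'n) set \<Rightarrow> 'e::euclidean_space) \<Rightarrow> (complex^'n) set measure \<Rightarrow> 'g set \<Rightarrow> 'e" where
  "bly_map h \<tau> \<mu> \<gamma> C =
     the_elem ((\<lambda>g. \<integral>x. \<mu> (proj_act (pos_sqrt h (\<tau> g ** h_adjoint h (\<tau> g))) x) \<partial>\<gamma>) ` C)"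

end

theory Submission
  imports Defs
begin

text \<open>
  Everything takes place in matrices. Write \<open>d = d\<tau>\<close> and, for \<open>\<beta> \<in> \<pp>\<close>, \<open>exp (d \<beta>)\<close> for the corresponding
  positive \<open>h\<close>-Hermitian operator. Compatibility and the uniqueness of positive square roots give
  \<open>\<tau> g (\<tau> g)\<^sup>* = exp (d \<beta>)\<^sup>2\<close> for some \<open>\<beta> \<in> \<pp>\<close>, and every \<open>\<beta>\<close> occurs
  (\<open>positive_part\<close>, \<open>positive_part_exists\<close>). Thus \<open>X\<close> is the set of the lines \<open>[exp (d \<beta>)\<^sup>2]\<close>,
  and the Bourguignon-Li-Yau map sends such a line to \<open>F (exp (d \<beta>))\<close>, where
  \<open>F S = \<integral> \<mu> (S x) d\<gamma> x\<close>. The right-hand side makes sense for every \<open>S \<noteq> 0\<close>: the kernel of \<open>S\<close> lies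
  in a hyperplane and so is \<open>\<gamma>\<close>-null. By dominated convergence \<open>F\<close> is continuous away from \<open>0\<close>, and it
  ignores scalars. The Satake compactification is the set of the lines \<open>[S\<^sup>2]\<close> with \<open>S\<close> a limit of
  normalised \<open>exp (d \<beta>)\<close>, and uniqueness of positive square roots makes \<open>S \<mapsto> [S\<^sup>2]\<close> a homeomorphism
  from the compact set of these limits; this is the continuous extension
  (\<open>bary_extends_to_closure\<close>).

  Let \<open>\<E>\<close> be the convex hull of \<open>\<mu> \<O>\<close>. For \<open>\<xi> \<in> \<pp>\<close> the support function of \<open>\<E>\<close> at \<open>\<xi>\<close> is the
  largest eigenvalue \<open>l\<close> of \<open>d \<xi>\<close>: the Rayleigh quotient is at most \<open>l\<close>, and by irreducibility
  some point of \<open>\<O>\<close> is not orthogonal to the top eigenspace, towards which it is pushed by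
  \<open>exp (t d \<xi>)\<close> (\<open>top_le_body_bound\<close>). Three facts follow.

  \<^item> \<open>F (exp (d \<beta>))\<close> is interior. Otherwise a supporting functional \<open>\<xi> \<noteq> 0\<close> would force almost
    every \<open>exp (d \<beta>) x\<close> into the top eigenspace of \<open>d \<xi>\<close>, which is a proper subspace because
    \<open>d \<xi>\<close> is traceless and nonzero; that contradicts admissibility (\<open>bary_exp_interior\<close>).
  \<^item> Boundary points go to the boundary. If \<open>\<beta>\<^sub>n\<close> tends to infinity, then along a subsequence
    \<open>\<beta>\<^sub>n / |\<beta>\<^sub>n|\<close> tends to some \<open>\<xi>\<close> and the normalised \<open>exp (d \<beta>\<^sub>n)\<close> to some \<open>S\<close> with image
    in the top eigenspace of \<open>d \<xi>\<close> (\<open>unit_exp_asymptotics\<close>), so \<open>F S\<close> lies on the supporting hyperplane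
    of \<open>\<E>\<close> with normal \<open>\<xi>\<close> (\<open>bary_at_infinity\<close>).
  \<^item> Every interior point \<open>y\<close> is attained. The same asymptotics show that the vector field
    \<open>\<beta> \<mapsto> F (exp (d \<beta>)) - y\<close> on \<open>\<pp>\<close> points outwards on a large sphere, so that it has a zero by
    Brouwer's theorem (\<open>bary_exp_image\<close>). The closure is then all of \<open>\<E>\<close>, by compactness.

  Semisimplicity enters through the injectivity of \<open>d\<tau>\<close> on \<open>\<pp>\<close> (\<open>differential_injective_on_p\<close>),
  which makes the operators \<open>d \<xi>\<close> above nonzero. It follows from the finiteness of the kernel of
  \<open>\<tau>\<close>, used along the one-parameter subgroups of \<open>K\<close>, and from the positivity of the Killing form on
  \<open>\<pp>\<close>. The operator theory rests on two facts: a top eigenvector maximises the Rayleigh quotient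
  (\<open>hermitian_top_eigenvector\<close>), and \<open>exp (- t N)\<close> pushes vectors into the kernel of a positive
  semidefinite \<open>N\<close> at the rate \<open>1 / t\<close> (\<open>psd_flow_decay\<close>).
\<close>

section \<open>The matrix exponential\<close>

lemma bounded_bilinear_matrix_mult:
  "bounded_bilinear ((**) :: complex^'n^'n \<Rightarrow> complex^'n^'n \<Rightarrow> complex^'n^'n)"
  unfolding bilinear_conv_bounded_bilinear[symmetric] bilinear_def
  by (auto intro!: linearI simp: matrix_matrix_mult_def vec_eq_iff sum.distrib
      distrib_right distrib_left scaleR_right.sum)

lemma bounded_bilinear_matrix_vector_mult:
  "bounded_bilinear ((*v) :: complex^'n^'n \<Rightarrow> complex^'n \<Rightarrow> complex^'n)"
  unfolding bilinear_conv_bounded_bilinear[symmetric] bilinear_def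
  by (auto intro!: linearI simp: matrix_vector_mult_def vec_eq_iff sum.distrib
      distrib_right distrib_left scaleR_right.sum)

interpretation matrix_mult: bounded_bilinear
  "(**) :: complex^'n^'n \<Rightarrow> complex^'n^'n \<Rightarrow> complex^'n^'n"
  by (rule bounded_bilinear_matrix_mult)

interpretation matrix_vector_mult: bounded_bilinear
  "(*v) :: complex^'n^'n \<Rightarrow> complex^'n \<Rightarrow> complex^'n"
  by (rule bounded_bilinear_matrix_vector_mult)

lemma matrix_eqI: "(\<And>v. A *v v = B *v v) \<Longrightarrow> A = (B :: complex^'n^'n)"
  using matrix_eq by blast

definition mat_pow :: "complex^'n^'n \<Rightarrow> nat \<Rightarrow> complex^'n^'n" where
  "mat_pow A k = ((**) A ^^ k) (mat 1)"

lemma mat_pow_0 [simp]: "mat_pow A 0 = mat 1"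
  and mat_pow_Suc: "mat_pow A (Suc k) = A ** mat_pow A k"
  by (simp_all add: mat_pow_def)

lemma mat_pow_commute: "mat_pow A k ** A = A ** mat_pow A k"
  by (induction k) (simp_all add: mat_pow_Suc matrix_mul_assoc[symmetric])

lemma mat_pow_scaleR: "mat_pow (t *\<^sub>R A) k = t ^ k *\<^sub>R mat_pow A k"
  by (induction k) (simp_all add: mat_pow_Suc matrix_mult.scaleR_left matrix_mult.scaleR_right)

lemma mat_pow_norm_bound:
  "\<exists>C>0. \<forall>A::complex^'n^'n. \<forall>k. norm (mat_pow A k) \<le> norm (mat 1 :: complex^'n^'n) * (C * norm A) ^ k"
proof -
  obtain C where C: "C > 0" "\<And>(A::complex^'n^'n) (B::complex^'n^'n). norm (A ** B) \<le> norm A * norm B * C"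
    using matrix_mult.pos_bounded by blast
  have "norm (mat_pow A k) \<le> norm (mat 1 :: complex^'n^'n) * (C * norm A) ^ k" for A :: "complex^'n^'n" and k
  proof (induction k)
    case (Suc k)
    have "norm (mat_pow A (Suc k)) \<le> norm A * norm (mat_pow A k) * C"
      unfolding mat_pow_Suc by (rule C(2))
    also have "\<dots> \<le> norm A * (norm (mat 1 :: complex^'n^'n) * (C * norm A) ^ k) * C"
      using Suc C(1) by (intro mult_right_mono mult_left_mono) auto
    finally show ?case by (simp add: mult_ac)
  qed simp
  with C(1) show ?thesis by (intro exI[of _ C] conjI allI)
qed

lemma mat_exp_norm_summable:
  fixes A :: "complex^'n^'n"
  shows "summable (\<lambda>k. norm ((1 / fact k) *\<^sub>R mat_pow A k))"
proof -
  obtain C where C: "C > 0" and bound: "\<forall>A::complex^'n^'n. \<forall>k. norm (mat_pow A k) \<le> norm (mat 1 :: complex^'n^'n) * (C * norm A) ^ k"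
    using mat_pow_norm_bound by blast
  have "summable (\<lambda>k. norm (mat 1 :: complex^'n^'n) * ((C * norm A) ^ k /\<^sub>R fact k))"
    by (intro summable_mult summable_exp_generic)
  then show ?thesis
  proof (rule summable_comparison_test'[where N=0])
    fix k
    have "norm ((1 / fact k) *\<^sub>R mat_pow A k) = (1 / fact k) * norm (mat_pow A k)" by simp
    also have "\<dots> \<le> (1 / fact k) * (norm (mat 1 :: complex^'n^'n) * (C * norm A) ^ k)"
      by (intro mult_left_mono bound[rule_format]) auto
    finally show "norm (norm ((1 / fact k) *\<^sub>R mat_pow A k)) \<le> norm (mat 1 :: complex^'n^'n) * ((C * norm A) ^ k /\<^sub>R fact k)"
      by (simp add: field_simps)
  qed
qed

lemma mat_exp_sums: "(\<lambda>k. (1 / fact k) *\<^sub>R mat_pow A k) sums mat_exp A"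
  unfolding mat_exp_def mat_pow_def[symmetric]
  by (rule summable_sums[OF summable_norm_cancel[OF mat_exp_norm_summable]])

lemma continuous_on_mat_exp: "continuous_on UNIV (mat_exp :: complex^'n^'n \<Rightarrow> complex^'n^'n)"
proof -
  obtain C where C: "C > 0" and bound: "\<forall>A::complex^'n^'n. \<forall>k. norm (mat_pow A k) \<le> norm (mat 1 :: complex^'n^'n) * (C * norm A) ^ k"
    using mat_pow_norm_bound by blast
  have cont_pow: "continuous_on S (\<lambda>A::complex^'n^'n. mat_pow A k)" for S k
    by (induction k)
      (simp_all add: mat_pow_Suc matrix_mult.continuous_on continuous_on_id)
  have "continuous_on (ball 0 r) (mat_exp :: complex^'n^'n \<Rightarrow> complex^'n^'n)" for r
  proof (rule uniform_limit_theorem)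
    show "uniform_limit (ball 0 r) (\<lambda>n A. \<Sum>k<n. (1 / fact k) *\<^sub>R mat_pow A k)
            (mat_exp :: complex^'n^'n \<Rightarrow> complex^'n^'n) sequentially"
      unfolding mat_exp_def mat_pow_def[symmetric]
    proof (rule Weierstrass_m_test)
      show "summable (\<lambda>k. norm (mat 1 :: complex^'n^'n) * ((C * \<bar>r\<bar>) ^ k /\<^sub>R fact k))"
        by (intro summable_mult summable_exp_generic)
      fix k and A :: "complex^'n^'n" assume A: "A \<in> ball 0 r"
      have "norm ((1 / fact k) *\<^sub>R mat_pow A k) = (1 / fact k) * norm (mat_pow A k)" by simp
      also have "\<dots> \<le> (1 / fact k) * (norm (mat 1 :: complex^'n^'n) * (C * norm A) ^ k)"
        by (intro mult_left_mono bound[rule_format]) auto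
      also have "\<dots> \<le> (1 / fact k) * (norm (mat 1 :: complex^'n^'n) * (C * \<bar>r\<bar>) ^ k)"
        using A C(1) by (intro mult_left_mono power_mono) (auto simp: mult_left_mono)
      finally show "norm ((1 / fact k) *\<^sub>R mat_pow A k) \<le> norm (mat 1 :: complex^'n^'n) * ((C * \<bar>r\<bar>) ^ k /\<^sub>R fact k)"
        by (simp add: field_simps)
    qed
    show "\<forall>\<^sub>F n in sequentially. continuous_on (ball 0 r) (\<lambda>A::complex^'n^'n. \<Sum>k<n. (1 / fact k) *\<^sub>R mat_pow A k)"
      by (intro always_eventually allI continuous_intros cont_pow)
  qed simp
  then have "isCont (mat_exp :: complex^'n^'n \<Rightarrow> complex^'n^'n) A" for A
    using continuous_on_eq_continuous_at[OF open_ball, of 0 "norm A + 1" mat_exp]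
    by (auto simp: less_add_one)
  then show ?thesis by (simp add: continuous_at_imp_continuous_on)
qed

lemma has_vector_derivative_entrywise:
  fixes M :: "real \<Rightarrow> complex^'n^'n"
  assumes "\<And>i j. ((\<lambda>t. M t $ i $ j) has_vector_derivative D $ i $ j) F"
  shows "(M has_vector_derivative D) F"
proof -
  have dec: "B = (\<Sum>i\<in>UNIV. \<Sum>j\<in>UNIV. axis i (axis j (B $ i $ j)))" for B :: "complex^'n^'n"
  proof -
    have "(\<Sum>i\<in>UNIV. \<Sum>j\<in>UNIV. axis i (axis j (B $ i $ j))) $ a $ b
        = (\<Sum>i\<in>UNIV. \<Sum>j\<in>UNIV. if i = a then (if j = b then B $ i $ j else 0) else 0)" for a b
      by (auto simp: axis_def intro!: sum.cong)
    also have "\<dots> a b = B $ a $ b" for a b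
      by (subst sum.swap) (simp add: sum.delta)
    finally show ?thesis by (simp add: vec_eq_iff)
  qed
  have lin: "bounded_linear (\<lambda>z::complex. axis i (axis j z) :: complex^'n^'n)" for i j
    unfolding linear_conv_bounded_linear[symmetric]
    by (rule linearI) (auto simp: axis_def vec_eq_iff)
  have "((\<lambda>t. \<Sum>i\<in>UNIV. \<Sum>j\<in>UNIV. axis i (axis j (M t $ i $ j))) has_vector_derivative
     (\<Sum>i\<in>UNIV. \<Sum>j\<in>UNIV. axis i (axis j (D $ i $ j)))) F"
    by (intro has_vector_derivative_sum bounded_linear.has_vector_derivative[OF lin] assms)
  then show ?thesis by (simp flip: dec)
qed

text \<open>Entrywise the exponential is a complex power series in \<open>t\<close> that converges everywhere, so it may be
  differentiated term by term.\<close>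

lemma mat_exp_has_vector_derivative:
  fixes A :: "complex^'n^'n"
  shows "((\<lambda>t. mat_exp (t *\<^sub>R A)) has_vector_derivative A ** mat_exp (t *\<^sub>R A)) (at t)"
proof (rule has_vector_derivative_entrywise)
  fix i j
  define c where "c k = mat_pow A k $ i $ j / fact k" for k
  have entry: "(\<lambda>k. c k * of_real s ^ k) sums (mat_exp (s *\<^sub>R A) $ i $ j)" for s :: real
  proof -
    have "(\<lambda>k. ((1 / fact k) *\<^sub>R mat_pow (s *\<^sub>R A) k) $ i $ j) sums (mat_exp (s *\<^sub>R A) $ i $ j)"
      by (intro bounded_linear.sums[OF bounded_linear_vec_nth] mat_exp_sums)
    then show ?thesis
      by (simp add: c_def mat_pow_scaleR scaleR_conv_of_real[where 'a=complex] mult_ac)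
  qed
  have summ: "summable (\<lambda>k. c k * z ^ k)" for z :: complex
  proof -
    have "summable (\<lambda>k. norm ((1 / fact k) *\<^sub>R mat_pow (norm z *\<^sub>R A) k))"
      by (rule mat_exp_norm_summable)
    moreover have "norm (c k * z ^ k) \<le> norm ((1 / fact k) *\<^sub>R mat_pow (norm z *\<^sub>R A) k)" for k
    proof -
      have "norm (c k * z ^ k) = norm (((1 / fact k) *\<^sub>R mat_pow (norm z *\<^sub>R A) k) $ i $ j)"
        by (simp add: c_def mat_pow_scaleR norm_mult norm_divide norm_power)
      also have "\<dots> \<le> norm ((1 / fact k) *\<^sub>R mat_pow (norm z *\<^sub>R A) k)"
        by (meson Finite_Cartesian_Product.norm_nth_le order_trans)
      finally show ?thesis .
    qed
    ultimately show ?thesis by (rule summable_comparison_test'[where N=0])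
  qed
  have entry': "(\<lambda>k. diffs c k * of_real t ^ k) sums ((A ** mat_exp (t *\<^sub>R A)) $ i $ j)"
  proof -
    have "(\<lambda>k. (A ** ((1 / fact k) *\<^sub>R mat_pow (t *\<^sub>R A) k)) $ i $ j) sums ((A ** mat_exp (t *\<^sub>R A)) $ i $ j)"
      by (intro bounded_linear.sums[OF bounded_linear_vec_nth] mat_exp_sums
          bounded_linear.sums[OF matrix_mult.bounded_linear_right])
    moreover have "(A ** ((1 / fact k) *\<^sub>R mat_pow (t *\<^sub>R A) k)) $ i $ j = diffs c k * of_real t ^ k" for k
    proof -
      have "A ** ((1 / fact k) *\<^sub>R mat_pow (t *\<^sub>R A) k) = (t ^ k / fact k) *\<^sub>R mat_pow A (Suc k)"
        by (simp add: mat_pow_scaleR mat_pow_Suc matrix_mult.scaleR_left matrix_mult.scaleR_right)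
      moreover have "diffs c k = mat_pow A (Suc k) $ i $ j / fact k"
        by (simp add: diffs_def c_def field_simps del: of_nat_Suc)
      ultimately show ?thesis
        by (simp add: scaleR_conv_of_real[where 'a=complex])
    qed
    ultimately show ?thesis by simp
  qed
  have "((\<lambda>x. \<Sum>n. c n * x ^ n) has_field_derivative (\<Sum>n. diffs c n * of_real t ^ n)) (at (of_real t))"
    by (rule termdiffs_strong_converges_everywhere) (rule summ)
  then have "((\<lambda>s. \<Sum>n. c n * of_real s ^ n) has_vector_derivative (\<Sum>n. diffs c n * of_real t ^ n)) (at t)"
    by (rule has_vector_derivative_real_field)
  moreover have "(\<Sum>n. c n * of_real s ^ n) = mat_exp (s *\<^sub>R A) $ i $ j" for s :: real
    using entry sums_unique by metis
  moreover have "(\<Sum>n. diffs c n * of_real t ^ n) = (A ** mat_exp (t *\<^sub>R A)) $ i $ j"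
    using entry' sums_unique by metis
  ultimately show "((\<lambda>s. mat_exp (s *\<^sub>R A) $ i $ j) has_vector_derivative (A ** mat_exp (t *\<^sub>R A)) $ i $ j) (at t)"
    by simp
qed

lemma mat_exp_commute:
  fixes A :: "complex^'n^'n"
  shows "mat_exp (t *\<^sub>R A) ** A = A ** mat_exp (t *\<^sub>R A)"
proof -
  have "(\<lambda>k. ((1 / fact k) *\<^sub>R mat_pow (t *\<^sub>R A) k) ** A) sums (mat_exp (t *\<^sub>R A) ** A)"
    by (intro bounded_linear.sums[OF matrix_mult.bounded_linear_left] mat_exp_sums)
  moreover have "(\<lambda>k. A ** ((1 / fact k) *\<^sub>R mat_pow (t *\<^sub>R A) k)) sums (A ** mat_exp (t *\<^sub>R A))"
    by (intro bounded_linear.sums[OF matrix_mult.bounded_linear_right] mat_exp_sums)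
  moreover have "((1 / fact k) *\<^sub>R mat_pow (t *\<^sub>R A) k) ** A = A ** ((1 / fact k) *\<^sub>R mat_pow (t *\<^sub>R A) k)" for k
    by (simp add: mat_pow_scaleR matrix_mult.scaleR_left matrix_mult.scaleR_right mat_pow_commute)
  ultimately show ?thesis by (simp only: sums_unique2)
qed

lemma mat_exp_0 [simp]: "mat_exp (0 :: complex^'n^'n) = mat 1"
proof -
  have "(1 / fact k) *\<^sub>R mat_pow (0::complex^'n^'n) k = (if k = 0 then mat 1 else 0)" for k
    by (cases k) (auto simp: mat_pow_Suc)
  then show ?thesis
    using mat_exp_sums[of "0::complex^'n^'n"] sums_single[of 0 "\<lambda>_. mat 1 :: complex^'n^'n"]
    by (simp only: sums_unique2)
qed

text \<open>The derivative of the left-hand side in \<open>t\<close> vanishes, so its value at \<open>t = 0\<close> is the only one.\<close>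

lemma mat_exp_add_aux:
  fixes A :: "complex^'n^'n"
  shows "mat_exp ((-t) *\<^sub>R A) ** mat_exp ((t + s) *\<^sub>R A) = mat_exp (s *\<^sub>R A)"
proof -
  let ?f = "\<lambda>t. mat_exp ((-t) *\<^sub>R A) ** mat_exp ((t + s) *\<^sub>R A)"
  have "(?f has_vector_derivative 0) (at t)" for t
  proof -
    have 1: "((\<lambda>t. mat_exp ((-t) *\<^sub>R A)) has_vector_derivative ((-1) *\<^sub>R (A ** mat_exp ((-t) *\<^sub>R A)))) (at t)"
    proof -
      have "((\<lambda>t::real. - t) has_vector_derivative -1) (at t)"
        by (auto intro!: derivative_eq_intros simp flip: has_real_derivative_iff_has_vector_derivative)
      from vector_diff_chain_at[OF this mat_exp_has_vector_derivative] show ?thesis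
        by (simp add: o_def)
    qed
    have 2: "((\<lambda>t. mat_exp ((t + s) *\<^sub>R A)) has_vector_derivative (1 *\<^sub>R (A ** mat_exp ((t + s) *\<^sub>R A)))) (at t)"
    proof -
      have "((\<lambda>t::real. t + s) has_vector_derivative 1) (at t)"
        by (auto intro!: derivative_eq_intros simp flip: has_real_derivative_iff_has_vector_derivative)
      from vector_diff_chain_at[OF this mat_exp_has_vector_derivative] show ?thesis
        by (simp add: o_def)
    qed
    have "mat_exp ((-t) *\<^sub>R A) ** (1 *\<^sub>R (A ** mat_exp ((t + s) *\<^sub>R A)))
        + ((-1) *\<^sub>R (A ** mat_exp ((-t) *\<^sub>R A))) ** mat_exp ((t + s) *\<^sub>R A) = 0"
      using mat_exp_commute[of "-t" A]
      by (simp add: matrix_mul_assoc matrix_mult.minus_left)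
    then show ?thesis
      using matrix_mult.has_vector_derivative[OF 1 2] by simp
  qed
  then have "(?f has_derivative (\<lambda>h. 0)) (at t)" for t
    by (simp add: has_vector_derivative_def)
  then have "?f t = ?f 0"
    by (intro has_derivative_zero_unique[of UNIV ?f]) auto
  then show ?thesis by simp
qed

lemma mat_exp_minus_left: "mat_exp ((-t) *\<^sub>R A) ** mat_exp (t *\<^sub>R A) = mat 1"
  using mat_exp_add_aux[of t A 0] by simp

lemma mat_exp_minus_right: "mat_exp (t *\<^sub>R A) ** mat_exp ((-t) *\<^sub>R A) = mat 1"
  using mat_exp_minus_left[of "-t" A] by simp

lemma mat_exp_add: "mat_exp (t *\<^sub>R A) ** mat_exp (s *\<^sub>R A) = mat_exp ((t + s) *\<^sub>R A)"
proof -
  have "mat_exp (t *\<^sub>R A) ** mat_exp (s *\<^sub>R A)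
      = (mat_exp (t *\<^sub>R A) ** mat_exp ((-t) *\<^sub>R A)) ** mat_exp ((t + s) *\<^sub>R A)"
    by (simp only: mat_exp_add_aux[of t A s, symmetric] matrix_mul_assoc)
  then show ?thesis by (simp only: mat_exp_minus_right matrix_mul_lid)
qed

section \<open>Hermitian forms and positive operators\<close>

locale hermitian_form =
  fixes h :: "complex^'n \<Rightarrow> complex^'n \<Rightarrow> complex"
  assumes hermitian: "hermitian_scalar_product h"
begin

lemma h_add_left: "h (u + v) w = h u w + h v w"
  and h_scale_left: "h (a *s u) v = a * h u v"
  and h_cnj: "h u v = cnj (h v u)"
  and h_pos: "u \<noteq> 0 \<Longrightarrow> Re (h u u) > 0"
  using hermitian unfolding hermitian_scalar_product_def by blast+

lemma h_add_right: "h w (u + v) = h w u + h w v"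
  by (metis h_add_left h_cnj complex_cnj_add)

lemma h_scale_right: "h u (a *s v) = cnj a * h u v"
  by (metis h_scale_left h_cnj complex_cnj_mult)

lemma bounded_bilinear_h: "bounded_bilinear h"
proof -
  have sR: "r *\<^sub>R v = complex_of_real r *s v" for r and v :: "complex^'n"
    by (simp add: vec_eq_iff scaleR_conv_of_real[where 'a=complex])
  show ?thesis
    unfolding bilinear_conv_bounded_bilinear[symmetric] bilinear_def
    by (auto intro!: linearI
        simp: h_add_left h_add_right sR h_scale_left h_scale_right scaleR_conv_of_real[where 'a=complex])
qed

sublocale h: bounded_bilinear h
  by (rule bounded_bilinear_h)

text \<open>The square of the norm defined by \<open>h\<close>.\<close>

definition hn :: "complex^'n \<Rightarrow> real" where
  "hn v = Re (h v v)"

lemma h_self: "h v v = of_real (hn v)"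
  using h_cnj[of v v] by (simp add: hn_def complex_eq_iff)

lemma hn_pos: "v \<noteq> 0 \<Longrightarrow> hn v > 0"
  by (simp add: hn_def h_pos)

lemma hn_0 [simp]: "hn 0 = 0"
  by (simp add: hn_def h.zero_left)

lemma hn_nonneg: "hn v \<ge> 0"
  using hn_pos[of v] by (cases "v = 0") auto

lemma hn_eq_0 [simp]: "hn v = 0 \<longleftrightarrow> v = 0"
  using hn_pos[of v] by (cases "v = 0") auto

lemma hn_scale: "hn (a *s v) = (cmod a)\<^sup>2 * hn v"
proof -
  have "h (a *s v) (a *s v) = (a * cnj a) * h v v"
    by (simp add: h_scale_left h_scale_right)
  also have "\<dots> = of_real ((cmod a)\<^sup>2 * hn v)"
    by (simp only: h_self[of v] complex_norm_square[symmetric] of_real_mult)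
  finally show ?thesis by (simp add: hn_def)
qed

lemma hn_scaleR: "hn (r *\<^sub>R v) = r\<^sup>2 * hn v"
  by (simp add: hn_def h.scaleR_left h.scaleR_right power2_eq_square mult.assoc)

lemma continuous_on_hn: "continuous_on S hn"
  unfolding hn_def[abs_def] by (intro continuous_intros h.continuous_on)

lemma hn_lower_bound: "\<exists>m>0. \<forall>v. m * (norm v)\<^sup>2 \<le> hn v"
proof -
  have "compact (sphere (0::complex^'n) 1)" by simp
  moreover have "sphere (0::complex^'n) 1 \<noteq> {}" by simp
  ultimately have "\<exists>u\<in>sphere (0::complex^'n) 1. \<forall>v\<in>sphere 0 1. hn u \<le> hn v"
    by (rule continuous_attains_inf[OF _ _ continuous_on_hn])
  then obtain u where u: "u \<in> sphere (0::complex^'n) 1" "\<And>v. v \<in> sphere 0 1 \<Longrightarrow> hn u \<le> hn v"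
    by blast
  have "hn u * (norm v)\<^sup>2 \<le> hn v" for v
  proof (cases "v = 0")
    case False
    then have "hn u \<le> hn ((1 / norm v) *\<^sub>R v)" by (intro u(2)) auto
    then show ?thesis using False by (simp add: hn_scaleR field_simps power2_eq_square)
  qed simp
  moreover have "hn u > 0" using u(1) by (intro hn_pos) auto
  ultimately show ?thesis by blast
qed

lemma herm_endosD: "N \<in> herm_endos h \<Longrightarrow> h (N *v v) w = h v (N *v w)"
  by (simp add: herm_endos_def)

lemma herm_endos_add: "M \<in> herm_endos h \<Longrightarrow> N \<in> herm_endos h \<Longrightarrow> M + N \<in> herm_endos h"
  by (simp add: herm_endos_def matrix_vector_mult_add_rdistrib h_add_left h_add_right)

lemma herm_endos_scaleR: "N \<in> herm_endos h \<Longrightarrow> r *\<^sub>R N \<in> herm_endos h"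
  by (simp add: herm_endos_def matrix_vector_mult.scaleR_left h.scaleR_left h.scaleR_right)

lemma herm_endos_0: "0 \<in> herm_endos h"
  by (simp add: herm_endos_def h.zero_left h.zero_right)

lemma herm_endos_mat_1: "mat 1 \<in> herm_endos h"
  by (simp add: herm_endos_def)

lemma herm_endos_diff: "M \<in> herm_endos h \<Longrightarrow> N \<in> herm_endos h \<Longrightarrow> M - N \<in> herm_endos h"
  by (simp add: herm_endos_def matrix_vector_mult_diff_rdistrib h.diff_left h.diff_right)

lemma herm_endos_square: "N \<in> herm_endos h \<Longrightarrow> N ** N \<in> herm_endos h"
  by (simp add: herm_endos_def matrix_vector_mul_assoc[symmetric])

lemma closed_herm_endos: "closed (herm_endos h)"
proof -
  have "herm_endos h = (\<Inter>v w. {A. h (A *v v) w = h v (A *v w)})"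
    by (auto simp: herm_endos_def)
  moreover have "closed {A. h (A *v v) w = h v (A *v w)}" for v w
    by (intro closed_Collect_eq h.continuous_on matrix_vector_mult.continuous_on continuous_intros)
  ultimately show ?thesis by (auto intro!: closed_INT)
qed

lemma herm_form_real: "N \<in> herm_endos h \<Longrightarrow> h (N *v v) v = of_real (Re (h (N *v v) v))"
  using h_cnj[of "N *v v" v] by (simp add: herm_endosD complex_eq_iff)

definition psd :: "(complex^'n^'n) set" where
  "psd = {N \<in> herm_endos h. \<forall>v. 0 \<le> Re (h (N *v v) v)}"

lemma psd_herm: "N \<in> psd \<Longrightarrow> N \<in> herm_endos h"
  and psd_nonneg: "N \<in> psd \<Longrightarrow> 0 \<le> Re (h (N *v v) v)"
  by (auto simp: psd_def)

lemma closed_psd: "closed psd"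
proof -
  have "psd = herm_endos h \<inter> (\<Inter>v. {A. 0 \<le> Re (h (A *v v) v)})"
    by (auto simp: psd_def)
  moreover have "closed {A. 0 \<le> Re (h (A *v v) v)}" for v
    by (intro closed_Collect_le h.continuous_on matrix_vector_mult.continuous_on continuous_intros)
  ultimately show ?thesis using closed_herm_endos by (auto intro!: closed_INT closed_Int)
qed

lemma psd_scaleR: "N \<in> psd \<Longrightarrow> r \<ge> 0 \<Longrightarrow> r *\<^sub>R N \<in> psd"
  by (auto simp: psd_def herm_endos_scaleR matrix_vector_mult.scaleR_left h.scaleR_left)

text \<open>The vectors on which a semidefinite form vanishes are minima of the form, hence critical points. The
  proof moves from \<open>v\<close> in the direction \<open>N v\<close>.\<close>

lemma psd_kernel:
  assumes N: "N \<in> psd" and zero: "Re (h (N *v v) v) = 0"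
  shows "N *v v = 0"
proof -
  define w where "w = N *v v"
  define a b where "a = hn w" and "b = Re (h (N *v w) w)"
  have a0: "a \<ge> 0" and b0: "b \<ge> 0" using N by (auto simp: a_def b_def hn_nonneg psd_nonneg)
  \<comment> \<open>small enough that the linear term beats the quadratic one for every \<open>b \<ge> 0\<close>\<close>
  define s where "s = a / (b + 1)"
  have vw: "Re (h (N *v w) v) = a" "Re (h (N *v v) w) = a"
    by (auto simp: a_def hn_def w_def herm_endosD[OF psd_herm[OF N]])
  have "0 \<le> Re (h (N *v (v - s *\<^sub>R w)) (v - s *\<^sub>R w))"
    using N by (rule psd_nonneg)
  also have "\<dots> = - 2 * s * a + s\<^sup>2 * b"
    using zero vw
    by (simp add: matrix_vector_mult_diff_distrib matrix_vector_mult.scaleR_right h.diff_left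
        h.diff_right h.scaleR_left h.scaleR_right b_def power2_eq_square algebra_simps)
  finally have 1: "2 * s * a \<le> s\<^sup>2 * b" by simp
  have "a = 0"
  proof (rule ccontr)
    assume "a \<noteq> 0"
    then have s: "s > 0" using a0 b0 by (simp add: s_def)
    then have "2 * a \<le> s * b" using 1 by (simp add: power2_eq_square)
    also have "\<dots> \<le> a" using a0 b0 by (simp add: s_def field_simps)
    finally show False using a0 \<open>a \<noteq> 0\<close> by simp
  qed
  then show ?thesis by (simp add: a_def w_def)
qed

text \<open>The eigenvector is a maximiser of the Rayleigh quotient; at the maximum \<open>l\<close> the operator
  \<open>l - A\<close> is positive semidefinite and its form vanishes at the maximiser.\<close>

lemma hermitian_top_eigenvector:
  assumes A: "A \<in> herm_endos h"
  obtains l v where "v \<noteq> 0" "A *v v = l *\<^sub>R v" "l *\<^sub>R mat 1 - A \<in> psd"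
proof -
  have c: "continuous_on (sphere 0 1) (\<lambda>v. Re (h (A *v v) v) / hn v)"
    by (intro continuous_intros h.continuous_on matrix_vector_mult.continuous_on continuous_on_hn) auto
  have "compact (sphere (0::complex^'n) 1)" "sphere (0::complex^'n) 1 \<noteq> {}" by simp_all
  then have "\<exists>u\<in>sphere (0::complex^'n) 1. \<forall>v\<in>sphere 0 1.
      Re (h (A *v v) v) / hn v \<le> Re (h (A *v u) u) / hn u"
    by (rule continuous_attains_sup[OF _ _ c])
  then obtain u where u: "u \<in> sphere (0::complex^'n) 1"
    "\<And>v. v \<in> sphere 0 1 \<Longrightarrow> Re (h (A *v v) v) / hn v \<le> Re (h (A *v u) u) / hn u"
    by blast
  define l where "l = Re (h (A *v u) u) / hn u"
  have N: "l *\<^sub>R mat 1 - A \<in> psd"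
  proof -
    have "0 \<le> Re (h ((l *\<^sub>R mat 1 - A) *v v) v)" for v
    proof (cases "v = 0")
      case False
      have "Re (h (A *v ((1 / norm v) *\<^sub>R v)) ((1 / norm v) *\<^sub>R v)) / hn ((1 / norm v) *\<^sub>R v) \<le> l"
        unfolding l_def using False by (intro u(2)) auto
      then have "Re (h (A *v v) v) / hn v \<le> l"
        using False by (simp add: matrix_vector_mult.scaleR_right h.scaleR_left h.scaleR_right
            hn_scaleR power2_eq_square)
      then have "Re (h (A *v v) v) \<le> l * hn v"
        using hn_pos[OF False] by (simp add: field_simps)
      then show ?thesis
        by (simp add: matrix_vector_mult_diff_rdistrib matrix_vector_mult.scaleR_left h.diff_left
            h.scaleR_left hn_def)
    qed (simp add: h.zero_right)
    then show ?thesis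
      using A by (auto simp: psd_def intro: herm_endos_diff herm_endos_scaleR herm_endos_mat_1)
  qed
  have u0: "u \<noteq> 0" using u(1) by auto
  have "Re (h ((l *\<^sub>R mat 1 - A) *v u) u) = 0"
    using u0 by (simp add: matrix_vector_mult_diff_rdistrib matrix_vector_mult.scaleR_left h.diff_left
            h.scaleR_left hn_def[symmetric] l_def)
  then have "(l *\<^sub>R mat 1 - A) *v u = 0" by (rule psd_kernel[OF N])
  then have "A *v u = l *\<^sub>R u"
    by (simp add: matrix_vector_mult_diff_rdistrib matrix_vector_mult.scaleR_left)
  then show ?thesis using u0 N that by blast
qed

text \<open>For \<open>D = S - T\<close> equality of the squares means \<open>S D + D T = 0\<close>. Evaluated at an eigenvector of \<open>D\<close>
  with eigenvalue \<open>l \<noteq> 0\<close> this makes the forms of \<open>S\<close> and \<open>T\<close> vanish there, hence \<open>S v = T v = 0\<close> and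
  \<open>D v = 0\<close>. So the top eigenvalue of \<open>D\<close> is \<open>0\<close>.\<close>

lemma psd_sqrt_unique_aux:
  assumes S: "S \<in> psd" and T: "T \<in> psd" and eq: "S ** S = T ** T"
  shows "T - S \<in> psd"
proof -
  define D where "D = S - T"
  have D: "D \<in> herm_endos h" using S T by (simp add: D_def herm_endos_diff psd_herm)
  then obtain l v where v: "v \<noteq> 0" "D *v v = l *\<^sub>R v" "l *\<^sub>R mat 1 - D \<in> psd"
    by (rule hermitian_top_eigenvector)
  have "l = 0"
  proof (rule ccontr)
    assume l: "l \<noteq> 0"
    have "S ** D + D ** T = 0"
      by (simp add: D_def matrix_mult.diff_left matrix_mult.diff_right eq)
    then have "h ((S ** D + D ** T) *v v) v = 0" by (simp add: h.zero_left)
    moreover have "h ((S ** D + D ** T) *v v) v = h (S *v (D *v v)) v + h (T *v v) (D *v v)"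
      by (simp add: matrix_vector_mult_add_rdistrib matrix_vector_mul_assoc[symmetric] h_add_left
          herm_endosD[OF D])
    ultimately have "l * (Re (h (S *v v) v) + Re (h (T *v v) v)) = 0"
      by (simp add: v(2) matrix_vector_mult.scaleR_right h.scaleR_left h.scaleR_right complex_eq_iff
          distrib_left)
    then have "Re (h (S *v v) v) = 0" "Re (h (T *v v) v) = 0"
      using l psd_nonneg[OF S, of v] psd_nonneg[OF T, of v] by auto
    then have "S *v v = 0" "T *v v = 0" using psd_kernel S T by auto
    then have "D *v v = 0" by (simp add: D_def matrix_vector_mult_diff_rdistrib)
    then show False using v l by simp
  qed
  then show ?thesis using v(3) by (simp add: D_def)
qed

lemma psd_sqrt_unique:
  assumes "S \<in> psd" "T \<in> psd" "S ** S = T ** T"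
  shows "S = T"
proof -
  have 1: "T - S \<in> psd" and 2: "S - T \<in> psd"
    using psd_sqrt_unique_aux assms by metis+
  have "(T - S) *v v = 0" for v
  proof (rule psd_kernel[OF 1])
    show "Re (h ((T - S) *v v) v) = 0"
      using psd_nonneg[OF 1, of v] psd_nonneg[OF 2, of v]
      by (simp add: matrix_vector_mult_diff_rdistrib h.diff_left)
  qed
  then have "(T - S) *v v = 0 *v v" for v by simp
  then have "T - S = 0" by (rule matrix_eqI)
  then show ?thesis by simp
qed

lemma mat_pow_vec_commute: "mat_pow A k *v (A *v w) = A *v (mat_pow A k *v w)"
  by (simp only: matrix_vector_mul_assoc mat_pow_commute)

lemma herm_endos_mat_pow: "A \<in> herm_endos h \<Longrightarrow> mat_pow A k \<in> herm_endos h"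
proof (induction k)
  case (Suc k)
  have "h ((A ** mat_pow A k) *v v) w = h v ((mat_pow A k ** A) *v w)" for v w
    using Suc by (simp add: matrix_vector_mul_assoc[symmetric] herm_endosD mat_pow_vec_commute)
  then show ?case by (simp add: herm_endos_def mat_pow_Suc mat_pow_commute)
qed (simp add: herm_endos_mat_1)

lemma mat_exp_form_sums:
  "(\<lambda>k. (1 / fact k) *\<^sub>R h (mat_pow A k *v v) w) sums h (mat_exp A *v v) w"
proof -
  have "(\<lambda>k. h (((1 / fact k) *\<^sub>R mat_pow A k) *v v) w) sums h (mat_exp A *v v) w"
    by (intro bounded_linear.sums[OF h.bounded_linear_left]
        bounded_linear.sums[OF matrix_vector_mult.bounded_linear_left] mat_exp_sums)
  then show ?thesis by (simp add: matrix_vector_mult.scaleR_left h.scaleR_left)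
qed

lemma herm_endos_mat_exp:
  assumes A: "A \<in> herm_endos h"
  shows "mat_exp A \<in> herm_endos h"
proof -
  have fin: "(\<Sum>k<m. (1 / fact k) *\<^sub>R mat_pow A k) \<in> herm_endos h" for m
    by (induction m)
      (auto intro!: herm_endos_add herm_endos_scaleR herm_endos_mat_pow A herm_endos_0)
  show ?thesis
    by (rule closed_sequentially[OF closed_herm_endos fin mat_exp_sums[of A, unfolded sums_def]])
qed

lemma mat_exp_inverse: "mat_exp (- A) ** mat_exp A = mat 1"
  using mat_exp_minus_left[of 1 A] by simp

lemma mat_exp_vec_eq_0: "mat_exp (A::complex^'n^'n) *v v = 0 \<longleftrightarrow> v = 0"
proof
  assume "mat_exp A *v v = 0"
  then have "mat_exp (- A) *v (mat_exp A *v v) = 0" by simp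
  then show "v = 0" by (simp only: matrix_vector_mul_assoc mat_exp_inverse matrix_vector_mul_lid)
qed simp

lemma mat_exp_half: "mat_exp ((1/2) *\<^sub>R A) ** mat_exp ((1/2) *\<^sub>R A) = mat_exp A"
  using mat_exp_add[of "1/2" A "1/2"] by simp

lemma mat_exp_form:
  assumes A: "A \<in> herm_endos h"
  shows "Re (h (mat_exp A *v v) v) = hn (mat_exp ((1/2) *\<^sub>R A) *v v)"
  unfolding hn_def mat_exp_half[of A, symmetric]
  by (simp add: matrix_vector_mul_assoc[symmetric] herm_endosD[OF herm_endos_mat_exp[OF herm_endos_scaleR[OF A]]])

lemma mat_exp_posdef: "A \<in> herm_endos h \<Longrightarrow> v \<noteq> 0 \<Longrightarrow> 0 < Re (h (mat_exp A *v v) v)"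
  by (simp add: mat_exp_form hn_pos mat_exp_vec_eq_0)

lemma mat_exp_psd: "A \<in> herm_endos h \<Longrightarrow> mat_exp A \<in> psd"
  by (simp add: psd_def herm_endos_mat_exp mat_exp_form hn_nonneg)

lemma pos_sqrt_mat_exp:
  assumes A: "A \<in> herm_endos h"
  shows "pos_sqrt h (mat_exp A ** mat_exp A) = mat_exp A"
  unfolding pos_sqrt_def
proof (rule the_equality)
  show "mat_exp A \<in> herm_endos h \<and> (\<forall>v. v \<noteq> 0 \<longrightarrow> 0 < Re (h (mat_exp A *v v) v)) \<and>
      mat_exp A ** mat_exp A = mat_exp A ** mat_exp A"
    using A by (simp add: herm_endos_mat_exp mat_exp_posdef)
  fix P assume P: "P \<in> herm_endos h \<and> (\<forall>v. v \<noteq> 0 \<longrightarrow> 0 < Re (h (P *v v) v)) \<and>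
      P ** P = mat_exp A ** mat_exp A"
  have "0 \<le> Re (h (P *v v) v)" for v
    using P by (cases "v = 0") (auto simp: h.zero_right less_imp_le)
  with P have "P \<in> psd" by (simp add: psd_def)
  then show "P = mat_exp A"
    using P by (auto dest: psd_sqrt_unique[OF _ mat_exp_psd[OF A]])
qed

lemma psd_mat_pow_form: "N \<in> psd \<Longrightarrow> 0 \<le> Re (h (mat_pow N k *v w) w)"
proof (induction k arbitrary: w rule: induct_nat_012)
  case 0
  then show ?case using hn_nonneg[of w] by (simp add: hn_def)
next
  case 1
  then show ?case by (simp add: mat_pow_Suc psd_nonneg)
next
  case (ge2 k)
  have "mat_pow N (Suc (Suc k)) *v w = N *v (mat_pow N k *v (N *v w))"
    by (simp only: mat_pow_vec_commute mat_pow_Suc matrix_vector_mul_assoc[symmetric])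
  then show ?case using ge2 by (simp add: herm_endosD[OF psd_herm])
qed

text \<open>The quantitative form of the fact that \<open>exp (- t N) v\<close> tends to the kernel of \<open>N\<close>. With
  \<open>w = exp (- t N) v\<close>, the square norm of \<open>v\<close> is the form of \<open>exp (2 t N)\<close> at \<open>w\<close>. All terms of that
  exponential series are nonnegative, and the first two already give the bound.\<close>

lemma psd_flow_decay:
  assumes N: "N \<in> psd" and t: "t \<ge> 0"
  shows "2 * t * Re (h (N *v (mat_exp ((-t) *\<^sub>R N) *v v)) (mat_exp ((-t) *\<^sub>R N) *v v)) \<le> hn v"
proof -
  define w where "w = mat_exp ((-t) *\<^sub>R N) *v v"
  have v: "v = mat_exp (t *\<^sub>R N) *v w"
    by (simp only: w_def matrix_vector_mul_assoc mat_exp_minus_right matrix_vector_mul_lid)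
  have H: "(2 * t) *\<^sub>R N \<in> herm_endos h" using N by (simp add: psd_herm herm_endos_scaleR)
  have hv: "hn v = Re (h (mat_exp ((2 * t) *\<^sub>R N) *v w) w)"
    unfolding mat_exp_form[OF H] by (simp add: v)
  have P: "(2 * t) *\<^sub>R N \<in> psd" using N t by (intro psd_scaleR) auto
  define f where "f k = Re ((1 / fact k) *\<^sub>R h (mat_pow ((2 * t) *\<^sub>R N) k *v w) w)" for k
  have f: "f sums hn v"
    unfolding f_def hv by (intro bounded_linear.sums[OF bounded_linear_Re] mat_exp_form_sums)
  have nn: "f k \<ge> 0" for k
    unfolding f_def using psd_mat_pow_form[OF P] by simp
  have "sum f {..<2} \<le> hn v"
    using sum_le_suminf[of f "{..<2}"] f nn by (simp add: sums_iff)
  moreover have "sum f {..<2} = hn w + 2 * t * Re (h (N *v w) w)"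
    by (simp add: f_def numeral_2_eq_2 mat_pow_Suc hn_def matrix_vector_mult.scaleR_left h.scaleR_left)
  ultimately have "hn w + 2 * t * Re (h (N *v w) w) \<le> hn v" by simp
  then show ?thesis using hn_nonneg[of w] by (simp add: w_def)
qed

lemma mat_exp_fixes_kernel:
  assumes "N *v v = 0"
  shows "mat_exp (t *\<^sub>R N) *v v = v"
proof -
  have "mat_pow (t *\<^sub>R N) k *v v = (if k = 0 then v else 0)" for k
  proof (cases k)
    case (Suc j)
    have "mat_pow (t *\<^sub>R N) k *v v = t ^ k *\<^sub>R (mat_pow N j *v (N *v v))"
      by (simp add: Suc mat_pow_scaleR mat_pow_Suc matrix_vector_mult.scaleR_left
          matrix_vector_mult.scaleR_right matrix_vector_mul_assoc[symmetric] mat_pow_vec_commute)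
    then show ?thesis using assms Suc by simp
  qed simp
  then have "((1 / fact k) *\<^sub>R mat_pow (t *\<^sub>R N) k) *v v = (if k = 0 then v else 0)" for k
    by (simp add: matrix_vector_mult.scaleR_left)
  then have "(\<lambda>k. if k = 0 then v else 0) sums (mat_exp (t *\<^sub>R N) *v v)"
    using bounded_linear.sums[OF matrix_vector_mult.bounded_linear_left mat_exp_sums[of "t *\<^sub>R N"], of v]
    by simp
  then show ?thesis using sums_single[of 0 "\<lambda>_. v"] by (simp add: sums_unique2)
qed

end

section \<open>The moment map on projective space and its averages\<close>

lemma openin_proj_space:
  "openin proj_space U \<longleftrightarrow>
     U \<subseteq> (\<lambda>v. vec.span {v}) ` (UNIV - {0}) \<and> open {v::complex^'n. v \<noteq> 0 \<and> vec.span {v} \<in> U}"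
proof -
  have "open (UNIV - {0::complex^'n})" by (simp add: open_Diff)
  moreover have "{x \<in> UNIV - {0}. vec.span {x} \<in> U} = {v. v \<noteq> 0 \<and> vec.span {v} \<in> U}" by auto
  ultimately show ?thesis
    unfolding proj_space_def openin_quotient_topology
    by (auto simp: openin_open_eq)
qed

lemma topspace_proj_space: "topspace proj_space = (\<lambda>v::complex^'n. vec.span {v}) ` (UNIV - {0})"
proof -
  have "openin proj_space ((\<lambda>v::complex^'n. vec.span {v}) ` (UNIV - {0}))"
    unfolding openin_proj_space
  proof
    have "{v::complex^'n. v \<noteq> 0 \<and> vec.span {v} \<in> (\<lambda>v. vec.span {v}) ` (UNIV - {0})} = UNIV - {0}"
      by auto
    then show "open {v::complex^'n. v \<noteq> 0 \<and> vec.span {v} \<in> (\<lambda>v. vec.span {v}) ` (UNIV - {0})}"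
      by (simp add: open_Diff)
  qed simp
  then show ?thesis
    using openin_subset openin_topspace openin_proj_space by blast
qed

text \<open>Points of projective space are lines. Functions on it are written through a chosen nonzero vector of
  each line; everything below that is integrated does not depend on the choice.\<close>

definition rep :: "(complex^'n) set \<Rightarrow> complex^'n" where
  "rep x = (SOME v. v \<noteq> 0 \<and> v \<in> x)"

lemma rep_props:
  assumes "x \<in> topspace proj_space"
  shows "rep x \<noteq> 0" "rep x \<in> x"
proof -
  obtain v where "v \<noteq> 0" "x = vec.span {v}" using assms by (auto simp: topspace_proj_space)
  then have "\<exists>v. v \<noteq> 0 \<and> v \<in> x" using vec.span_base by blast
  then show "rep x \<noteq> 0" "rep x \<in> x" unfolding rep_def by (metis (mono_tags, lifting) someI_ex)+
qed

text \<open>Changes of representative are scalings, which is how independence of the choice is checked.\<close>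

lemma rep_span:
  assumes "v \<noteq> 0"
  obtains a where "a \<noteq> 0" "rep (vec.span {v}) = a *s v"
proof -
  have "vec.span {v} \<in> topspace proj_space" using assms by (auto simp: topspace_proj_space)
  note r = rep_props[OF this]
  then obtain a where "rep (vec.span {v}) = a *s v" by (auto simp: vec.span_singleton)
  with r that show thesis by auto
qed

lemma span_rep: "x \<in> topspace proj_space \<Longrightarrow> x = vec.span {rep x}"
proof -
  assume x: "x \<in> topspace proj_space"
  then obtain v where v: "v \<noteq> 0" "x = vec.span {v}" by (auto simp: topspace_proj_space)
  obtain a where a: "a \<noteq> 0" "rep x = a *s v" using rep_span[OF v(1)] v(2) by metis
  have "range (\<lambda>k. k *s v) = range (\<lambda>k. k *s (a *s v))"
  proof -
    have "k *s v \<in> range (\<lambda>k. k *s (a *s v))" for k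
      using a by (intro image_eqI[of _ _ "k / a"]) (auto simp: vector_smult_assoc)
    then show ?thesis by (auto simp: vector_smult_assoc)
  qed
  then show ?thesis using v a by (simp add: vec.span_singleton)
qed

lemma proj_act_span: "proj_act A (vec.span {v}) = vec.span {A *v v}"
  by (simp add: proj_act_def vec.span_singleton image_image vec.scale)

text \<open>The part of the situation that the convexity arguments see: a real vector space \<open>\<pp>\<close> of traceless
  Hermitian operators, a closed set \<open>\<O>\<close> of lines that is stable under their exponentials and spans the
  space, and an admissible probability measure on it. The Euclidean scalar product of the ambient
  space of \<open>\<pp>\<close> is used; other scalar products are reached through an isomorphism at the end.\<close>

locale moment_setting = hermitian_form h
  for h :: "complex^'n \<Rightarrow> complex^'n \<Rightarrow> complex" +
  fixes \<pp> :: "'e::euclidean_space set" and d :: "'e \<Rightarrow> complex^'n^'n"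
    and \<O> :: "(complex^'n) set set" and \<gamma> :: "(complex^'n) set measure"
  assumes subspace: "subspace \<pp>" and linear_d: "linear d"
    and d_herm: "\<beta> \<in> \<pp> \<Longrightarrow> d \<beta> \<in> herm_endos h"
    and d_trace: "\<beta> \<in> \<pp> \<Longrightarrow> trace (d \<beta>) = 0"
    and d_inj: "\<beta> \<in> \<pp> \<Longrightarrow> d \<beta> = 0 \<Longrightarrow> \<beta> = 0"
    and closed_O: "closedin proj_space \<O>"
    and flow_O: "\<beta> \<in> \<pp> \<Longrightarrow> x \<in> \<O> \<Longrightarrow> proj_act (mat_exp (d \<beta>)) x \<in> \<O>"
    and O_spans: "w \<noteq> 0 \<Longrightarrow> \<exists>x\<in>\<O>. \<exists>v\<in>x. h v w \<noteq> 0"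
    and gamma: "borel_probability_on \<O> \<gamma>" and adm: "admissible \<O> \<gamma>"
begin

lemma O_sub: "x \<in> \<O> \<Longrightarrow> x \<in> topspace proj_space"
  using closedin_subset[OF closed_O] by blast

definition onb :: "'e set" where
  "onb = (SOME B. B \<subseteq> \<pp> \<and> pairwise orthogonal B \<and> (\<forall>b\<in>B. norm b = 1) \<and> finite B \<and> span B = \<pp>)"

lemma onb: "onb \<subseteq> \<pp>" "pairwise orthogonal onb" "\<And>b. b \<in> onb \<Longrightarrow> norm b = 1" "finite onb" "span onb = \<pp>"
proof -
  obtain B where "B \<subseteq> \<pp>" "pairwise orthogonal B" "\<And>x. x \<in> B \<Longrightarrow> norm x = 1" "independent B"
    "card B = dim \<pp>" "span B = \<pp>"
    using orthonormal_basis_subspace[OF subspace] by metis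
  then have "\<exists>B. B \<subseteq> \<pp> \<and> pairwise orthogonal B \<and> (\<forall>b\<in>B. norm b = 1) \<and> finite B \<and> span B = \<pp>"
    using independent_imp_finite by blast
  from someI_ex[OF this]
  show "onb \<subseteq> \<pp>" "pairwise orthogonal onb" "\<And>b. b \<in> onb \<Longrightarrow> norm b = 1" "finite onb" "span onb = \<pp>"
    by (simp_all add: onb_def)
qed

text \<open>The gradient map for the Euclidean scalar product, as a function of a vector: by \<open>moment_inner\<close> its scalar
  product with \<open>\<xi> \<in> \<pp>\<close> is the Rayleigh quotient of \<open>d \<xi>\<close>. The value at \<open>0\<close> is \<open>0\<close>, which matters only on
  null sets.\<close>

definition moment :: "complex^'n \<Rightarrow> 'e" where
  "moment v = (\<Sum>b\<in>onb. (Re (h (d b *v v) v) / hn v) *\<^sub>R b)"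

lemma moment_in: "moment v \<in> \<pp>"
  unfolding moment_def using onb(1)
  by (intro subspace_sum[OF subspace] subspace_scale[OF subspace]) auto

lemma moment_0 [simp]: "moment 0 = 0"
  by (simp add: moment_def)

lemma moment_inner:
  assumes "\<xi> \<in> \<pp>"
  shows "moment v \<bullet> \<xi> = Re (h (d \<xi> *v v) v) / hn v"
proof -
  have "\<xi> = (\<Sum>b\<in>onb. (\<xi> \<bullet> b) *\<^sub>R b)"
    using onb assms by (subst orthonormal_basis_expand) auto
  then have "d \<xi> = (\<Sum>b\<in>onb. (\<xi> \<bullet> b) *\<^sub>R d b)"
    using linear_sum[OF linear_d, of "\<lambda>b. (\<xi> \<bullet> b) *\<^sub>R b" onb] linear_scale[OF linear_d] by simp
  then have "Re (h (d \<xi> *v v) v) / hn v = (\<Sum>b\<in>onb. (\<xi> \<bullet> b) * Re (h (d b *v v) v) / hn v)"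
    by (simp add: matrix_vector_mult.sum_left matrix_vector_mult.scaleR_left h.sum_left
        h.scaleR_left sum_divide_distrib)
  then show ?thesis
    by (simp add: moment_def inner_sum_left inner_commute[of \<xi>] mult.commute)
qed

lemma moment_scale: "a \<noteq> 0 \<Longrightarrow> moment (a *s v) = moment v"
proof -
  assume "a \<noteq> 0"
  have "h (d b *v (a *s v)) (a *s v) = of_real ((cmod a)\<^sup>2) * h (d b *v v) v" for b
    by (simp only: vec.scale h_scale_left h_scale_right complex_norm_square mult_ac)
  then have "Re (h (d b *v (a *s v)) (a *s v)) = (cmod a)\<^sup>2 * Re (h (d b *v v) v)" for b
    by simp
  then show ?thesis using \<open>a \<noteq> 0\<close> by (simp add: moment_def hn_scale)
qed

lemma moment_scaleR: "r \<noteq> 0 \<Longrightarrow> moment (r *\<^sub>R v) = moment v"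
  by (simp add: moment_def hn_scaleR matrix_vector_mult.scaleR_right h.scaleR_left h.scaleR_right
      power2_eq_square)

lemma continuous_on_moment: "continuous_on (UNIV - {0}) moment"
  unfolding moment_def[abs_def]
  by (intro continuous_intros h.continuous_on matrix_vector_mult.continuous_on continuous_on_hn) auto

lemma moment_bounded: "\<exists>C. \<forall>v. norm (moment v) \<le> C"
proof -
  have "compact (moment ` sphere 0 1)"
    by (intro compact_continuous_image continuous_on_subset[OF continuous_on_moment]) auto
  then have "bounded (moment ` sphere 0 1)" by (rule compact_imp_bounded)
  then obtain C where "\<forall>x\<in>moment ` sphere 0 1. norm x \<le> C" by (auto simp: bounded_iff)
  then have C: "v \<in> sphere 0 1 \<Longrightarrow> norm (moment v) \<le> C" for v by auto
  have "norm (moment v) \<le> \<bar>C\<bar>" for v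
  proof (cases "v = 0")
    case False
    then have "norm (moment ((1 / norm v) *\<^sub>R v)) \<le> C" by (intro C) auto
    then show ?thesis using False by (simp add: moment_scaleR)
  qed simp
  then show ?thesis by blast
qed

lemma moment_rep: "v \<noteq> 0 \<Longrightarrow> moment (S *v rep (vec.span {v})) = moment (S *v v)"
  by (rule rep_span) (auto simp: vec.scale moment_scale)

sublocale \<gamma>: prob_space \<gamma>
  using gamma by (simp add: borel_probability_on_def)

lemma space_gamma: "space \<gamma> = \<O>"
  and sets_gamma: "sets \<gamma> = sigma_sets \<O> {U. openin (subtopology proj_space \<O>) U}"
  using gamma by (auto simp: borel_probability_on_def)

text \<open>Homogeneous open conditions on a representative are open conditions on the line.\<close>

lemma open_in_sets:
  assumes "open V" "\<And>v a. v \<noteq> 0 \<Longrightarrow> a \<noteq> 0 \<Longrightarrow> a *s v \<in> V \<longleftrightarrow> v \<in> V"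
  shows "{x \<in> \<O>. rep x \<in> V} \<in> sets \<gamma>"
proof -
  define U where "U = {x \<in> topspace proj_space. rep x \<in> V}"
  have "openin proj_space U"
    unfolding openin_proj_space
  proof
    show "U \<subseteq> (\<lambda>v. vec.span {v}) ` (UNIV - {0})" by (auto simp: U_def topspace_proj_space)
    have "v \<noteq> 0 \<Longrightarrow> vec.span {v} \<in> U \<longleftrightarrow> v \<in> V" for v
      using assms(2)[of v] by (auto simp: U_def topspace_proj_space intro: rep_span[of v])
    then have "{v. v \<noteq> 0 \<and> vec.span {v} \<in> U} = V - {0}" by auto
    then show "open {v. v \<noteq> 0 \<and> vec.span {v} \<in> U}" using assms(1) by (simp add: open_Diff)
  qed
  moreover have "{x \<in> \<O>. rep x \<in> V} = U \<inter> \<O>" using O_sub by (auto simp: U_def)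
  ultimately show ?thesis
    unfolding sets_gamma by (auto simp: openin_subtopology intro!: sigma_sets.Basic)
qed

lemma kernel_in_sets: "{x \<in> \<O>. S *v rep x = 0} \<in> sets \<gamma>"
proof -
  have "{x \<in> \<O>. rep x \<in> {v. S *v v \<noteq> 0}} \<in> sets \<gamma>"
    by (rule open_in_sets)
      (auto simp: vec.scale intro!: open_Collect_neq matrix_vector_mult.continuous_on continuous_intros)
  then have "space \<gamma> - {x \<in> \<O>. S *v rep x \<noteq> 0} \<in> sets \<gamma>" by auto
  also have "space \<gamma> - {x \<in> \<O>. S *v rep x \<noteq> 0} = {x \<in> \<O>. S *v rep x = 0}"
    by (auto simp: space_gamma)
  finally show ?thesis .
qed

text \<open>This is what admissibility is for: the kernel of \<open>S\<close> is contained in the hyperplane defined by any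
  nonzero row of \<open>S\<close>.\<close>

lemma AE_not_in_kernel:
  assumes "S \<noteq> 0"
  shows "AE x in \<gamma>. S *v rep x \<noteq> 0"
proof -
  obtain i where i: "S $ i \<noteq> 0" using assms by (auto simp: vec_eq_iff)
  define a where "a = S $ i"
  define H where "H = {x \<in> topspace proj_space. \<forall>v\<in>x. (\<Sum>j\<in>UNIV. a $ j * v $ j) = 0}"
  define A :: "complex^'n^'n" where "A = (\<chi> k j. a $ j)"
  have "proj_hyperplane H" using i by (auto simp: proj_hyperplane_def H_def a_def)
  then have null: "emeasure \<gamma> (\<O> \<inter> H) = 0" using adm by (simp add: admissible_def)
  have A: "A *v v = 0 \<longleftrightarrow> (\<Sum>j\<in>UNIV. a $ j * v $ j) = 0" for v
    by (simp add: A_def matrix_vector_mult_def vec_eq_iff)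
  have "\<O> \<inter> H = {x \<in> \<O>. A *v rep x = 0}"
  proof (rule equalityI; rule subsetI)
    fix x assume "x \<in> \<O> \<inter> H"
    then show "x \<in> {x \<in> \<O>. A *v rep x = 0}"
      using rep_props[of x] by (auto simp: H_def A)
  next
    fix x assume x: "x \<in> {x \<in> \<O>. A *v rep x = 0}"
    then have top: "x \<in> topspace proj_space" using O_sub by auto
    have "A *v v = 0" if "v \<in> x" for v
    proof -
      have "v \<in> vec.span {rep x}" using that span_rep[OF top] by blast
      then obtain k where "v = k *s rep x" by (auto simp: vec.span_singleton)
      then show ?thesis using x by (simp add: vec.scale)
    qed
    then show "x \<in> \<O> \<inter> H" using x top by (auto simp: H_def A)
  qed
  then have "\<O> \<inter> H \<in> null_sets \<gamma>" using null kernel_in_sets[of A] by (simp add: null_sets_def)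
  then show ?thesis
  proof (rule AE_I')
    show "{x \<in> space \<gamma>. \<not> S *v rep x \<noteq> 0} \<subseteq> \<O> \<inter> H"
    proof
      fix x assume x: "x \<in> {x \<in> space \<gamma>. \<not> S *v rep x \<noteq> 0}"
      then have "(S *v rep x) $ i = 0" by simp
      then have "A *v rep x = 0" unfolding A by (simp add: a_def matrix_vector_mult_def)
      then show "x \<in> \<O> \<inter> H" using x \<open>\<O> \<inter> H = _\<close> by (auto simp: space_gamma)
    qed
  qed
qed

lemma moment_measurable: "(\<lambda>x. moment (S *v rep x)) \<in> borel_measurable \<gamma>"
proof (rule borel_measurableI)
  fix W :: "'e set" assume W: "open W"
  let ?V = "{v. S *v v \<noteq> 0 \<and> moment (S *v v) \<in> W}"
  have "open ?V"
  proof -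
    have "open ((UNIV - {0}) \<inter> moment -` W)"
      using continuous_on_moment W by (simp add: continuous_on_open_vimage open_Diff Int_commute)
    then have "open ((*v) S -` ((UNIV - {0}) \<inter> moment -` W))"
      by (intro open_vimage matrix_vector_mult.continuous_on continuous_intros)
    moreover have "(*v) S -` ((UNIV - {0}) \<inter> moment -` W) = ?V" by auto
    ultimately show ?thesis by simp
  qed
  then have 1: "{x \<in> \<O>. rep x \<in> ?V} \<in> sets \<gamma>"
    by (rule open_in_sets) (auto simp: vec.scale moment_scale)
  have "(\<lambda>x. moment (S *v rep x)) -` W \<inter> space \<gamma>
      = {x \<in> \<O>. rep x \<in> ?V} \<union> (if 0 \<in> W then {x \<in> \<O>. S *v rep x = 0} else {})"
    by (auto simp: space_gamma)
  then show "(\<lambda>x. moment (S *v rep x)) -` W \<inter> space \<gamma> \<in> sets \<gamma>"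
    using 1 kernel_in_sets[of S] by auto
qed

text \<open>The average of the moment map after moving by \<open>S\<close>. It is meaningful for every \<open>S \<noteq> 0\<close>, and at
  \<open>S = exp (d \<beta>)\<close> it is the Bourguignon-Li-Yau map.\<close>

definition bary :: "complex^'n^'n \<Rightarrow> 'e" where
  "bary S = (\<integral>x. moment (S *v rep x) \<partial>\<gamma>)"

lemma moment_integrable: "integrable \<gamma> (\<lambda>x. moment (S *v rep x))"
proof -
  obtain C where "\<And>v. norm (moment v) \<le> C" using moment_bounded by auto
  then show ?thesis by (intro \<gamma>.integrable_const_bound[where B=C] moment_measurable) auto
qed

lemma bary_inner: "bary S \<bullet> \<xi> = (\<integral>x. moment (S *v rep x) \<bullet> \<xi> \<partial>\<gamma>)"
  unfolding bary_def by (rule integral_inner_left[symmetric]) (rule moment_integrable)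

lemma bary_scaleR: "r \<noteq> 0 \<Longrightarrow> bary (r *\<^sub>R S) = bary S"
  by (simp add: bary_def matrix_vector_mult.scaleR_left moment_scaleR)

text \<open>The integrands are bounded and converge off the projectivised kernel of \<open>S\<close>, a null set.\<close>

lemma bary_tendsto:
  assumes "S \<noteq> 0" "T \<longlonglongrightarrow> S"
  shows "(\<lambda>n. bary (T n)) \<longlonglongrightarrow> bary S"
proof -
  obtain C where C: "\<And>v. norm (moment v) \<le> C" using moment_bounded by auto
  show ?thesis
    unfolding bary_def
  proof (rule integral_dominated_convergence[where w="\<lambda>_. C"])
    show "AE x in \<gamma>. (\<lambda>i. moment (T i *v rep x)) \<longlonglongrightarrow> moment (S *v rep x)"
      using AE_not_in_kernel[OF assms(1)]
    proof (rule AE_mp, intro AE_I2 impI)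
      fix x assume x: "S *v rep x \<noteq> 0"
      have "isCont moment (S *v rep x)"
        using continuous_on_moment x by (simp add: continuous_on_eq_continuous_at open_Diff)
      moreover have "(\<lambda>i. T i *v rep x) \<longlonglongrightarrow> S *v rep x"
        by (intro matrix_vector_mult.tendsto assms tendsto_const)
      ultimately show "(\<lambda>i. moment (T i *v rep x)) \<longlonglongrightarrow> moment (S *v rep x)"
        by (rule isCont_tendsto_compose)
    qed
  qed (auto intro: moment_measurable C)
qed

lemma continuous_on_bary: "continuous_on (UNIV - {0}) bary"
  unfolding continuous_on_sequentially by (auto simp: o_def intro: bary_tendsto)

end

section \<open>The convex body and its support function\<close>

text \<open>Scalars may be split off from an exponential. Up to a positive factor, which neither the moment map nor
  projective points see, \<open>exp (t d \<xi>)\<close> is therefore \<open>exp (- t (l - d \<xi>))\<close>, a contraction if \<open>l\<close> is the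
  largest eigenvalue.\<close>

lemma mat_exp_shift:
  fixes A :: "complex^'n^'n"
  shows "mat_exp (t *\<^sub>R (A - l *\<^sub>R mat 1)) = exp (- t * l) *\<^sub>R mat_exp (t *\<^sub>R A)"
proof -
  define N where "N = A - l *\<^sub>R mat 1"
  let ?f = "\<lambda>t. mat_exp (t *\<^sub>R (- N)) ** (exp (- t * l) *\<^sub>R mat_exp (t *\<^sub>R A))"
  have "(?f has_derivative (\<lambda>h. 0)) (at t)" for t
  proof -
    let ?P = "mat_exp (t *\<^sub>R (- N))" and ?Q = "exp (- t * l) *\<^sub>R mat_exp (t *\<^sub>R A)"
    have "((\<lambda>t. exp (- t * l)) has_real_derivative (- l * exp (- t * l))) (at t)"
      by (auto intro!: derivative_eq_intros)
    from has_vector_derivative_scaleR[OF this mat_exp_has_vector_derivative[of A t]]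
    have Q: "((\<lambda>t. exp (- t * l) *\<^sub>R mat_exp (t *\<^sub>R A)) has_vector_derivative (A ** ?Q - l *\<^sub>R ?Q)) (at t)"
      by (simp add: matrix_mult.scaleR_right algebra_simps)
    have "?P ** (A ** ?Q - l *\<^sub>R ?Q) + (- N ** ?P) ** ?Q = 0"
    proof -
      have "- N ** ?P = ?P ** (- N)" by (rule mat_exp_commute[symmetric])
      then have "?P ** (A ** ?Q - l *\<^sub>R ?Q) + (- N ** ?P) ** ?Q
          = ?P ** (A ** ?Q - l *\<^sub>R ?Q + (- N) ** ?Q)"
        by (simp add: matrix_mult.add_right matrix_mul_assoc)
      also have "A ** ?Q - l *\<^sub>R ?Q + (- N) ** ?Q = 0"
        by (simp add: N_def matrix_mult.diff_left matrix_mult.scaleR_left matrix_mult.minus_left)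
      finally show ?thesis by simp
    qed
    with matrix_mult.has_vector_derivative[OF mat_exp_has_vector_derivative[of "- N" t] Q]
    show ?thesis by (simp add: has_vector_derivative_def)
  qed
  then have "?f t = ?f 0" by (intro has_derivative_zero_unique[of UNIV ?f]) auto
  then have "mat_exp (t *\<^sub>R (- N)) ** (exp (- t * l) *\<^sub>R mat_exp (t *\<^sub>R A)) = mat 1" by simp
  then have "mat_exp (t *\<^sub>R N) ** (mat_exp ((- t) *\<^sub>R N) ** (exp (- t * l) *\<^sub>R mat_exp (t *\<^sub>R A)))
      = mat_exp (t *\<^sub>R N)" by simp
  then have "exp (- t * l) *\<^sub>R mat_exp (t *\<^sub>R A) = mat_exp (t *\<^sub>R N)"
    by (simp only: matrix_mul_assoc mat_exp_minus_right matrix_mul_lid)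
  then show ?thesis by (simp add: N_def)
qed

text \<open>A supporting hyperplane whose normal vector lies in the subspace \<open>P\<close>. It is a limit of unit normals
  pointing from nearest points in \<open>E\<close> to points of \<open>P\<close> outside \<open>E\<close> that approach \<open>y\<close>; this
  construction also covers the case that \<open>E\<close> has empty interior in \<open>P\<close>.\<close>

lemma supporting_functional_at_non_interior_point:
  fixes E :: "'a::euclidean_space set"
  assumes P: "subspace P" and E: "E \<subseteq> P" "compact E" "convex E" and y: "y \<in> E"
    and not_int: "y \<notin> top_of_set P interior_of E"
  obtains \<xi> where "\<xi> \<in> P" "\<xi> \<noteq> 0" "\<And>z. z \<in> E \<Longrightarrow> z \<bullet> \<xi> \<le> y \<bullet> \<xi>"
proof -
  have "\<exists>u. u \<in> P \<and> u \<notin> E \<and> dist u y < 1 / real (Suc n)" for n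
  proof (rule ccontr)
    assume "\<not> ?thesis"
    then have "P \<inter> ball y (1 / real (Suc n)) \<subseteq> E" by (auto simp: dist_commute)
    moreover have "openin (top_of_set P) (P \<inter> ball y (1 / real (Suc n)))" by (simp add: openin_open_Int)
    moreover have "y \<in> P \<inter> ball y (1 / real (Suc n))" using y E by auto
    ultimately have "y \<in> top_of_set P interior_of E" by (auto simp: interior_of_def)
    with not_int show False by simp
  qed
  then obtain u where u: "\<And>n. u n \<in> P" "\<And>n. u n \<notin> E" "\<And>n. dist (u n) y < 1 / real (Suc n)"
    by metis
  have clE: "closed E" and neE: "E \<noteq> {}" using E y by (auto simp: compact_imp_closed)
  define c where "c n = closest_point E (u n)" for n
  have c: "c n \<in> E" for n unfolding c_def by (rule closest_point_in_set[OF clE neE])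
  define \<xi> where "\<xi> n = sgn (u n - c n)" for n
  have xi_norm: "norm (\<xi> n) = 1" for n
    using c[of n] u(2)[of n] by (auto simp: \<xi>_def norm_sgn)
  have xi_P: "\<xi> n \<in> P" for n
    unfolding \<xi>_def sgn_div_norm
    using c[of n] u(1)[of n] E(1) P by (auto intro!: subspace_scale subspace_diff)
  have sep: "z \<bullet> \<xi> n \<le> c n \<bullet> \<xi> n" if "z \<in> E" for z n
  proof -
    have "(u n - c n) \<bullet> (z - c n) \<le> 0"
      unfolding c_def using closest_point_dot[OF E(3) clE that] .
    then have "inverse (norm (u n - c n)) * ((u n - c n) \<bullet> (z - c n)) \<le> 0"
      by (simp add: mult_nonneg_nonpos)
    then show ?thesis
      by (simp add: \<xi>_def sgn_div_norm inner_diff_right inner_diff_left inner_commute divide_inverse algebra_simps)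
  qed
  have lim_u: "u \<longlonglongrightarrow> y"
  proof (rule tendstoI)
    fix e :: real assume "e > 0"
    then have "\<forall>\<^sub>F n in sequentially. 1 / real (Suc n) < e"
      using order_tendstoD(2)[OF LIMSEQ_inverse_real_of_nat, of e] by (simp add: inverse_eq_divide)
    then show "\<forall>\<^sub>F n in sequentially. dist (u n) y < e"
      by (rule eventually_mono) (use u(3) in \<open>meson less_trans\<close>)
  qed
  have "isCont (closest_point E) y"
    using continuous_at_closest_point[OF E(3) clE neE] .
  then have lim_c: "c \<longlonglongrightarrow> y"
    using isCont_tendsto_compose[OF _ lim_u] closest_point_self[OF y]
    unfolding c_def by metis
  have "\<xi> n \<in> sphere 0 1" for n using xi_norm by simp
  then obtain \<xi>0 r where r: "\<xi>0 \<in> sphere 0 1" "strict_mono r" "(\<xi> \<circ> r) \<longlonglongrightarrow> \<xi>0"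
    using compact_sphere[of "0::'a" 1] unfolding compact_def by metis
  show thesis
  proof (rule that)
    show "\<xi>0 \<in> P"
      by (rule closed_sequentially[OF closed_subspace[OF P] _ r(3)]) (simp add: xi_P)
    show "\<xi>0 \<noteq> 0" using r(1) by auto
    fix z assume z: "z \<in> E"
    have 1: "(\<lambda>n. z \<bullet> (\<xi> \<circ> r) n) \<longlonglongrightarrow> z \<bullet> \<xi>0" by (intro tendsto_intros r)
    have 2: "(\<lambda>n. (c \<circ> r) n \<bullet> (\<xi> \<circ> r) n) \<longlonglongrightarrow> y \<bullet> \<xi>0"
      by (intro tendsto_intros r LIMSEQ_subseq_LIMSEQ lim_c)
    show "z \<bullet> \<xi>0 \<le> y \<bullet> \<xi>0"
      by (rule LIMSEQ_le[OF 1 2]) (use sep[OF z] in auto)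
  qed
qed

lemma interior_point_not_extremal:
  assumes P: "subspace P" and y: "y \<in> top_of_set P interior_of E" and \<xi>: "\<xi> \<in> P" "\<xi> \<noteq> 0"
    and bound: "\<And>z. z \<in> E \<Longrightarrow> z \<bullet> \<xi> \<le> l"
  shows "y \<bullet> \<xi> < l"
proof -
  obtain U where U: "openin (top_of_set P) U" "y \<in> U" "U \<subseteq> E"
    using y by (auto simp: interior_of_def)
  then obtain V where V: "open V" "U = P \<inter> V" by (auto simp: openin_open)
  then obtain e where e: "e > 0" "ball y e \<subseteq> V" using U openE by blast
  define s where "s = e / (2 * norm \<xi>)"
  have s: "s > 0" using e \<xi> by (simp add: s_def)
  have "y + s *\<^sub>R \<xi> \<in> ball y e" using e \<xi> by (simp add: dist_norm s_def)
  moreover have "y + s *\<^sub>R \<xi> \<in> P" using U V \<xi> P by (auto intro: subspace_add subspace_scale)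
  ultimately have "(y + s *\<^sub>R \<xi>) \<bullet> \<xi> \<le> l" using e V U by (intro bound) auto
  moreover have "s * (\<xi> \<bullet> \<xi>) > 0" using s \<xi> by simp
  ultimately show ?thesis by (simp add: inner_add_left)
qed

context moment_setting
begin

text \<open>This is \<open>\<E>\<close> for the Euclidean scalar product.\<close>

definition body :: "'e set" where
  "body = convex hull ((\<lambda>x. moment (rep x)) ` \<O>)"

text \<open>Closedness of \<open>\<O>\<close> enters here: its unit vectors form a compact set.\<close>

lemma compact_body: "compact body"
proof -
  let ?A = "{v \<in> sphere 0 1. vec.span {v} \<in> \<O>}"
  have im: "(\<lambda>x. moment (rep x)) ` \<O> = moment ` ?A"
  proof (rule equalityI; rule subsetI)
    fix z assume "z \<in> (\<lambda>x. moment (rep x)) ` \<O>"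
    then obtain x where x: "x \<in> \<O>" "z = moment (rep x)" by auto
    let ?v = "(1 / norm (rep x)) *\<^sub>R rep x"
    have r: "rep x \<noteq> 0" using rep_props[OF O_sub[OF x(1)]] by simp
    have "?v = complex_of_real (1 / norm (rep x)) *s rep x"
      by (simp add: vec_eq_iff scaleR_conv_of_real[where 'a=complex])
    then have "vec.span {?v} = vec.span {rep x}"
      using r vec.span_image_scale[of "{rep x}" "\<lambda>_. complex_of_real (1 / norm (rep x))"] by simp
    then have "?v \<in> ?A" using x r span_rep[OF O_sub[OF x(1)]] by simp
    moreover have "z = moment ?v" using x r by (simp add: moment_scaleR)
    ultimately show "z \<in> moment ` ?A" by blast
  next
    fix z assume "z \<in> moment ` ?A"
    then obtain v where v: "norm v = 1" "vec.span {v} \<in> \<O>" "z = moment v" by auto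
    then have "v \<noteq> 0" by auto
    then have "z = moment (rep (vec.span {v}))" using v moment_rep[of v "mat 1"] by simp
    then show "z \<in> (\<lambda>x. moment (rep x)) ` \<O>" using v by blast
  qed
  have "openin proj_space (topspace proj_space - \<O>)" using closed_O by blast
  then have "open {v. v \<noteq> 0 \<and> vec.span {v} \<in> topspace proj_space - \<O>}" by (simp add: openin_proj_space)
  then have "compact (sphere 0 1 - {v. v \<noteq> 0 \<and> vec.span {v} \<in> topspace proj_space - \<O>})"
    by (intro compact_diff) auto
  also have "sphere 0 1 - {v. v \<noteq> 0 \<and> vec.span {v} \<in> topspace proj_space - \<O>} = ?A"
    by (auto simp: topspace_proj_space)
  finally have "compact (moment ` ?A)"
    by (intro compact_continuous_image continuous_on_subset[OF continuous_on_moment]) auto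
  then show ?thesis unfolding body_def im by (rule compact_convex_hull)
qed

lemma convex_body: "convex body"
  by (simp add: body_def)

lemma body_sub: "body \<subseteq> \<pp>"
  unfolding body_def by (rule hull_minimal) (auto simp: moment_in subspace subspace_imp_convex)

lemma flow_in_body:
  assumes "\<beta> \<in> \<pp>" "x \<in> \<O>"
  shows "moment (mat_exp (d \<beta>) *v rep x) \<in> body"
proof -
  let ?w = "mat_exp (d \<beta>) *v rep x"
  have "?w \<noteq> 0" using rep_props[OF O_sub[OF assms(2)]] by (simp add: mat_exp_vec_eq_0)
  have "proj_act (mat_exp (d \<beta>)) x = vec.span {?w}"
    using span_rep[OF O_sub[OF assms(2)]] proj_act_span by metis
  then have "vec.span {?w} \<in> \<O>" using flow_O[OF assms] by simp
  moreover have "moment ?w = moment (rep (vec.span {?w}))"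
    using moment_rep[OF \<open>?w \<noteq> 0\<close>, of "mat 1"] by simp
  ultimately show ?thesis unfolding body_def by (auto intro: hull_inc)
qed

text \<open>A barycenter of a closed convex set cannot be strictly separated from it.\<close>

lemma bary_exp_in_body:
  assumes "\<beta> \<in> \<pp>"
  shows "bary (mat_exp (d \<beta>)) \<in> body"
proof (rule ccontr)
  assume "bary (mat_exp (d \<beta>)) \<notin> body"
  then obtain a b where ab: "a \<bullet> bary (mat_exp (d \<beta>)) < b" "\<And>z. z \<in> body \<Longrightarrow> a \<bullet> z > b"
    using separating_hyperplane_closed_point[OF convex_body compact_imp_closed[OF compact_body]]
    by metis
  have "b = (\<integral>x. b \<partial>\<gamma>)" by (simp add: \<gamma>.prob_space)
  also have "\<dots> \<le> (\<integral>x. moment (mat_exp (d \<beta>) *v rep x) \<bullet> a \<partial>\<gamma>)"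
  proof (rule integral_mono)
    fix x assume "x \<in> space \<gamma>"
    then show "b \<le> moment (mat_exp (d \<beta>) *v rep x) \<bullet> a"
      using ab(2)[OF flow_in_body[OF assms]] by (simp add: space_gamma inner_commute less_imp_le)
  qed (auto intro: integrable_inner_left moment_integrable)
  also have "\<dots> = a \<bullet> bary (mat_exp (d \<beta>))" by (simp only: bary_inner[symmetric] inner_commute[of a])
  finally show False using ab(1) by simp
qed

text \<open>The distance of a moment value from the supporting value \<open>l\<close> is a Rayleigh quotient of the
  semidefinite operator \<open>l - d \<xi>\<close>; so equality means lying in the top eigenspace.\<close>

lemma moment_deficit:
  assumes "\<xi> \<in> \<pp>" "w \<noteq> 0"
  shows "l - moment w \<bullet> \<xi> = Re (h ((l *\<^sub>R mat 1 - d \<xi>) *v w) w) / hn w"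
  using assms by (simp add: moment_inner matrix_vector_mult_diff_rdistrib h.diff_left
      matrix_vector_mult.scaleR_left h.scaleR_left hn_def[symmetric] diff_divide_distrib)

lemma body_le_top:
  assumes "\<xi> \<in> \<pp>" "l *\<^sub>R mat 1 - d \<xi> \<in> psd" "z \<in> body"
  shows "z \<bullet> \<xi> \<le> l"
proof -
  have "body \<subseteq> {z. \<xi> \<bullet> z \<le> l}"
    unfolding body_def
  proof (rule hull_minimal)
    show "(\<lambda>x. moment (rep x)) ` \<O> \<subseteq> {z. \<xi> \<bullet> z \<le> l}"
    proof clarify
      fix x assume "x \<in> \<O>"
      then have "rep x \<noteq> 0" using rep_props O_sub by blast
      from moment_deficit[OF assms(1) this, of l] psd_nonneg[OF assms(2)] hn_nonneg
      show "\<xi> \<bullet> moment (rep x) \<le> l" by (metis diff_ge_0_iff_ge divide_nonneg_nonneg inner_commute)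
    qed
  qed (simp add: convex_halfspace_le)
  then show ?thesis using assms(3) by (auto simp: inner_commute)
qed

text \<open>The largest eigenvalue of \<open>d \<xi>\<close> is not larger than the supremum of \<open>\<xi>\<close> over the body. Take a vector
  \<open>u\<close> of \<open>\<O>\<close> not orthogonal to the top eigenvector \<open>v\<close> and flow it by \<open>exp (- t N)\<close> with \<open>N = l - d \<xi>\<close>.
  The component along \<open>v\<close> is preserved, which bounds the norm from below by some \<open>\<delta>\<close>, while the form of
  \<open>N\<close> decays like \<open>1 / t\<close>.\<close>

lemma top_le_body_bound:
  assumes \<xi>: "\<xi> \<in> \<pp>" and psd: "l *\<^sub>R mat 1 - d \<xi> \<in> psd" and v: "v \<noteq> 0" "d \<xi> *v v = l *\<^sub>R v"
    and bound: "\<And>z. z \<in> body \<Longrightarrow> z \<bullet> \<xi> \<le> m"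
  shows "l \<le> m"
proof (rule field_le_epsilon)
  fix e :: real assume e: "e > 0"
  define N where "N = l *\<^sub>R mat 1 - d \<xi>"
  have Nv: "N *v v = 0"
    using v by (simp add: N_def matrix_vector_mult_diff_rdistrib matrix_vector_mult.scaleR_left)
  obtain x u where x: "x \<in> \<O>" "u \<in> x" "h u v \<noteq> 0" using O_spans[OF v(1)] by blast
  obtain k where k: "u = k *s rep x"
    using x(2) span_rep[OF O_sub[OF x(1)]] by (metis rangeE vec.span_singleton)
  have u0: "u \<noteq> 0" using x(3) by (auto simp: h.zero_left)
  then have k0: "k \<noteq> 0" using k by auto
  obtain C where C: "C > 0" "\<And>u v. norm (h u v) \<le> norm u * norm v * C" using h.pos_bounded by blast
  obtain a where a: "a > 0" "\<And>v. a * (norm v)\<^sup>2 \<le> hn v" using hn_lower_bound by blast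
  define \<delta> where "\<delta> = a * (norm (h u v) / (norm v * C))\<^sup>2"
  have \<delta>: "\<delta> > 0" using a C v x by (simp add: \<delta>_def)
  \<comment> \<open>the time after which the decay estimate is below \<open>e\<close> relative to \<open>\<delta>\<close>\<close>
  define t where "t = hn u / (2 * \<delta> * e)"
  have t: "t > 0" using hn_pos[OF u0] \<delta> e by (simp add: t_def)
  define w where "w = mat_exp ((- t) *\<^sub>R N) *v u"
  have Np: "N \<in> psd" using psd by (simp add: N_def)
  \<comment> \<open>up to a positive factor the flow is an exponential from \<open>\<pp>\<close>, so it stays in \<open>\<O>\<close>\<close>
  have w_exp: "w = exp (- t * l) *\<^sub>R (mat_exp (d (t *\<^sub>R \<xi>)) *v u)"
  proof -
    have "(- t) *\<^sub>R N = t *\<^sub>R (d \<xi> - l *\<^sub>R mat 1)" by (simp add: N_def algebra_simps)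
    then show ?thesis
      by (simp add: w_def mat_exp_shift linear_scale[OF linear_d] matrix_vector_mult.scaleR_left)
  qed
  have "h w v = h u (mat_exp ((- t) *\<^sub>R N) *v v)"
    unfolding w_def by (intro herm_endosD herm_endos_mat_exp herm_endos_scaleR psd_herm Np)
  then have hw: "h w v = h u v" by (simp only: mat_exp_fixes_kernel[OF Nv])
  have "norm (h u v) \<le> norm w * (norm v * C)" using C(2)[of w v] hw by (simp add: mult.assoc)
  then have "norm (h u v) / (norm v * C) \<le> norm w" using C v by (simp add: divide_le_eq)
  then have "\<delta> \<le> a * (norm w)\<^sup>2"
    unfolding \<delta>_def using a C v by (intro mult_left_mono power_mono) auto
  then have \<delta>w: "\<delta> \<le> hn w" using a(2)[of w] by simp
  then have w0: "w \<noteq> 0" using \<delta> by auto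
  have "2 * t * Re (h (N *v w) w) \<le> hn u"
    unfolding w_def using psd_flow_decay[OF Np, of t u] t by simp
  then have "Re (h (N *v w) w) \<le> \<delta> * e"
    using t \<delta> e hn_pos[OF u0] by (simp add: t_def field_simps)
  also have "\<dots> \<le> hn w * e" using \<delta>w e by simp
  finally have "Re (h (N *v w) w) / hn w \<le> e" using w0 hn_pos[OF w0] by (simp add: divide_le_eq mult.commute)
  then have 1: "l - moment w \<bullet> \<xi> \<le> e" using moment_deficit[OF \<xi> w0] by (simp add: N_def)
  have "moment w = moment (mat_exp (d (t *\<^sub>R \<xi>)) *v u)"
    unfolding w_exp by (rule moment_scaleR) simp
  also have "\<dots> = moment (mat_exp (d (t *\<^sub>R \<xi>)) *v rep x)"
    unfolding k using k0 by (simp add: vec.scale moment_scale)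
  also have "\<dots> \<in> body" using \<xi> x(1) by (intro flow_in_body subspace_scale[OF subspace])
  finally have "moment w \<bullet> \<xi> \<le> m" by (rule bound)
  with 1 show "l \<le> m + e" by simp
qed

text \<open>A traceless scalar operator vanishes.\<close>

lemma top_shift_nonzero:
  assumes "\<xi> \<in> \<pp>" "\<xi> \<noteq> 0"
  shows "l *\<^sub>R mat 1 - d \<xi> \<noteq> 0"
proof
  assume "l *\<^sub>R mat 1 - d \<xi> = 0"
  then have eq: "d \<xi> = l *\<^sub>R mat 1" by simp
  have "trace (l *\<^sub>R mat 1 :: complex^'n^'n) = of_real (l * real CARD('n))"
    by (simp add: trace_def mat_def scaleR_conv_of_real[where 'a=complex])
  then have "l = 0" using d_trace[OF assms(1)] by (simp add: eq)
  then show False using d_inj[OF assms(1)] eq assms(2) by simp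
qed

text \<open>At a supporting functional the average equals the maximum, so almost every integrand does, and almost
  every \<open>exp (d \<beta>) x\<close> lies in the kernel of the nonzero operator \<open>l - d \<xi>\<close>. Admissibility forbids this.\<close>

lemma bary_exp_interior:
  assumes "\<beta> \<in> \<pp>"
  shows "bary (mat_exp (d \<beta>)) \<in> top_of_set \<pp> interior_of body"
proof (rule ccontr)
  let ?y = "bary (mat_exp (d \<beta>))"
  assume "?y \<notin> top_of_set \<pp> interior_of body"
  then obtain \<xi> where \<xi>: "\<xi> \<in> \<pp>" "\<xi> \<noteq> 0" "\<And>z. z \<in> body \<Longrightarrow> z \<bullet> \<xi> \<le> ?y \<bullet> \<xi>"
    using supporting_functional_at_non_interior_point[OF subspace body_sub compact_body convex_body
        bary_exp_in_body[OF assms]] by metis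
  obtain l v where lv: "v \<noteq> 0" "d \<xi> *v v = l *\<^sub>R v" "l *\<^sub>R mat 1 - d \<xi> \<in> psd"
    using hermitian_top_eigenvector[OF d_herm[OF \<xi>(1)]] by metis
  have "l \<le> ?y \<bullet> \<xi>" by (rule top_le_body_bound[OF \<xi>(1) lv(3,1,2) \<xi>(3)])
  moreover have "?y \<bullet> \<xi> \<le> l" by (rule body_le_top[OF \<xi>(1) lv(3) bary_exp_in_body[OF assms]])
  ultimately have yl: "?y \<bullet> \<xi> = l" by simp
  let ?g = "\<lambda>x. l - moment (mat_exp (d \<beta>) *v rep x) \<bullet> \<xi>"
  have int: "integrable \<gamma> ?g"
    by (intro Bochner_Integration.integrable_diff integrable_inner_left moment_integrable) simp
  have "integral\<^sup>L \<gamma> ?g = l - ?y \<bullet> \<xi>"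
    by (subst Bochner_Integration.integral_diff)
      (auto simp: bary_inner \<gamma>.prob_space intro: integrable_inner_left moment_integrable)
  then have "integral\<^sup>L \<gamma> ?g = 0" using yl by simp
  moreover have "AE x in \<gamma>. 0 \<le> ?g x"
    using body_le_top[OF \<xi>(1) lv(3) flow_in_body[OF assms]] by (intro AE_I2) (simp add: space_gamma)
  ultimately have "AE x in \<gamma>. ?g x = 0" using integral_nonneg_eq_0_iff_AE[OF int] by simp
  moreover have "AE x in \<gamma>. ((l *\<^sub>R mat 1 - d \<xi>) ** mat_exp (d \<beta>)) *v rep x \<noteq> 0"
  proof (rule AE_not_in_kernel)
    show "(l *\<^sub>R mat 1 - d \<xi>) ** mat_exp (d \<beta>) \<noteq> 0"
    proof
      assume "(l *\<^sub>R mat 1 - d \<xi>) ** mat_exp (d \<beta>) = 0"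
      then have "(l *\<^sub>R mat 1 - d \<xi>) ** (mat_exp (d \<beta>) ** mat_exp (- d \<beta>)) = 0"
        by (simp add: matrix_mul_assoc)
      then show False
        using mat_exp_minus_right[of 1 "d \<beta>"] top_shift_nonzero[OF \<xi>(1,2)] by simp
    qed
  qed
  \<comment> \<open>a point satisfying both conditions would have its image in the kernel of \<open>l - d \<xi>\<close> and outside of it\<close>
  ultimately have "AE x in \<gamma>. False"
  proof eventually_elim
    case (elim x)
    let ?w = "mat_exp (d \<beta>) *v rep x"
    have Nw: "(l *\<^sub>R mat 1 - d \<xi>) *v ?w \<noteq> 0" using elim(2) by (simp add: matrix_vector_mul_assoc)
    then have w0: "?w \<noteq> 0" by auto
    have "Re (h ((l *\<^sub>R mat 1 - d \<xi>) *v ?w) ?w) = 0"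
      using moment_deficit[OF \<xi>(1) w0, of l] elim(1) w0 by simp
    with psd_kernel[OF lv(3)] Nw show False by blast
  qed
  then show False by simp
qed

end

section \<open>Behaviour at infinity and surjectivity\<close>

text \<open>If \<open>f\<close> had no zero, a Brouwer fixed point of \<open>x \<mapsto> - R f x / |f x|\<close> would be a point of the sphere
  at which \<open>f\<close> points inwards.\<close>

lemma poincare_bohl:
  fixes f :: "'a::euclidean_space \<Rightarrow> 'a"
  assumes P: "subspace P" and f: "continuous_on P f" "f ` P \<subseteq> P" and R: "R > 0"
    and outward: "\<And>x. x \<in> P \<Longrightarrow> norm x = R \<Longrightarrow> 0 < f x \<bullet> x"
  shows "\<exists>x\<in>P. f x = 0"
proof (rule ccontr)
  assume "\<not> ?thesis"
  then have nz: "f x \<noteq> 0" if "x \<in> P" for x using that by blast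
  let ?B = "P \<inter> cball 0 R"
  let ?g = "\<lambda>x. (- R / norm (f x)) *\<^sub>R f x"
  have B1: "compact ?B" by (intro closed_Int_compact closed_subspace P) simp
  have B2: "convex ?B" by (intro convex_Int subspace_imp_convex[OF P] convex_cball)
  have "0 \<in> ?B" using R subspace_0[OF P] by simp
  then have B3: "?B \<noteq> {}" by blast
  have B4: "continuous_on ?B ?g"
    using nz by (intro continuous_intros continuous_on_subset[OF f(1)]) auto
  have B5: "?g \<in> ?B \<rightarrow> ?B"
  proof
    fix x assume "x \<in> ?B"
    then have "f x \<in> P" "f x \<noteq> 0" using f(2) nz by auto
    then show "?g x \<in> ?B" using R P by (auto intro!: subspace_scale subspace_neg)
  qed
  obtain x where x: "x \<in> ?B" "?g x = x" by (rule brouwer[OF B1 B2 B3 B4 B5])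
  then have fx: "f x \<noteq> 0" using nz by auto
  have "norm (?g x) = R" using fx R by simp
  then have "norm x = R" unfolding x(2) .
  then have "0 < f x \<bullet> x" using outward x(1) by blast
  then have "0 < f x \<bullet> ?g x" unfolding x(2) .
  then have "(R / norm (f x)) * (f x \<bullet> f x) < 0" by simp
  moreover have "(R / norm (f x)) * (f x \<bullet> f x) \<ge> 0" using R by simp
  ultimately show False by linarith
qed

context moment_setting
begin

text \<open>Normalisation makes the values relatively compact and is invisible to \<open>bary\<close>.\<close>

definition unit_exp :: "'e \<Rightarrow> complex^'n^'n" where
  "unit_exp \<beta> = (1 / norm (mat_exp (d \<beta>))) *\<^sub>R mat_exp (d \<beta>)"

lemma mat_exp_nonzero: "mat_exp (A :: complex^'n^'n) \<noteq> 0"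
proof
  assume "mat_exp A = 0"
  then have "mat_exp A *v 1 = 0" by simp
  then show False by (simp add: mat_exp_vec_eq_0)
qed

lemma norm_unit_exp: "norm (unit_exp \<beta>) = 1"
  using mat_exp_nonzero by (simp add: unit_exp_def)

lemma bary_unit_exp: "bary (unit_exp \<beta>) = bary (mat_exp (d \<beta>))"
  unfolding unit_exp_def using mat_exp_nonzero by (intro bary_scaleR) simp

lemma unit_exp_psd: "\<beta> \<in> \<pp> \<Longrightarrow> unit_exp \<beta> \<in> psd"
  unfolding unit_exp_def by (intro psd_scaleR mat_exp_psd d_herm) auto

lemma continuous_on_mat_exp_d: "continuous_on UNIV (\<lambda>\<beta>. mat_exp (d \<beta>))"
  using continuous_on_compose2[OF continuous_on_mat_exp linear_continuous_on[of d]] linear_d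
  by (auto simp: linear_conv_bounded_linear)

lemma continuous_on_unit_exp: "continuous_on UNIV unit_exp"
  unfolding unit_exp_def[abs_def] using mat_exp_nonzero
  by (intro continuous_intros continuous_on_mat_exp_d) auto

text \<open>The hypothesis says that \<open>S\<close> maps into the eigenspace of \<open>d \<xi>\<close> for \<open>l\<close>, on which \<open>\<xi>\<close> takes the
  constant value \<open>l\<close> along the moment map.\<close>

lemma bary_at_infinity:
  assumes \<xi>: "\<xi> \<in> \<pp>" and S: "S \<noteq> 0" "(l *\<^sub>R mat 1 - d \<xi>) ** S = 0"
  shows "bary S \<bullet> \<xi> = l"
proof -
  have "AE x in \<gamma>. moment (S *v rep x) \<bullet> \<xi> = l"
    using AE_not_in_kernel[OF S(1)]
  proof eventually_elim
    case (elim x)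
    have "(l *\<^sub>R mat 1 - d \<xi>) *v (S *v rep x) = 0" using S(2) by (simp add: matrix_vector_mul_assoc)
    then show ?case using moment_deficit[OF \<xi> elim, of l] by (simp add: h.zero_left)
  qed
  then have "(\<integral>x. moment (S *v rep x) \<bullet> \<xi> \<partial>\<gamma>) = (\<integral>x. l \<partial>\<gamma>)"
    by (intro integral_cong_AE) (auto intro: borel_measurable_inner moment_measurable)
  then show ?thesis by (simp add: bary_inner \<gamma>.prob_space)
qed

text \<open>Going to infinity in the direction \<open>\<xi>\<close>, the normalised exponentials degenerate onto the top eigenspace
  of \<open>d \<xi>\<close>. With \<open>\<beta>\<^sub>n = t\<^sub>n \<xi>\<^sub>n\<close> and \<open>N\<^sub>n = l\<^sub>n - d \<xi>\<^sub>n\<close> the operator \<open>exp (- t\<^sub>n N\<^sub>n)\<close> is a positive multiple of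
  \<open>exp (d \<beta>\<^sub>n)\<close>. It fixes a top eigenvector, so its norm does not tend to \<open>0\<close>, and
  the form of \<open>N\<^sub>n\<close> on its image is of order \<open>1 / t\<^sub>n\<close>.\<close>

lemma unit_exp_asymptotics:
  fixes \<beta> :: "nat \<Rightarrow> 'e"
  assumes \<beta>: "\<And>n. \<beta> n \<in> \<pp>" and lim: "filterlim (\<lambda>n. norm (\<beta> n)) at_top sequentially"
  obtains r :: "nat \<Rightarrow> nat" and S \<xi> l where "strict_mono r" "(\<lambda>n. unit_exp (\<beta> (r n))) \<longlonglongrightarrow> S"
    "(\<lambda>n. sgn (\<beta> (r n))) \<longlonglongrightarrow> \<xi>" "S \<noteq> 0" "\<xi> \<in> \<pp>" "\<xi> \<noteq> 0"
    "l *\<^sub>R mat 1 - d \<xi> \<in> psd" "(l *\<^sub>R mat 1 - d \<xi>) ** S = 0"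
proof -
  define \<xi> where "\<xi> n = sgn (\<beta> n)" for n
  define t where "t n = norm (\<beta> n)" for n
  have t: "filterlim t at_top sequentially" using lim by (simp add: t_def[abs_def])
  have t0: "t n \<ge> 0" for n by (simp add: t_def)
  have \<beta>_eq: "\<beta> n = t n *\<^sub>R \<xi> n" for n by (cases "\<beta> n = 0") (simp_all add: \<xi>_def t_def sgn_div_norm)
  have \<xi>P: "\<xi> n \<in> \<pp>" for n
    unfolding \<xi>_def sgn_div_norm by (intro subspace_scale[OF subspace] \<beta>)
  have "\<exists>l v. norm v = 1 \<and> d (\<xi> n) *v v = l *\<^sub>R v \<and> l *\<^sub>R mat 1 - d (\<xi> n) \<in> psd" for n
  proof -
    obtain l v where v: "v \<noteq> 0" "d (\<xi> n) *v v = l *\<^sub>R v" "l *\<^sub>R mat 1 - d (\<xi> n) \<in> psd"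
      using hermitian_top_eigenvector[OF d_herm[OF \<xi>P]] by metis
    show ?thesis
      using v by (intro exI[of _ l] exI[of _ "(1 / norm v) *\<^sub>R v"])
        (simp add: matrix_vector_mult.scaleR_right)
  qed
  then obtain l v where v: "\<And>n. norm (v n) = 1" and ev: "\<And>n. d (\<xi> n) *v v n = l n *\<^sub>R v n"
    and psd: "\<And>n. l n *\<^sub>R mat 1 - d (\<xi> n) \<in> psd" by metis
  obtain K where K: "K > 0" "\<And>(A::complex^'n^'n) (u::complex^'n). norm (A *v u) \<le> norm A * norm u * K"
    using matrix_vector_mult.pos_bounded by blast
  obtain D where D: "D > 0" "\<And>\<beta>. norm (d \<beta>) \<le> norm \<beta> * D"
    using bounded_linear.pos_bounded[of d] linear_d by (auto simp: linear_conv_bounded_linear)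
  have \<xi>1: "norm (\<xi> n) \<le> 1" for n by (simp add: \<xi>_def norm_sgn)
  have l_bound: "\<bar>l n\<bar> \<le> D * K" for n
  proof -
    have "\<bar>l n\<bar> = norm (d (\<xi> n) *v v n)" by (simp add: ev v)
    also have "\<dots> \<le> norm (d (\<xi> n)) * K" using K(2)[of "d (\<xi> n)" "v n"] by (simp add: v)
    also have "\<dots> \<le> (1 * D) * K"
    proof (rule mult_right_mono)
      show "norm (d (\<xi> n)) \<le> 1 * D"
        using D(2)[of "\<xi> n"] mult_right_mono[OF \<xi>1[of n], of D] D(1) by linarith
    qed (use K in simp)
    finally show ?thesis by simp
  qed
  let ?C = "cball (0::'e) 1 \<times> cball (0::real) (D * K) \<times> sphere (0::complex^'n^'n) 1"
  let ?s = "\<lambda>n. (\<xi> n, l n, unit_exp (\<beta> n))"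
  have "compact ?C" by (intro compact_Times) auto
  then have sc: "seq_compact ?C" by (rule compact_imp_seq_compact)
  have "\<forall>n. ?s n \<in> ?C" using \<xi>1 l_bound by (simp add: norm_unit_exp)
  then obtain L r where L: "L \<in> ?C" "strict_mono (r :: nat \<Rightarrow> nat)" "(?s \<circ> r) \<longlonglongrightarrow> L"
    by (rule seq_compactE[OF sc])
  obtain \<xi>0 l0 S where Leq: "L = (\<xi>0, l0, S)" by (cases L) auto
  have l1: "(\<lambda>n. \<xi> (r n)) \<longlonglongrightarrow> \<xi>0" using tendsto_fst[OF L(3)] by (simp add: Leq o_def)
  have l2: "(\<lambda>n. l (r n)) \<longlonglongrightarrow> l0" using tendsto_fst[OF tendsto_snd[OF L(3)]] by (simp add: Leq o_def)
  have l3: "(\<lambda>n. unit_exp (\<beta> (r n))) \<longlonglongrightarrow> S"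
    using tendsto_snd[OF tendsto_snd[OF L(3)]] by (simp add: Leq o_def)
  have tr: "filterlim (\<lambda>n. t (r n)) at_top sequentially"
    using filterlim_compose[OF t filterlim_subseq[OF L(2)]] .
  have ld: "(\<lambda>n. d (\<xi> (r n))) \<longlonglongrightarrow> d \<xi>0"
    using bounded_linear.tendsto[of d] l1 linear_d by (auto simp: linear_conv_bounded_linear)
  have \<xi>0P: "\<xi>0 \<in> \<pp>"
    by (rule closed_sequentially[OF closed_subspace[OF subspace] _ l1]) (rule \<xi>P)
  have "norm \<xi>0 = 1"
  proof -
    have "\<forall>\<^sub>F n in sequentially. norm (\<xi> (r n)) = 1"
      using filterlim_at_top_dense[THEN iffD1, OF tr, rule_format, of 0]
      by eventually_elim (auto simp: \<xi>_def t_def norm_sgn)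
    then have "(\<lambda>n. norm (\<xi> (r n))) \<longlonglongrightarrow> 1" by (rule tendsto_eventually)
    then show ?thesis using LIMSEQ_unique tendsto_norm[OF l1] by blast
  qed
  then have \<xi>0: "\<xi>0 \<noteq> 0" by auto
  have S0: "S \<noteq> 0" using L(1) Leq by auto
  have lN: "(\<lambda>n. l (r n) *\<^sub>R mat 1 - d (\<xi> (r n))) \<longlonglongrightarrow> l0 *\<^sub>R mat 1 - d \<xi>0"
    by (intro tendsto_intros l2 ld)
  have N0: "l0 *\<^sub>R mat 1 - d \<xi>0 \<in> psd"
    by (rule closed_sequentially[OF closed_psd _ lN]) (rule psd)
  \<comment> \<open>the decay estimate, rescaled by the lower bound \<open>1 \<le> norm G * K\<close> that the fixed vector \<open>v n\<close> gives\<close>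
  have est: "2 * t n * Re (h ((l n *\<^sub>R mat 1 - d (\<xi> n)) *v (unit_exp (\<beta> n) *v u)) (unit_exp (\<beta> n) *v u)) \<le> K\<^sup>2 * hn u" for n u
  proof -
    define N where "N = l n *\<^sub>R mat 1 - d (\<xi> n)"
    define G where "G = mat_exp ((- t n) *\<^sub>R N)"
    have N: "N \<in> psd" using psd by (simp add: N_def)
    have "(- t n) *\<^sub>R N = t n *\<^sub>R (d (\<xi> n) - l n *\<^sub>R mat 1)" by (simp add: N_def algebra_simps)
    then have G: "G = exp (- t n * l n) *\<^sub>R mat_exp (d (\<beta> n))"
      by (simp add: G_def mat_exp_shift \<beta>_eq linear_scale[OF linear_d])
    have GU: "G = norm G *\<^sub>R unit_exp (\<beta> n)"
      using mat_exp_nonzero by (simp add: G unit_exp_def)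
    have "N *v v n = 0"
      by (simp add: N_def matrix_vector_mult_diff_rdistrib matrix_vector_mult.scaleR_left ev)
    then have "G *v v n = v n" unfolding G_def by (rule mat_exp_fixes_kernel)
    then have G1: "1 \<le> norm G * K" using K(2)[of G "v n"] v[of n] by simp
    define q where "q = 2 * t n * Re (h (N *v (unit_exp (\<beta> n) *v u)) (unit_exp (\<beta> n) *v u))"
    have q0: "q \<ge> 0" using psd_nonneg[OF N] t0 by (simp add: q_def)
    have "2 * t n * Re (h (N *v (G *v u)) (G *v u)) \<le> hn u"
      unfolding G_def using psd_flow_decay[OF N t0] .
    then have "(norm G)\<^sup>2 * q \<le> hn u"
      by (subst (asm) (1 2) GU) (simp add: q_def matrix_vector_mult.scaleR_left
          matrix_vector_mult.scaleR_right h.scaleR_left h.scaleR_right power2_eq_square mult_ac)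
    then have "K\<^sup>2 * ((norm G)\<^sup>2 * q) \<le> K\<^sup>2 * hn u" by (intro mult_left_mono) auto
    moreover have "1 * q \<le> (norm G * K)\<^sup>2 * q"
      using G1 q0 one_le_power[OF G1, of 2] by (intro mult_right_mono) auto
    ultimately show ?thesis unfolding q_def[unfolded N_def, symmetric]
      by (simp add: power_mult_distrib mult_ac N_def q_def)
  qed
  have "(l0 *\<^sub>R mat 1 - d \<xi>0) *v (S *v u) = 0" for u
  proof (rule psd_kernel[OF N0])
    let ?a = "\<lambda>n. Re (h ((l (r n) *\<^sub>R mat 1 - d (\<xi> (r n))) *v (unit_exp (\<beta> (r n)) *v u)) (unit_exp (\<beta> (r n)) *v u))"
    have a: "?a \<longlonglongrightarrow> Re (h ((l0 *\<^sub>R mat 1 - d \<xi>0) *v (S *v u)) (S *v u))"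
      by (intro tendsto_Re h.tendsto matrix_vector_mult.tendsto lN l3 tendsto_const)
    have "?a \<longlonglongrightarrow> 0"
    proof (rule tendsto_sandwich)
      show "\<forall>\<^sub>F n in sequentially. 0 \<le> ?a n" using psd_nonneg[OF psd] by simp
      show "\<forall>\<^sub>F n in sequentially. ?a n \<le> (K\<^sup>2 * hn u / 2) / t (r n)"
        using filterlim_at_top_dense[THEN iffD1, OF tr, rule_format, of 0]
      proof eventually_elim
        case (elim n)
        then show ?case using est[of "r n" u] by (simp add: field_simps)
      qed
      show "(\<lambda>n. (K\<^sup>2 * hn u / 2) / t (r n)) \<longlonglongrightarrow> 0"
        by (intro real_tendsto_divide_at_top[OF tendsto_const tr])
    qed simp
    then show "Re (h ((l0 *\<^sub>R mat 1 - d \<xi>0) *v (S *v u)) (S *v u)) = 0"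
      using LIMSEQ_unique[OF a] by simp
  qed
  then have "((l0 *\<^sub>R mat 1 - d \<xi>0) ** S) *v u = 0 *v u" for u
    by (simp add: matrix_vector_mul_assoc[symmetric])
  then have "(l0 *\<^sub>R mat 1 - d \<xi>0) ** S = 0" by (rule matrix_eqI)
  then show thesis
    using that[OF L(2) l3 _ S0 \<xi>0P \<xi>0 N0] l1 by (simp add: \<xi>_def)
qed

text \<open>If the inequality failed for arbitrarily large \<open>R\<close>, the asymptotics would give a direction \<open>\<xi>\<close> in which
  \<open>y\<close> is at least as large as the value \<open>l\<close> of the support function, which is impossible for an interior
  point.\<close>

lemma bary_outward:
  assumes y: "y \<in> top_of_set \<pp> interior_of body"
  shows "\<exists>R>0. \<forall>\<beta>\<in>\<pp>. norm \<beta> = R \<longrightarrow> 0 < (bary (mat_exp (d \<beta>)) - y) \<bullet> \<beta>"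
proof (rule ccontr)
  assume neg: "\<not> ?thesis"
  have "\<exists>\<beta>. \<beta> \<in> \<pp> \<and> norm \<beta> = real (Suc n) \<and> (bary (mat_exp (d \<beta>)) - y) \<bullet> \<beta> \<le> 0" for n
  proof (rule ccontr)
    assume "\<not> ?thesis"
    then have "\<forall>\<beta>\<in>\<pp>. norm \<beta> = real (Suc n) \<longrightarrow> 0 < (bary (mat_exp (d \<beta>)) - y) \<bullet> \<beta>"
      by (meson not_le)
    moreover have "real (Suc n) > 0" by simp
    ultimately show False using neg by blast
  qed
  then obtain \<beta> where \<beta>: "\<And>n. \<beta> n \<in> \<pp>" "\<And>n. norm (\<beta> n) = real (Suc n)"
    "\<And>n. (bary (mat_exp (d (\<beta> n))) - y) \<bullet> \<beta> n \<le> 0" by metis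
  have "filterlim (\<lambda>n. norm (\<beta> n)) at_top sequentially"
    unfolding \<beta>(2) by (rule filterlim_compose[OF filterlim_real_sequentially filterlim_Suc])
  from unit_exp_asymptotics[of \<beta>, OF \<beta>(1) this]
  obtain r S \<xi> l where r: "strict_mono r" and S: "(\<lambda>n. unit_exp (\<beta> (r n))) \<longlonglongrightarrow> S"
    and \<xi>: "(\<lambda>n. sgn (\<beta> (r n))) \<longlonglongrightarrow> \<xi>" and props: "S \<noteq> 0" "\<xi> \<in> \<pp>" "\<xi> \<noteq> 0"
    "l *\<^sub>R mat 1 - d \<xi> \<in> psd" "(l *\<^sub>R mat 1 - d \<xi>) ** S = 0" by metis
  have "(\<lambda>n. (bary (unit_exp (\<beta> (r n))) - y) \<bullet> sgn (\<beta> (r n))) \<longlonglongrightarrow> (bary S - y) \<bullet> \<xi>"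
    by (intro tendsto_intros bary_tendsto props S \<xi>)
  moreover have "(bary (unit_exp (\<beta> (r n))) - y) \<bullet> sgn (\<beta> (r n)) \<le> 0" for n
    using \<beta>(3)[of "r n"] by (simp add: bary_unit_exp sgn_div_norm mult_nonneg_nonpos)
  ultimately have "(bary S - y) \<bullet> \<xi> \<le> 0" by (intro LIMSEQ_le_const2) auto
  moreover have "bary S \<bullet> \<xi> = l" by (rule bary_at_infinity[OF props(2,1,5)])
  moreover have "y \<bullet> \<xi> < l"
    by (rule interior_point_not_extremal[OF subspace y props(2,3)]) (rule body_le_top[OF props(2,4)])
  ultimately show False by (simp add: inner_diff_left)
qed

lemma bary_exp_image: "(\<lambda>\<beta>. bary (mat_exp (d \<beta>))) ` \<pp> = top_of_set \<pp> interior_of body"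
proof (rule equalityI; rule subsetI)
  fix y assume "y \<in> (\<lambda>\<beta>. bary (mat_exp (d \<beta>))) ` \<pp>"
  then show "y \<in> top_of_set \<pp> interior_of body" using bary_exp_interior by auto
next
  fix y assume y: "y \<in> top_of_set \<pp> interior_of body"
  then obtain R where R: "R > 0" "\<And>\<beta>. \<beta> \<in> \<pp> \<Longrightarrow> norm \<beta> = R \<Longrightarrow> 0 < (bary (mat_exp (d \<beta>)) - y) \<bullet> \<beta>"
    using bary_outward by blast
  have yP: "y \<in> \<pp>" using y interior_of_subset[of "top_of_set \<pp>" body] body_sub by auto
  have "\<exists>\<beta>\<in>\<pp>. bary (mat_exp (d \<beta>)) - y = 0"
  proof (rule poincare_bohl[OF subspace _ _ R])
    show "continuous_on \<pp> (\<lambda>\<beta>. bary (mat_exp (d \<beta>)) - y)"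
      using mat_exp_nonzero
      by (intro continuous_intros continuous_on_compose2[OF continuous_on_bary]
          continuous_on_subset[OF continuous_on_mat_exp_d]) auto
    show "(\<lambda>\<beta>. bary (mat_exp (d \<beta>)) - y) ` \<pp> \<subseteq> \<pp>"
      using bary_exp_in_body body_sub yP by (auto intro!: subspace_diff[OF subspace])
  qed
  then show "y \<in> (\<lambda>\<beta>. bary (mat_exp (d \<beta>))) ` \<pp>" by force
qed

end

section \<open>Extension to the closure of the space of positive lines\<close>

text \<open>The ball around \<open>y0\<close> inside \<open>E\<close> is shrunk towards \<open>y\<close> by the factor \<open>s\<close>.\<close>

lemma convex_shrink_interior_of:
  fixes E :: "'a::euclidean_space set"
  assumes P: "subspace P" and E: "E \<subseteq> P" "convex E" and y: "y \<in> E"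
    and y0: "y0 \<in> top_of_set P interior_of E" and s: "0 < s" "s \<le> 1"
  shows "y + s *\<^sub>R (y0 - y) \<in> top_of_set P interior_of E"
proof -
  let ?z = "y + s *\<^sub>R (y0 - y)"
  obtain U where U: "openin (top_of_set P) U" "y0 \<in> U" "U \<subseteq> E"
    using y0 by (auto simp: interior_of_def)
  then obtain V where V: "open V" "U = P \<inter> V" by (auto simp: openin_open)
  then obtain e where e: "e > 0" "ball y0 e \<subseteq> V" using U openE by blast
  have yP: "y \<in> P" "y0 \<in> P" using y E U V by auto
  have "w \<in> E" if w: "w \<in> P" "w \<in> ball ?z (s * e)" for w
  proof -
    define w0 where "w0 = y + (1 / s) *\<^sub>R (w - y)"
    have "w0 \<in> P" using w yP P by (auto simp: w0_def intro!: subspace_add subspace_scale subspace_diff)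
    moreover have "s *\<^sub>R (y0 - w0) = ?z - w" using s by (simp add: w0_def algebra_simps)
    then have "s * norm (y0 - w0) = norm (?z - w)" using s by (metis abs_of_pos norm_scaleR)
    then have "s * dist y0 w0 < s * e" using w by (simp add: dist_norm)
    then have "w0 \<in> ball y0 e" using s by simp
    ultimately have "w0 \<in> E" using e V U by auto
    then have "(1 - s) *\<^sub>R y + s *\<^sub>R w0 \<in> E" using y s E(2) by (intro convexD_alt) auto
    moreover have "(1 - s) *\<^sub>R y + s *\<^sub>R w0 = w" using s by (simp add: w0_def algebra_simps)
    ultimately show ?thesis by simp
  qed
  then have "P \<inter> ball ?z (s * e) \<subseteq> E" by auto
  moreover have "openin (top_of_set P) (P \<inter> ball ?z (s * e))" by (simp add: openin_open_Int)
  moreover have "?z \<in> P" using yP P by (auto intro!: subspace_add subspace_scale subspace_diff)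
  ultimately show ?thesis using s e by (auto simp: interior_of_def)
qed

text \<open>Real lines, as opposed to rays, through a compact set: two cones, one for each sign.\<close>

lemma closed_lines_over_compact:
  fixes D :: "'a::euclidean_space set"
  assumes "compact D" "0 \<notin> D"
  shows "closed {c *\<^sub>R x | c x. x \<in> D}"
proof -
  have "closed (conic hull D)" "closed (conic hull (uminus ` D))"
    using assms by (auto intro!: closed_conic_hull compact_negations)
  moreover have "{c *\<^sub>R x | c x. x \<in> D} = conic hull D \<union> conic hull (uminus ` D)"
  proof (rule equalityI; rule subsetI)
    fix z assume "z \<in> {c *\<^sub>R x | c x. x \<in> D}"
    then obtain c x where z: "z = c *\<^sub>R x" "x \<in> D" by auto
    show "z \<in> conic hull D \<union> conic hull (uminus ` D)"
    proof (cases "c \<ge> 0")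
      case False
      then have "z = (- c) *\<^sub>R (- x)" "- c \<ge> 0" using z by auto
      then have "z \<in> conic hull (uminus ` D)" unfolding conic_hull_explicit using z(2) by blast
      then show ?thesis by simp
    qed (use z in \<open>auto simp: conic_hull_explicit\<close>)
  next
    fix z assume "z \<in> conic hull D \<union> conic hull (uminus ` D)"
    then obtain c x where "x \<in> D" "z = c *\<^sub>R x \<or> z = c *\<^sub>R (- x)"
      unfolding conic_hull_explicit by blast
    then have "x \<in> D \<and> (z = c *\<^sub>R x \<or> z = (- c) *\<^sub>R x)" by auto
    then show "z \<in> {c *\<^sub>R x | c x. x \<in> D}" by blast
  qed
  ultimately show ?thesis by (simp only: closed_Un)
qed

lemma span_singleton_nonzero_eq:
  fixes A B :: "'a::real_vector"
  assumes "B \<noteq> 0" "span {B} = span {A}"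
  obtains c where "c \<noteq> 0" "B = c *\<^sub>R A"
proof -
  have "B \<in> span {A}" using assms(2) span_base[of B "{B}"] by simp
  then obtain c where "B = c *\<^sub>R A" by (auto simp: span_singleton)
  with assms(1) that show thesis by auto
qed

lemma span_singleton_scaleR: "c \<noteq> 0 \<Longrightarrow> span {c *\<^sub>R A} = span {A::'a::real_vector}"
  using span_image_scale[of "{A}" "\<lambda>_. c"] by simp

context moment_setting
begin

text \<open>The square roots of the points of the compactification, normalised to norm \<open>1\<close>.\<close>

definition limits :: "(complex^'n^'n) set" where
  "limits = closure (unit_exp ` \<pp>)"

definition sqline :: "complex^'n^'n \<Rightarrow> (complex^'n^'n) set" where
  "sqline S = span {S ** S}"

lemma limits_obtain:
  assumes "S \<in> limits"
  obtains \<beta> where "\<And>n. \<beta> n \<in> \<pp>" "(\<lambda>n. unit_exp (\<beta> n)) \<longlonglongrightarrow> S"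
proof -
  obtain u where u: "\<And>n. u n \<in> unit_exp ` \<pp>" "u \<longlonglongrightarrow> S"
    using assms unfolding limits_def closure_sequential by blast
  then have "\<forall>n. \<exists>\<beta>. \<beta> \<in> \<pp> \<and> u n = unit_exp \<beta>" by blast
  then obtain \<beta> where "\<And>n. \<beta> n \<in> \<pp>" "\<And>n. u n = unit_exp (\<beta> n)" by metis
  moreover from this have "u = (\<lambda>n. unit_exp (\<beta> n))" by auto
  ultimately show thesis using that u(2) by auto
qed

lemma limits_norm: "S \<in> limits \<Longrightarrow> norm S = 1"
proof -
  have "closure (unit_exp ` \<pp>) \<subseteq> sphere 0 1"
    by (rule closure_minimal) (auto simp: norm_unit_exp)
  then show "S \<in> limits \<Longrightarrow> norm S = 1" unfolding limits_def by auto
qed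

lemma limits_psd: "S \<in> limits \<Longrightarrow> S \<in> psd"
proof -
  have "closure (unit_exp ` \<pp>) \<subseteq> psd"
    by (rule closure_minimal) (auto simp: unit_exp_psd closed_psd)
  then show "S \<in> limits \<Longrightarrow> S \<in> psd" unfolding limits_def by auto
qed

lemma limits_nonzero: "S \<in> limits \<Longrightarrow> S \<noteq> 0"
  using limits_norm by force

lemma compact_limits: "compact limits"
  unfolding limits_def by (rule compact_closure[THEN iffD2]) (auto simp: bounded_iff norm_unit_exp)

lemma psd_square_form: "S \<in> psd \<Longrightarrow> Re (h ((S ** S) *v v) v) = hn (S *v v)"
  by (simp add: matrix_vector_mul_assoc[symmetric] herm_endosD[OF psd_herm] hn_def)

lemma psd_square_nonzero: "S \<in> psd \<Longrightarrow> S \<noteq> 0 \<Longrightarrow> S ** S \<noteq> 0"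
proof
  assume S: "S \<in> psd" "S \<noteq> 0" "S ** S = 0"
  have "S *v v = 0 *v v" for v using psd_square_form[OF S(1), of v] S(3) by (simp add: h.zero_left)
  then have "S = 0" by (rule matrix_eqI)
  with S show False by simp
qed

text \<open>If \<open>S\<^sup>2\<close> and \<open>T\<^sup>2\<close> span the same line, the factor between them is positive, so it has a square root and
  uniqueness of square roots applies; the normalisation then fixes the factor.\<close>

lemma sqline_inj:
  assumes S: "S \<in> limits" and T: "T \<in> limits" and eq: "sqline S = sqline T"
  shows "S = T"
proof -
  note psd = limits_psd[OF S] limits_psd[OF T]
  obtain c where c: "S ** S = c *\<^sub>R (T ** T)"
    using span_singleton_nonzero_eq[OF psd_square_nonzero[OF psd(1) limits_nonzero[OF S]]] eq
    unfolding sqline_def by metis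
  have hc: "hn (S *v v) = c * hn (T *v v)" for v
    using psd_square_form[OF psd(1), of v] psd_square_form[OF psd(2), of v]
    by (simp add: c matrix_vector_mult.scaleR_left h.scaleR_left)
  obtain v where v: "S *v v \<noteq> 0" using limits_nonzero[OF S] matrix_eqI[of S 0] by auto
  have "c > 0"
  proof (rule ccontr)
    assume "\<not> c > 0"
    then have "c * hn (T *v v) \<le> 0" using hn_nonneg by (simp add: mult_nonpos_nonneg)
    then show False using hc[of v] hn_pos[OF v] by simp
  qed
  then have "(sqrt c *\<^sub>R T) ** (sqrt c *\<^sub>R T) = S ** S"
    by (simp add: c matrix_mult.scaleR_left matrix_mult.scaleR_right)
  then have ST: "S = sqrt c *\<^sub>R T"
    using psd_sqrt_unique[OF psd(1) psd_scaleR[OF psd(2), of "sqrt c"]] \<open>c > 0\<close> by simp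
  then have "sqrt c = 1" using limits_norm[OF S] limits_norm[OF T] \<open>c > 0\<close> by simp
  then show ?thesis using ST by simp
qed

lemma openin_herm_proj_space:
  "openin (herm_proj_space h) U \<longleftrightarrow> U \<subseteq> (\<lambda>A. span {A}) ` (herm_endos h - {0}) \<and>
     openin (top_of_set (herm_endos h - {0})) {A \<in> herm_endos h - {0}. span {A} \<in> U}"
  unfolding herm_proj_space_def openin_quotient_topology by simp

lemma topspace_herm_proj_space:
  "topspace (herm_proj_space h) = (\<lambda>A. span {A}) ` (herm_endos h - {0})"
proof -
  have "{A \<in> herm_endos h - {0}. span {A} \<in> (\<lambda>A. span {A}) ` (herm_endos h - {0})} = herm_endos h - {0}"
    by auto
  then have "openin (herm_proj_space h) ((\<lambda>A. span {A}) ` (herm_endos h - {0}))"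
    unfolding openin_herm_proj_space by simp
  then have "(\<lambda>A. span {A}) ` (herm_endos h - {0}) \<subseteq> topspace (herm_proj_space h)"
    by (rule openin_subset)
  moreover have "topspace (herm_proj_space h) \<subseteq> (\<lambda>A. span {A}) ` (herm_endos h - {0})"
    using openin_topspace[of "herm_proj_space h"] unfolding openin_herm_proj_space by simp
  ultimately show ?thesis by (rule equalityI[rotated])
qed

lemma limits_square: "S \<in> limits \<Longrightarrow> S ** S \<in> herm_endos h - {0}"
  by (simp add: limits_psd limits_nonzero psd_square_nonzero herm_endos_square psd_herm)

lemma sqline_in_topspace: "S \<in> limits \<Longrightarrow> sqline S \<in> topspace (herm_proj_space h)"
  unfolding topspace_herm_proj_space sqline_def
  by (rule image_eqI[OF refl]) (rule limits_square)

text \<open>Together with injectivity this makes \<open>sqline\<close> a homeomorphism onto its image: in the quotient topology a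
  set of lines is closed if the union of the lines is closed away from \<open>0\<close>.\<close>

lemma closedin_sqline_image:
  assumes C: "C \<subseteq> limits" "compact C"
  shows "closedin (herm_proj_space h) (sqline ` C)"
proof -
  let ?sq = "(\<lambda>S. S ** S) ` C"
  have "compact ?sq"
    by (intro compact_continuous_image C matrix_mult.continuous_on continuous_intros)
  moreover have "0 \<notin> ?sq" using C(1) limits_square by force
  ultimately have cl: "closed {c *\<^sub>R B | c B. B \<in> ?sq}" by (rule closed_lines_over_compact)
  let ?Z = "{A \<in> herm_endos h - {0}. span {A} \<in> topspace (herm_proj_space h) - sqline ` C}"
  have "?Z = (herm_endos h - {0}) \<inter> - {c *\<^sub>R B | c B. B \<in> ?sq}"
  proof -
    have "span {A} \<in> sqline ` C \<longleftrightarrow> A \<in> {c *\<^sub>R B | c B. B \<in> ?sq}" if A: "A \<noteq> 0" for A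
    proof
      assume "span {A} \<in> sqline ` C"
      then obtain S where S: "S \<in> C" "span {A} = span {S ** S}" by (auto simp: sqline_def)
      then obtain c where "A = c *\<^sub>R (S ** S)" using span_singleton_nonzero_eq[OF A] by metis
      then show "A \<in> {c *\<^sub>R B | c B. B \<in> ?sq}" using S by blast
    next
      assume "A \<in> {c *\<^sub>R B | c B. B \<in> ?sq}"
      then obtain c S where S: "A = c *\<^sub>R (S ** S)" "S \<in> C" by blast
      then have "c \<noteq> 0" using A by auto
      then have "span {A} = sqline S" using S by (simp add: sqline_def span_singleton_scaleR)
      then show "span {A} \<in> sqline ` C" using S by blast
    qed
    then have "span {A} \<in> topspace (herm_proj_space h) - sqline ` C \<longleftrightarrow>
        A \<in> - {c *\<^sub>R B | c B. B \<in> ?sq}" if "A \<in> herm_endos h - {0}" for A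
      using that unfolding topspace_herm_proj_space by blast
    then show ?thesis by blast
  qed
  moreover have "openin (top_of_set (herm_endos h - {0}))
      ((herm_endos h - {0}) \<inter> - {c *\<^sub>R B | c B. B \<in> ?sq})"
    using cl by (intro openin_open_Int) (simp add: open_Compl)
  ultimately have "openin (herm_proj_space h) (topspace (herm_proj_space h) - sqline ` C)"
    unfolding openin_herm_proj_space by (auto simp: topspace_herm_proj_space)
  then show ?thesis using C sqline_in_topspace by (auto simp: closedin_def)
qed

text \<open>The image of the symmetric space under the Satake embedding.\<close>

definition interior_points :: "(complex^'n^'n) set set" where
  "interior_points = (\<lambda>\<beta>. span {mat_exp (d \<beta>) ** mat_exp (d \<beta>)}) ` \<pp>"

lemma sqline_unit_exp: "sqline (unit_exp \<beta>) = span {mat_exp (d \<beta>) ** mat_exp (d \<beta>)}"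
  using mat_exp_nonzero[of "d \<beta>"]
  by (simp add: sqline_def unit_exp_def matrix_mult.scaleR_left matrix_mult.scaleR_right
      span_singleton_scaleR)

lemma unit_exp_in_limits: "\<beta> \<in> \<pp> \<Longrightarrow> unit_exp \<beta> \<in> limits"
  unfolding limits_def by (rule subsetD[OF closure_subset imageI])

lemma interior_points_closure: "herm_proj_space h closure_of interior_points = sqline ` limits"
proof (rule equalityI)
  show "herm_proj_space h closure_of interior_points \<subseteq> sqline ` limits"
  proof (rule closure_of_minimal)
    show "interior_points \<subseteq> sqline ` limits"
      unfolding interior_points_def sqline_unit_exp[symmetric] by (intro subsetI, erule imageE) (simp add: unit_exp_in_limits)
    show "closedin (herm_proj_space h) (sqline ` limits)"
      by (rule closedin_sqline_image[OF order_refl compact_limits])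
  qed
next
  show "sqline ` limits \<subseteq> herm_proj_space h closure_of interior_points"
  proof clarify
    fix S assume S: "S \<in> limits"
    then obtain \<beta> where \<beta>: "\<And>n. \<beta> n \<in> \<pp>" "(\<lambda>n. unit_exp (\<beta> n)) \<longlonglongrightarrow> S"
      by (rule limits_obtain) blast
    show "sqline S \<in> herm_proj_space h closure_of interior_points"
      unfolding in_closure_of
    proof (intro conjI allI impI)
      show "sqline S \<in> topspace (herm_proj_space h)" by (rule sqline_in_topspace[OF S])
      fix U assume U: "sqline S \<in> U \<and> openin (herm_proj_space h) U"
      then obtain V where V: "open V" "{A \<in> herm_endos h - {0}. span {A} \<in> U} = (herm_endos h - {0}) \<inter> V"
        unfolding openin_herm_proj_space openin_open by blast
      have iff: "T \<in> limits \<Longrightarrow> T ** T \<in> V \<longleftrightarrow> sqline T \<in> U" for T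
        using limits_square[of T] V(2) unfolding sqline_def by blast
      have "(\<lambda>n. unit_exp (\<beta> n) ** unit_exp (\<beta> n)) \<longlonglongrightarrow> S ** S"
        by (intro matrix_mult.tendsto \<beta>)
      moreover have "S ** S \<in> V" using iff[OF S] U by simp
      ultimately have "\<forall>\<^sub>F n in sequentially. unit_exp (\<beta> n) ** unit_exp (\<beta> n) \<in> V"
        using V(1) by (auto simp: tendsto_def)
      then obtain n where "unit_exp (\<beta> n) ** unit_exp (\<beta> n) \<in> V"
        using eventually_happens'[OF sequentially_bot] by blast
      then have "sqline (unit_exp (\<beta> n)) \<in> U" using iff[OF unit_exp_in_limits[OF \<beta>(1)]] by simp
      moreover have "sqline (unit_exp (\<beta> n)) \<in> interior_points"
        unfolding interior_points_def sqline_unit_exp using \<beta>(1) by blast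
      ultimately show "\<exists>y. y \<in> interior_points \<and> y \<in> U" by blast
    qed
  qed
qed

lemma bary_limits_in_body:
  assumes "S \<in> limits"
  shows "bary S \<in> body"
proof -
  obtain \<beta> where \<beta>: "\<And>n. \<beta> n \<in> \<pp>" "(\<lambda>n. unit_exp (\<beta> n)) \<longlonglongrightarrow> S"
    using assms by (rule limits_obtain) blast
  show ?thesis
  proof (rule closed_sequentially[OF compact_imp_closed[OF compact_body]])
    show "(\<lambda>n. bary (unit_exp (\<beta> n))) \<longlonglongrightarrow> bary S"
      by (rule bary_tendsto[OF limits_nonzero[OF assms] \<beta>(2)])
    show "bary (unit_exp (\<beta> n)) \<in> body" for n
      by (simp add: bary_unit_exp bary_exp_in_body \<beta>)
  qed
qed

text \<open>A limit \<open>S\<close> that is not attained comes from a sequence \<open>\<beta>\<^sub>n\<close> that leaves every ball, since the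
  exponentials of a ball form a compact set.\<close>

lemma bary_boundary:
  assumes S: "S \<in> limits" and not_in: "S \<notin> unit_exp ` \<pp>"
  shows "bary S \<in> top_of_set \<pp> frontier_of body"
proof -
  obtain \<beta> where \<beta>: "\<And>n. \<beta> n \<in> \<pp>" "(\<lambda>n. unit_exp (\<beta> n)) \<longlonglongrightarrow> S"
    using S by (rule limits_obtain) blast
  have "filterlim (\<lambda>n. norm (\<beta> n)) at_top sequentially"
    unfolding filterlim_at_top_dense
  proof
    fix R :: real
    have "compact (unit_exp ` (\<pp> \<inter> cball 0 R))"
      by (intro compact_continuous_image closed_Int_compact closed_subspace subspace
          continuous_on_subset[OF continuous_on_unit_exp]) auto
    then have "open (- unit_exp ` (\<pp> \<inter> cball 0 R))" by (simp add: compact_imp_closed open_Compl)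
    moreover have "S \<in> - unit_exp ` (\<pp> \<inter> cball 0 R)" using not_in by auto
    ultimately have "\<forall>\<^sub>F n in sequentially. unit_exp (\<beta> n) \<in> - unit_exp ` (\<pp> \<inter> cball 0 R)"
      by (rule topological_tendstoD[OF \<beta>(2)])
    then show "\<forall>\<^sub>F n in sequentially. R < norm (\<beta> n)"
    proof eventually_elim
      case (elim n)
      then show ?case using \<beta>(1)[of n] by (auto simp: not_le[symmetric])
    qed
  qed
  from unit_exp_asymptotics[of \<beta>, OF \<beta>(1) this]
  obtain r S' \<xi> l where r: "strict_mono r" and S': "(\<lambda>n. unit_exp (\<beta> (r n))) \<longlonglongrightarrow> S'"
    and props: "\<xi> \<in> \<pp>" "\<xi> \<noteq> 0" "l *\<^sub>R mat 1 - d \<xi> \<in> psd" "(l *\<^sub>R mat 1 - d \<xi>) ** S' = 0" by metis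
  have "S' = S"
    using LIMSEQ_unique[OF S'] LIMSEQ_subseq_LIMSEQ[OF \<beta>(2) r] by (simp add: o_def)
  then have l: "bary S \<bullet> \<xi> = l"
    using bary_at_infinity[OF props(1) limits_nonzero[OF S]] props(4) by simp
  have "bary S \<notin> top_of_set \<pp> interior_of body"
    using interior_point_not_extremal[OF subspace _ props(1,2) body_le_top[OF props(1,3)]] l by force
  moreover have "bary S \<in> top_of_set \<pp> closure_of body"
    using bary_limits_in_body[OF S] closure_of_subset[of body "top_of_set \<pp>"] body_sub by auto
  ultimately show ?thesis by (simp add: frontier_of_def)
qed

text \<open>The image is compact and contains the interior of the body. As this interior is nonempty, it is dense in
  the body.\<close>

lemma bary_limits_image: "bary ` limits = body"
proof (rule equalityI)
  show "bary ` limits \<subseteq> body" using bary_limits_in_body by blast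
  show "body \<subseteq> bary ` limits"
  proof
    fix y assume y: "y \<in> body"
    let ?I = "top_of_set \<pp> interior_of body"
    define y0 where "y0 = bary (mat_exp (d 0))"
    have y0: "y0 \<in> ?I" unfolding y0_def by (rule bary_exp_interior[OF subspace_0[OF subspace]])
    define u where "u n = y + inverse (real (Suc n)) *\<^sub>R (y0 - y)" for n
    have "u n \<in> ?I" for n
      unfolding u_def
      by (rule convex_shrink_interior_of[OF subspace body_sub convex_body y y0]) (auto simp: inverse_le_1_iff)
    moreover have "?I \<subseteq> bary ` limits"
    proof
      fix z assume "z \<in> ?I"
      then obtain \<beta> where "\<beta> \<in> \<pp>" "z = bary (mat_exp (d \<beta>))" using bary_exp_image by blast
      then show "z \<in> bary ` limits"
        by (intro image_eqI[of _ _ "unit_exp \<beta>"]) (simp_all add: bary_unit_exp unit_exp_in_limits)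
    qed
    ultimately have un: "u n \<in> bary ` limits" for n by blast
    have "u \<longlonglongrightarrow> y + 0 *\<^sub>R (y0 - y)"
      unfolding u_def by (intro tendsto_intros LIMSEQ_inverse_real_of_nat)
    moreover have "closed (bary ` limits)"
      using limits_nonzero
      by (intro compact_imp_closed compact_continuous_image compact_limits
          continuous_on_subset[OF continuous_on_bary]) auto
    ultimately show "y \<in> bary ` limits" using closed_sequentially un by fastforce
  qed
qed

text \<open>The extension sends the line \<open>[S\<^sup>2]\<close> to \<open>bary S\<close>, where \<open>S\<close> is its normalised positive square root.\<close>

theorem bary_extends_to_closure:
  fixes Sat defines "Sat \<equiv> herm_proj_space h closure_of interior_points"
  obtains \<Psi> where "continuous_map (subtopology (herm_proj_space h) Sat) (top_of_set \<pp>) \<Psi>"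
    "\<And>\<beta>. \<beta> \<in> \<pp> \<Longrightarrow> \<Psi> (span {mat_exp (d \<beta>) ** mat_exp (d \<beta>)}) = bary (mat_exp (d \<beta>))"
    "\<Psi> ` (Sat - interior_points) \<subseteq> top_of_set \<pp> frontier_of body"
    "\<Psi> ` Sat = body"
proof
  have Sat: "Sat = sqline ` limits" by (simp add: Sat_def interior_points_closure)
  define \<Psi> where "\<Psi> L = bary (the_inv_into limits sqline L)" for L
  have inj: "inj_on sqline limits" by (rule inj_onI) (rule sqline_inj)
  have \<Psi>: "\<Psi> (sqline S) = bary S" if "S \<in> limits" for S
    using that by (simp add: \<Psi>_def the_inv_into_f_f[OF inj])
  have "topspace (subtopology (herm_proj_space h) Sat) = Sat"
    using sqline_in_topspace by (auto simp: Sat)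
  moreover have "closedin (subtopology (herm_proj_space h) Sat) {L \<in> Sat. \<Psi> L \<in> W}"
    if W: "closedin (top_of_set \<pp>) W" for W
  proof -
    have "closed W" using W closed_subspace[OF subspace] closedin_closed_trans by blast
    moreover have "continuous_on limits bary"
      using limits_nonzero by (intro continuous_on_subset[OF continuous_on_bary]) auto
    ultimately have "closed (limits \<inter> bary -` W)"
      by (intro continuous_closed_preimage compact_imp_closed[OF compact_limits])
    then have "compact (limits \<inter> (limits \<inter> bary -` W))"
      by (intro compact_Int_closed compact_limits)
    then have "closedin (herm_proj_space h) (sqline ` (limits \<inter> bary -` W))"
      by (intro closedin_sqline_image) (auto simp: Int_assoc[symmetric])
    moreover have "{L \<in> Sat. \<Psi> L \<in> W} = sqline ` (limits \<inter> bary -` W)"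
      using \<Psi> by (auto simp: Sat)
    ultimately show ?thesis
      by (intro closedin_subset_topspace) auto
  qed
  ultimately show "continuous_map (subtopology (herm_proj_space h) Sat) (top_of_set \<pp>) \<Psi>"
    unfolding continuous_map_closedin using \<Psi> bary_limits_in_body body_sub by (auto simp: Sat)
  show "\<Psi> (span {mat_exp (d \<beta>) ** mat_exp (d \<beta>)}) = bary (mat_exp (d \<beta>))" if "\<beta> \<in> \<pp>" for \<beta>
    using \<Psi>[OF unit_exp_in_limits[OF that]] by (simp add: sqline_unit_exp bary_unit_exp)
  show "\<Psi> ` (Sat - interior_points) \<subseteq> top_of_set \<pp> frontier_of body"
  proof
    fix z assume "z \<in> \<Psi> ` (Sat - interior_points)"
    then obtain S where S: "S \<in> limits" "sqline S \<notin> interior_points" "z = \<Psi> (sqline S)"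
      by (auto simp: Sat)
    then have "S \<notin> unit_exp ` \<pp>" by (auto simp: interior_points_def sqline_unit_exp)
    then show "z \<in> top_of_set \<pp> frontier_of body" using bary_boundary S \<Psi> by simp
  qed
  have "\<Psi> ` Sat = bary ` limits" using \<Psi> by (simp add: Sat image_image)
  then show "\<Psi> ` Sat = body" by (simp add: bary_limits_image)
qed

end

section \<open>Injectivity of the differential on the positive part\<close>

lemma smooth_on_differentiable: "smooth_on S f \<Longrightarrow> x \<in> S \<Longrightarrow> f differentiable (at x)"
  unfolding smooth_on_def by (metis ck_on.simps(2))

text \<open>Two orders of smoothness, in the form needed to differentiate the adjoint representation.\<close>

lemma smooth_on_derivative_differentiable:
  assumes "smooth_on S f" "x \<in> S"
  shows "(\<lambda>x. frechet_derivative f (at x) v) differentiable (at x)"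
proof -
  have "ck_on (Suc (Suc 0)) S f" using assms(1) by (simp only: smooth_on_def)
  then have "ck_on (Suc 0) S (\<lambda>x. frechet_derivative f (at x) v)"
    unfolding ck_on.simps(2)[of "Suc 0"] by (elim conjE allE)
  then show ?thesis using assms(2) by simp
qed

lemma has_derivative_frechet_derivative: "f differentiable (at x) \<Longrightarrow> (f has_derivative frechet_derivative f (at x)) (at x)"
  by (simp add: frechet_derivative_works)

lemma frechet_derivative_eqI: "(f has_derivative f') (at x) \<Longrightarrow> frechet_derivative f (at x) = f'"
  by (rule frechet_derivative_at[symmetric])

locale lie_rep =
  fixes G :: "('g, 'm) monoid_scheme" and T :: "'g topology"
    and A :: "('g, 'e::euclidean_space) chart set" and c :: "('g, 'e) chart"
    and \<tau> :: "'g \<Rightarrow> complex^'n^'n"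
  assumes lie: "lie_group G T A" and chart: "chart_at_one G A c"
    and rep: "sl_representation G A \<tau>"
begin

abbreviation "R \<equiv> chart_range c"
abbreviation "\<phi> \<equiv> snd c"
abbreviation "\<psi> \<equiv> chart_inv c"
abbreviation "e \<equiv> \<phi> \<one>\<^bsub>G\<^esub>"
abbreviation "d\<tau> \<equiv> differential G c \<tau>"

sublocale group G
  using lie by (simp add: lie_group_def)

lemma topspace_T: "topspace T = carrier G"
  and mult_cont: "continuous_map (prod_topology T T) T (\<lambda>(x, y). x \<otimes>\<^bsub>G\<^esub> y)"
  and inv_cont: "continuous_map T T (\<lambda>x. inv\<^bsub>G\<^esub> x)"
  and Hausdorff_T: "Hausdorff_space T"
  using lie by (auto simp: lie_group_def smooth_manifold_def)

lemma c_in: "c \<in> A" and one_dom: "\<one>\<^bsub>G\<^esub> \<in> fst c"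
  using chart by (auto simp: chart_at_one_def)

lemma is_chart: "is_chart T c"
  using lie c_in by (auto simp: lie_group_def smooth_manifold_def)

lemma open_dom: "openin T (fst c)" and open_R: "open R"
  and homeo: "homeomorphic_map (subtopology T (fst c)) (top_of_set R) \<phi>"
  using is_chart by (auto simp: is_chart_def)

lemma dom_sub: "fst c \<subseteq> carrier G"
  using openin_subset[OF open_dom] by (simp add: topspace_T)

lemma inj_\<phi>: "inj_on \<phi> (fst c)"
  using homeomorphic_imp_injective_map[OF homeo] dom_sub by (simp add: topspace_T Int_absorb1)

lemma \<phi>_in_R: "g \<in> fst c \<Longrightarrow> \<phi> g \<in> R"
  by (simp add: chart_range_def)

lemma \<psi>_\<phi> [simp]: "g \<in> fst c \<Longrightarrow> \<psi> (\<phi> g) = g"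
  by (simp add: chart_inv_def inj_\<phi>)

lemma \<phi>_\<psi> [simp]: "x \<in> R \<Longrightarrow> \<phi> (\<psi> x) = x"
  by (simp add: chart_inv_def chart_range_def f_inv_into_f)

lemma \<psi>_dom: "x \<in> R \<Longrightarrow> \<psi> x \<in> fst c"
  by (simp add: chart_inv_def chart_range_def inv_into_into)

lemma \<psi>_carrier: "x \<in> R \<Longrightarrow> \<psi> x \<in> carrier G"
  using \<psi>_dom dom_sub by blast

lemma e_in_R: "e \<in> R" and \<psi>_e [simp]: "\<psi> e = \<one>\<^bsub>G\<^esub>"
  using one_dom by (auto simp: \<phi>_in_R)

lemma open_\<psi>_preimage:
  assumes "openin T U"
  shows "open {x \<in> R. \<psi> x \<in> U}"
proof -
  have "openin (subtopology T (fst c)) (fst c \<inter> U)"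
    using openin_subtopology_Int[OF assms, of "fst c"] by (simp only: Int_commute)
  then have "openin (top_of_set R) (\<phi> ` (fst c \<inter> U))"
    using homeo by (metis homeomorphic_imp_open_map open_map_def)
  also have "\<phi> ` (fst c \<inter> U) = {x \<in> R. \<psi> x \<in> U}"
    by (force simp: chart_range_def \<psi>_dom[unfolded chart_range_def] intro: \<phi>_\<psi>[unfolded chart_range_def, symmetric])
  finally show ?thesis using open_R openin_open_trans by blast
qed

lemma left_mult_cont: "g \<in> carrier G \<Longrightarrow> continuous_map T T (\<lambda>y. g \<otimes>\<^bsub>G\<^esub> y)"
proof -
  assume g: "g \<in> carrier G"
  have "continuous_map T (prod_topology T T) (\<lambda>y. (g, y))"
    using g by (simp add: continuous_map_pairwise o_def topspace_T)
  from continuous_map_compose[OF this mult_cont] show ?thesis by (simp add: o_def)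
qed

lemma right_mult_cont: "g \<in> carrier G \<Longrightarrow> continuous_map T T (\<lambda>y. y \<otimes>\<^bsub>G\<^esub> g)"
proof -
  assume g: "g \<in> carrier G"
  have "continuous_map T (prod_topology T T) (\<lambda>y. (y, g))"
    using g by (simp add: continuous_map_pairwise o_def topspace_T)
  from continuous_map_compose[OF this mult_cont] show ?thesis by (simp add: o_def)
qed

lemma eventually_in_dom:
  assumes "continuous_map T T f" "f (\<psi> x) \<in> fst c" "x \<in> R"
  shows "\<exists>V. open V \<and> x \<in> V \<and> V \<subseteq> R \<and> (\<forall>w\<in>V. f (\<psi> w) \<in> fst c)"
proof -
  have "openin T {y \<in> topspace T. f y \<in> fst c}"
    using assms(1) open_dom by (rule openin_continuous_map_preimage)
  from open_\<psi>_preimage[OF this] show ?thesis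
    using assms(2,3) \<psi>_carrier
    by (intro exI[of _ "{x \<in> R. \<psi> x \<in> {y \<in> topspace T. f y \<in> fst c}}"]) (auto simp: topspace_T)
qed

definition mul :: "'e \<times> 'e \<Rightarrow> 'e" where
  "mul = (\<lambda>(x, y). \<phi> (\<psi> x \<otimes>\<^bsub>G\<^esub> \<psi> y))"

definition mul_dom :: "('e \<times> 'e) set" where
  "mul_dom = {(x, y). x \<in> R \<and> y \<in> R \<and> \<psi> x \<otimes>\<^bsub>G\<^esub> \<psi> y \<in> fst c}"

definition invr :: "'e \<Rightarrow> 'e" where
  "invr x = \<phi> (inv\<^bsub>G\<^esub> (\<psi> x))"

definition inv_dom :: "'e set" where
  "inv_dom = {x \<in> R. inv\<^bsub>G\<^esub> (\<psi> x) \<in> fst c}"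

lemma smooth_mul: "smooth_on mul_dom mul"
  using lie c_in unfolding lie_group_def mul_def mul_dom_def by blast

lemma smooth_inv: "smooth_on inv_dom invr"
  using lie c_in unfolding lie_group_def invr_def[abs_def] inv_dom_def by blast

lemma open_inv_dom: "open inv_dom"
proof -
  have "openin T {y \<in> topspace T. inv\<^bsub>G\<^esub> y \<in> fst c}"
    using inv_cont open_dom by (rule openin_continuous_map_preimage)
  from open_\<psi>_preimage[OF this] show ?thesis
    using \<psi>_carrier by (simp add: inv_dom_def topspace_T cong: conj_cong)
qed

lemma e_in_inv_dom: "e \<in> inv_dom"
  using e_in_R one_dom by (simp add: inv_dom_def)

lemma invr_e [simp]: "invr e = e"
  by (simp add: invr_def)

text \<open>In coordinates conjugation by \<open>\<psi> z\<close> is \<open>w \<mapsto> mul (mul (z, w), invr z)\<close>, which expresses \<open>Ad\<close> through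
  partial derivatives of the multiplication.\<close>

lemma Ad_formula:
  assumes z: "z \<in> inv_dom"
  shows "((\<lambda>w. \<phi> (\<psi> z \<otimes>\<^bsub>G\<^esub> \<psi> w \<otimes>\<^bsub>G\<^esub> inv\<^bsub>G\<^esub> (\<psi> z))) has_derivative
      (\<lambda>v. frechet_derivative mul (at (z, invr z)) (frechet_derivative mul (at (z, e)) (0, v), 0))) (at e)"
proof -
  let ?g = "\<psi> z"
  have zR: "z \<in> R" and iz: "inv\<^bsub>G\<^esub> ?g \<in> fst c" using z by (auto simp: inv_dom_def)
  have g: "?g \<in> carrier G" "?g \<in> fst c" using zR \<psi>_carrier \<psi>_dom by auto
  have D1: "(z, e) \<in> mul_dom" using zR e_in_R g by (simp add: mul_dom_def)
  have D2: "(z, invr z) \<in> mul_dom"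
    using zR g iz one_dom by (simp add: mul_dom_def invr_def \<phi>_in_R)
  note M1 = has_derivative_frechet_derivative[OF smooth_on_differentiable[OF smooth_mul D1]]
  note M2 = has_derivative_frechet_derivative[OF smooth_on_differentiable[OF smooth_mul D2]]
  have m1: "mul (z, e) = z" using zR g by (simp add: mul_def)
  have "((\<lambda>w. (z, w)) has_derivative (\<lambda>v. (0, v))) (at e)"
    by (auto intro!: derivative_eq_intros)
  from has_derivative_compose[OF this M1]
  have "((\<lambda>w. mul (z, w)) has_derivative (\<lambda>v. frechet_derivative mul (at (z, e)) (0, v))) (at e)" .
  from has_derivative_Pair[OF this has_derivative_const[of "invr z"]]
  have "((\<lambda>w. (mul (z, w), invr z)) has_derivative (\<lambda>v. (frechet_derivative mul (at (z, e)) (0, v), 0))) (at e)" .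
  from has_derivative_compose[OF this, of mul] M2 m1
  have D: "((\<lambda>w. mul (mul (z, w), invr z)) has_derivative
      (\<lambda>v. frechet_derivative mul (at (z, invr z)) (frechet_derivative mul (at (z, e)) (0, v), 0))) (at e)"
    by simp
  obtain V where V: "open V" "e \<in> V" "V \<subseteq> R" "\<forall>w\<in>V. ?g \<otimes>\<^bsub>G\<^esub> \<psi> w \<in> fst c"
    using eventually_in_dom[OF left_mult_cont[OF g(1)], of e] g e_in_R by auto
  show ?thesis
  proof (rule has_derivative_transform_within_open[OF D V(1,2)])
    fix w assume "w \<in> V"
    then show "mul (mul (z, w), invr z) = \<phi> (?g \<otimes>\<^bsub>G\<^esub> \<psi> w \<otimes>\<^bsub>G\<^esub> inv\<^bsub>G\<^esub> ?g)"
      using V iz by (simp add: mul_def invr_def)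
  qed
qed

lemma Ad_has_derivative:
  assumes "z \<in> inv_dom"
  shows "((\<lambda>w. \<phi> (\<psi> z \<otimes>\<^bsub>G\<^esub> \<psi> w \<otimes>\<^bsub>G\<^esub> inv\<^bsub>G\<^esub> (\<psi> z))) has_derivative Ad G c (\<psi> z)) (at e)"
  using Ad_formula[OF assms] frechet_derivative_eqI[OF Ad_formula[OF assms]] by (simp add: Ad_def)

text \<open>The bracket is defined by a Frechet derivative, which is meaningful only after differentiability is
  known. In the formula for \<open>Ad\<close> the inner derivative is expanded in the standard basis, so that only
  derivatives of the multiplication in fixed directions have to be differentiated in \<open>z\<close>.\<close>

lemma Ad_differentiable: "(\<lambda>z. Ad G c (\<psi> z) y) differentiable (at e)"
proof -
  let ?a = "\<lambda>z. frechet_derivative mul (at (z, e)) (0, y)"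
  let ?b = "\<lambda>b z. frechet_derivative mul (at (z, invr z)) (b, 0)"
  have ee: "(e, e) \<in> mul_dom" using e_in_R one_dom by (simp add: mul_dom_def)
  have "(\<lambda>z. (z, e)) differentiable (at e)" by (intro differentiableI derivative_intros)
  then have a: "?a differentiable (at e)"
    using differentiable_compose[of "\<lambda>p. frechet_derivative mul (at p) (0, y)" "\<lambda>z. (z, e)" e UNIV]
      smooth_on_derivative_differentiable[OF smooth_mul ee] by auto
  have "(\<lambda>z. (z, invr z)) differentiable (at e)"
    using has_derivative_Pair[OF has_derivative_ident has_derivative_frechet_derivative[OF
        smooth_on_differentiable[OF smooth_inv e_in_inv_dom]]] by (rule differentiableI)
  then have b: "?b b differentiable (at e)" for b
    using differentiable_compose[of "\<lambda>p. frechet_derivative mul (at p) (b, 0)" "\<lambda>z. (z, invr z)" e UNIV]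
      smooth_on_derivative_differentiable[OF smooth_mul ee] by auto
  have "(\<lambda>z. (?a z \<bullet> b) *\<^sub>R ?b b z) differentiable (at e)" for b
  proof -
    obtain Da Db where "(?a has_derivative Da) (at e)" "(?b b has_derivative Db) (at e)"
      using a b[of b] unfolding differentiable_def by auto
    then have "((\<lambda>z. (?a z \<bullet> b) *\<^sub>R ?b b z) has_derivative
        (\<lambda>x. (?a e \<bullet> b) *\<^sub>R Db x + (Da x \<bullet> b) *\<^sub>R ?b b e)) (at e)"
      by (intro has_derivative_scaleR bounded_linear.has_derivative[OF bounded_linear_inner_left])
    then show ?thesis by (rule differentiableI)
  qed
  then have "(\<lambda>z. \<Sum>b\<in>Basis. (?a z \<bullet> b) *\<^sub>R ?b b z) differentiable (at e)"
    by (intro differentiable_sum) auto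
  then obtain D where D: "((\<lambda>z. \<Sum>b\<in>Basis. (?a z \<bullet> b) *\<^sub>R ?b b z) has_derivative D) (at e)"
    by (auto simp: differentiable_def)
  have "((\<lambda>z. Ad G c (\<psi> z) y) has_derivative D) (at e)"
  proof (rule has_derivative_transform_within_open[OF D open_inv_dom e_in_inv_dom])
    fix z assume z: "z \<in> inv_dom"
    have zR: "z \<in> R" and iz: "inv\<^bsub>G\<^esub> (\<psi> z) \<in> fst c" using z by (auto simp: inv_dom_def)
    have D2: "(z, invr z) \<in> mul_dom"
      using zR iz one_dom \<psi>_carrier by (simp add: mul_dom_def invr_def \<phi>_in_R)
    have lin: "linear (frechet_derivative mul (at (z, invr z)))"
      by (intro linear_frechet_derivative smooth_on_differentiable[OF smooth_mul D2])
    have "Ad G c (\<psi> z) y = frechet_derivative mul (at (z, invr z)) (?a z, 0)"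
      by (simp add: Ad_def frechet_derivative_eqI[OF Ad_formula[OF z]])
    also have "(?a z, 0) = (\<Sum>b\<in>Basis. (?a z \<bullet> b) *\<^sub>R (b, 0 :: 'e))"
      by (simp add: prod_eq_iff fst_sum snd_sum euclidean_representation)
    also have "frechet_derivative mul (at (z, invr z)) \<dots> = (\<Sum>b\<in>Basis. (?a z \<bullet> b) *\<^sub>R ?b b z)"
      by (simp only: linear_sum[OF lin] linear_scale[OF lin])
    finally show "(\<Sum>b\<in>Basis. (?a z \<bullet> b) *\<^sub>R ?b b z) = Ad G c (\<psi> z) y" by simp
  qed
  then show ?thesis by (rule differentiableI)
qed

lemma bracket_has_derivative:
  "((\<lambda>z. Ad G c (\<psi> z) y) has_derivative (\<lambda>x. lie_bracket G c x y)) (at e)"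
  using has_derivative_frechet_derivative[OF Ad_differentiable] by (simp add: lie_bracket_def[abs_def])

lemma \<tau>_mult: "g \<in> carrier G \<Longrightarrow> g' \<in> carrier G \<Longrightarrow> \<tau> (g \<otimes>\<^bsub>G\<^esub> g') = \<tau> g ** \<tau> g'"
  and \<tau>_det: "g \<in> carrier G \<Longrightarrow> det (\<tau> g) = 1"
  using rep by (auto simp: sl_representation_def)

lemma \<tau>_one [simp]: "\<tau> \<one>\<^bsub>G\<^esub> = mat 1"
proof -
  have "\<tau> \<one>\<^bsub>G\<^esub> ** \<tau> \<one>\<^bsub>G\<^esub> = \<tau> \<one>\<^bsub>G\<^esub>" using \<tau>_mult[of "\<one>\<^bsub>G\<^esub>" "\<one>\<^bsub>G\<^esub>"] by simp
  moreover have "invertible (\<tau> \<one>\<^bsub>G\<^esub>)" by (simp add: invertible_det_nz \<tau>_det)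
  then obtain B where "B ** \<tau> \<one>\<^bsub>G\<^esub> = mat 1" by (auto simp: invertible_def)
  ultimately show ?thesis by (metis matrix_mul_assoc matrix_mul_lid)
qed

lemma \<tau>_inv_left: "g \<in> carrier G \<Longrightarrow> \<tau> (inv\<^bsub>G\<^esub> g) ** \<tau> g = mat 1"
  using \<tau>_mult[of "inv\<^bsub>G\<^esub> g" g] by simp

lemma \<tau>_inv_right: "g \<in> carrier G \<Longrightarrow> \<tau> g ** \<tau> (inv\<^bsub>G\<^esub> g) = mat 1"
  using \<tau>_mult[of g "inv\<^bsub>G\<^esub> g"] by simp

lemma \<tau>_has_derivative: "((\<tau> \<circ> \<psi>) has_derivative d\<tau>) (at e)"
proof -
  have "smooth_on R (\<tau> \<circ> \<psi>)" using rep c_in by (simp add: sl_representation_def)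
  then show ?thesis unfolding differential_def
    by (rule has_derivative_frechet_derivative[OF smooth_on_differentiable[OF _ e_in_R]])
qed

lemma linear_d\<tau>: "linear d\<tau>"
  using has_derivative_linear[OF \<tau>_has_derivative] .

lemma differential_Ad:
  assumes z: "z \<in> inv_dom"
  shows "d\<tau> (Ad G c (\<psi> z) y) ** \<tau> (\<psi> z) = \<tau> (\<psi> z) ** d\<tau> y"
proof -
  let ?g = "\<psi> z"
  let ?C = "\<lambda>w. \<phi> (?g \<otimes>\<^bsub>G\<^esub> \<psi> w \<otimes>\<^bsub>G\<^esub> inv\<^bsub>G\<^esub> ?g)"
  have g: "?g \<in> carrier G" using z \<psi>_carrier by (auto simp: inv_dom_def)
  have Ce: "?C e = e" using g by simp
  have "(((\<tau> \<circ> \<psi>) \<circ> ?C) has_derivative (d\<tau> \<circ> Ad G c ?g)) (at e)"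
    using \<tau>_has_derivative Ce by (intro diff_chain_at Ad_has_derivative[OF z]) simp
  from bounded_linear.has_derivative[OF matrix_mult.bounded_linear_left[of "\<tau> ?g"] this]
  have 1: "((\<lambda>w. (\<tau> \<circ> \<psi>) (?C w) ** \<tau> ?g) has_derivative (\<lambda>y. d\<tau> (Ad G c ?g y) ** \<tau> ?g)) (at e)"
    by (simp add: o_def)
  have cm: "continuous_map T T (\<lambda>y. ?g \<otimes>\<^bsub>G\<^esub> y \<otimes>\<^bsub>G\<^esub> inv\<^bsub>G\<^esub> ?g)"
    using continuous_map_compose[OF left_mult_cont[OF g] right_mult_cont[OF inv_closed[OF g]]]
    by (simp add: o_def)
  obtain V where V: "open V" "e \<in> V" "V \<subseteq> R" "\<forall>w\<in>V. ?g \<otimes>\<^bsub>G\<^esub> \<psi> w \<otimes>\<^bsub>G\<^esub> inv\<^bsub>G\<^esub> ?g \<in> fst c"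
    using eventually_in_dom[OF cm, of e] g e_in_R one_dom by auto
  have 2: "((\<lambda>w. (\<tau> \<circ> \<psi>) (?C w) ** \<tau> ?g) has_derivative (\<lambda>y. \<tau> ?g ** d\<tau> y)) (at e)"
  proof (rule has_derivative_transform_within_open[OF _ V(1,2)])
    show "((\<lambda>w. \<tau> ?g ** (\<tau> \<circ> \<psi>) w) has_derivative (\<lambda>y. \<tau> ?g ** d\<tau> y)) (at e)"
      by (rule bounded_linear.has_derivative[OF matrix_mult.bounded_linear_right \<tau>_has_derivative])
    fix w assume w: "w \<in> V"
    then have wc: "\<psi> w \<in> carrier G" using V \<psi>_carrier by auto
    have "(\<tau> \<circ> \<psi>) (?C w) = \<tau> ?g ** \<tau> (\<psi> w) ** \<tau> (inv\<^bsub>G\<^esub> ?g)"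
      using w V g wc by (simp add: \<tau>_mult)
    then show "\<tau> ?g ** (\<tau> \<circ> \<psi>) w = (\<tau> \<circ> \<psi>) (?C w) ** \<tau> ?g"
      using \<tau>_inv_left[OF g] by (simp add: matrix_mul_assoc[symmetric])
  qed
  from has_derivative_unique[OF 1 2] show ?thesis by metis
qed

text \<open>The special case \<open>d\<tau> x = 0\<close> of \<open>d\<tau> [x, y] = d\<tau> x d\<tau> y - d\<tau> y d\<tau> x\<close>, obtained by differentiating
  \<open>d\<tau> (Ad g y) \<tau> g = \<tau> g d\<tau> y\<close> at the identity in the direction \<open>x\<close>.\<close>

lemma differential_bracket_zero:
  assumes x: "d\<tau> x = 0"
  shows "d\<tau> (lie_bracket G c x y) = 0"
proof -
  let ?W = "\<lambda>z. d\<tau> (Ad G c (\<psi> z) y)"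
  have bl: "bounded_linear d\<tau>" using linear_d\<tau> by (simp add: linear_conv_bounded_linear)
  have W: "(?W has_derivative (\<lambda>x. d\<tau> (lie_bracket G c x y))) (at e)"
    by (rule bounded_linear.has_derivative[OF bl bracket_has_derivative])
  from matrix_mult.FDERIV[OF W \<tau>_has_derivative]
  have 1: "((\<lambda>z. ?W z ** (\<tau> \<circ> \<psi>) z) has_derivative
      (\<lambda>x. ?W e ** d\<tau> x + d\<tau> (lie_bracket G c x y) ** (\<tau> \<circ> \<psi>) e)) (at e)" .
  have 2: "((\<lambda>z. ?W z ** (\<tau> \<circ> \<psi>) z) has_derivative (\<lambda>x. d\<tau> x ** d\<tau> y)) (at e)"
  proof (rule has_derivative_transform_within_open[OF _ open_inv_dom e_in_inv_dom])
    show "((\<lambda>z. (\<tau> \<circ> \<psi>) z ** d\<tau> y) has_derivative (\<lambda>x. d\<tau> x ** d\<tau> y)) (at e)"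
      by (rule bounded_linear.has_derivative[OF matrix_mult.bounded_linear_left \<tau>_has_derivative])
    show "z \<in> inv_dom \<Longrightarrow> (\<tau> \<circ> \<psi>) z ** d\<tau> y = ?W z ** (\<tau> \<circ> \<psi>) z" for z
      by (simp add: differential_Ad)
  qed
  from has_derivative_unique[OF 1 2]
  have "?W e ** d\<tau> x + d\<tau> (lie_bracket G c x y) ** (\<tau> \<circ> \<psi>) e = d\<tau> x ** d\<tau> y" by metis
  then show ?thesis by (simp add: x)
qed

lemma one_parameter_subgroup:
  assumes "x \<in> lie_algebra_of G T c K"
  obtains \<sigma> :: "real \<Rightarrow> 'g" where "\<And>t. \<sigma> t \<in> K" "\<And>t. \<sigma> t \<in> carrier G" "\<sigma> 0 = \<one>\<^bsub>G\<^esub>"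
    "\<And>s t. \<sigma> (s + t) = \<sigma> s \<otimes>\<^bsub>G\<^esub> \<sigma> t" "continuous_map euclideanreal T \<sigma>"
    "((\<lambda>t. \<phi> (\<sigma> t)) has_vector_derivative x) (at 0)"
    "((\<lambda>t. \<tau> (\<sigma> t)) has_vector_derivative d\<tau> x) (at 0)"
proof -
  obtain \<sigma> :: "real \<Rightarrow> 'g" where \<sigma>: "continuous_map euclideanreal T \<sigma>"
    "\<And>s t. \<sigma> (s + t) = \<sigma> s \<otimes>\<^bsub>G\<^esub> \<sigma> t" "\<And>t. \<sigma> t \<in> K"
    "((\<lambda>t. \<phi> (\<sigma> t)) has_vector_derivative x) (at 0)"
    using assms by (auto simp: lie_algebra_of_def)
  have car: "\<sigma> t \<in> carrier G" for t
    using continuous_map_image_subset_topspace[OF \<sigma>(1)] by (auto simp: topspace_T)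
  have one: "\<sigma> 0 = \<one>\<^bsub>G\<^esub>" using \<sigma>(2)[of 0 0] car[of 0] by simp
  have "openin euclideanreal {t \<in> topspace euclideanreal. \<sigma> t \<in> fst c}"
    by (rule openin_continuous_map_preimage[OF \<sigma>(1) open_dom])
  then have op: "open {t. \<sigma> t \<in> fst c}" by simp
  have "((\<lambda>t. \<phi> (\<sigma> t)) has_derivative (\<lambda>t. t *\<^sub>R x)) (at 0)"
    using \<sigma>(4) by (simp add: has_vector_derivative_def)
  from has_derivative_compose[OF this, of "\<tau> \<circ> \<psi>" d\<tau>] \<tau>_has_derivative
  have "((\<lambda>t. (\<tau> \<circ> \<psi>) (\<phi> (\<sigma> t))) has_derivative (\<lambda>t. t *\<^sub>R d\<tau> x)) (at 0)"
    by (simp add: one linear_scale[OF linear_d\<tau>])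
  then have "((\<lambda>t. \<tau> (\<sigma> t)) has_derivative (\<lambda>t. t *\<^sub>R d\<tau> x)) (at 0)"
    by (rule has_derivative_transform_within_open[OF _ op]) (auto simp: one one_dom)
  then show thesis
    by (intro that[OF \<sigma>(3) car one \<sigma>(2) \<sigma>(1) \<sigma>(4)]) (simp add: has_vector_derivative_def)
qed

text \<open>A one-parameter subgroup with velocity in the kernel of \<open>d\<tau>\<close> stays in the kernel of \<open>\<tau>\<close>. That kernel is
  finite, hence discrete, so the subgroup is constant near \<open>0\<close>.\<close>

lemma differential_injective_on_subgroup:
  assumes x: "x \<in> lie_algebra_of G T c K" "d\<tau> x = 0" and fin: "finite (representation_kernel G \<tau>)"
  shows "x = 0"
proof -
  obtain \<sigma> :: "real \<Rightarrow> 'g" where \<sigma>: "\<And>t. \<sigma> t \<in> carrier G" "\<sigma> 0 = \<one>\<^bsub>G\<^esub>"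
    "\<And>s t. \<sigma> (s + t) = \<sigma> s \<otimes>\<^bsub>G\<^esub> \<sigma> t" "continuous_map euclideanreal T \<sigma>"
    "((\<lambda>t. \<phi> (\<sigma> t)) has_vector_derivative x) (at 0)"
    "((\<lambda>t. \<tau> (\<sigma> t)) has_vector_derivative d\<tau> x) (at 0)"
    using x(1) by (rule one_parameter_subgroup) blast
  have "((\<lambda>t. \<tau> (\<sigma> t)) has_derivative (\<lambda>h. 0)) (at t)" for t
  proof -
    have "((\<lambda>s. s - t) has_derivative (\<lambda>s. s)) (at t)" by (auto intro!: derivative_eq_intros)
    from has_derivative_compose[OF this, of "\<lambda>t. \<tau> (\<sigma> t)" "\<lambda>h. 0"] \<sigma>(6) x(2)
    have "((\<lambda>s. \<tau> (\<sigma> (s - t))) has_derivative (\<lambda>h. 0)) (at t)"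
      by (simp add: has_vector_derivative_def)
    from bounded_linear.has_derivative[OF matrix_mult.bounded_linear_right[of "\<tau> (\<sigma> t)"] this]
    have "((\<lambda>s. \<tau> (\<sigma> t) ** \<tau> (\<sigma> (s - t))) has_derivative (\<lambda>h. 0)) (at t)" by simp
    moreover have "\<tau> (\<sigma> t) ** \<tau> (\<sigma> (s - t)) = \<tau> (\<sigma> s)" for s
      using \<sigma>(3)[of t "s - t"] \<tau>_mult[OF \<sigma>(1) \<sigma>(1)] by simp
    ultimately show ?thesis by simp
  qed
  then have "\<tau> (\<sigma> t) = \<tau> (\<sigma> 0)" for t
    by (intro has_derivative_zero_unique[of UNIV "\<lambda>t. \<tau> (\<sigma> t)"]) auto
  then have ker: "\<sigma> t \<in> representation_kernel G \<tau>" for t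
    using \<sigma>(1,2) by (simp add: representation_kernel_def)
  \<comment> \<open>removing the finitely many other points of the kernel leaves a neighbourhood of the identity\<close>
  let ?F = "representation_kernel G \<tau> - {\<one>\<^bsub>G\<^esub>}"
  have "closedin T ?F"
    using fin by (intro closedin_Hausdorff_finite[OF Hausdorff_T]) (auto simp: representation_kernel_def topspace_T)
  then have "openin T (topspace T - ?F)" by blast
  then have "openin euclideanreal {t \<in> topspace euclideanreal. \<sigma> t \<in> topspace T - ?F}"
    by (rule openin_continuous_map_preimage[OF \<sigma>(4)])
  then have op: "open {t. \<sigma> t \<in> topspace T - ?F}" by simp
  have "((\<lambda>t. \<phi> (\<sigma> t)) has_derivative (\<lambda>t. 0)) (at 0)"
  proof (rule has_derivative_transform_within_open[OF _ op])
    show "((\<lambda>t. e) has_derivative (\<lambda>t. 0)) (at (0::real))" by simp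
    show "0 \<in> {t. \<sigma> t \<in> topspace T - ?F}" using \<sigma>(2) by (simp add: topspace_T)
    show "s \<in> {t. \<sigma> t \<in> topspace T - ?F} \<Longrightarrow> e = \<phi> (\<sigma> s)" for s using ker[of s] by auto
  qed
  with \<sigma>(5) show "x = 0"
    unfolding has_vector_derivative_def using has_derivative_unique by (metis scaleR_one)
qed

end

locale unitary_lie_rep = lie_rep G T A c \<tau> + hermitian_form h
  for G :: "('g, 'm) monoid_scheme" and T :: "'g topology"
    and A :: "('g, 'e::euclidean_space) chart set" and c :: "('g, 'e) chart"
    and \<tau> :: "'g \<Rightarrow> complex^'n^'n" and h :: "complex^'n \<Rightarrow> complex^'n \<Rightarrow> complex" +
  fixes K :: "'g set"
  assumes unitary: "\<tau> ` K \<subseteq> special_unitary h"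
begin

text \<open>Differentiate the invariance of \<open>h\<close> along a one-parameter subgroup of \<open>K\<close>.\<close>

lemma differential_skew:
  assumes x: "x \<in> lie_algebra_of G T c K"
  shows "h (d\<tau> x *v v) w + h v (d\<tau> x *v w) = 0"
proof -
  obtain \<sigma> :: "real \<Rightarrow> 'g" where \<sigma>: "\<And>t. \<sigma> t \<in> K" "\<sigma> 0 = \<one>\<^bsub>G\<^esub>"
    "((\<lambda>t. \<tau> (\<sigma> t)) has_vector_derivative d\<tau> x) (at 0)"
    using x by (rule one_parameter_subgroup) blast
  have 1: "((\<lambda>t. \<tau> (\<sigma> t) *v u) has_vector_derivative (d\<tau> x *v u)) (at 0)" for u
    by (rule bounded_linear.has_vector_derivative[OF matrix_vector_mult.bounded_linear_left \<sigma>(3)])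
  have "((\<lambda>t. h (\<tau> (\<sigma> t) *v v) (\<tau> (\<sigma> t) *v w)) has_vector_derivative
      (h (\<tau> (\<sigma> 0) *v v) (d\<tau> x *v w) + h (d\<tau> x *v v) (\<tau> (\<sigma> 0) *v w))) (at 0)"
    by (rule h.has_vector_derivative[OF 1 1])
  moreover have "h (\<tau> (\<sigma> t) *v v) (\<tau> (\<sigma> t) *v w) = h v w" for t
    using unitary \<sigma>(1)[of t] by (auto simp: special_unitary_def)
  ultimately have "((\<lambda>t::real. h v w) has_vector_derivative (h v (d\<tau> x *v w) + h (d\<tau> x *v v) w)) (at 0)"
    by (simp add: \<sigma>(2))
  then show ?thesis
    using vector_derivative_unique_at[OF _ has_vector_derivative_const] by (metis add.commute)
qed

text \<open>An element of the kernel of \<open>d\<tau>\<close> has its \<open>\<kk>\<close>-component in the kernel, because \<open>d\<tau>\<close> is skew on \<open>\<kk>\<close> and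
  Hermitian on \<open>\<pp>\<close>; so the kernel lies in \<open>\<pp>\<close>. It is also an ideal, hence for \<open>\<beta>\<close> in it
  \<open>[\<beta>, y] \<in> \<pp>\<close> for all \<open>y\<close>, and \<open>[\<beta>, [\<beta>, y]]\<close> lies in \<open>\<kk>\<close> and in the kernel, so it vanishes. Thus
  \<open>(ad \<beta>)\<^sup>2 = 0\<close> and the Killing form of \<open>\<beta>\<close> is \<open>0\<close>.\<close>

lemma differential_injective_on_p:
  assumes cartan: "cartan_decomposition G c (lie_algebra_of G T c K) \<pp>"
    and fin: "finite (representation_kernel G \<tau>)"
    and herm: "\<And>\<beta>. \<beta> \<in> \<pp> \<Longrightarrow> d\<tau> \<beta> \<in> herm_endos h"
    and \<beta>: "\<beta> \<in> \<pp>" "d\<tau> \<beta> = 0"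
  shows "\<beta> = 0"
proof -
  let ?k = "lie_algebra_of G T c K"
  have dec: "\<forall>z. \<exists>x\<in>?k. \<exists>y\<in>\<pp>. z = x + y"
    and pp: "\<forall>x\<in>\<pp>. \<forall>y\<in>\<pp>. lie_bracket G c x y \<in> ?k"
    and pos: "\<forall>x\<in>\<pp>. x \<noteq> 0 \<longrightarrow> killing_form G c x x > 0"
    using cartan unfolding cartan_decomposition_def by - (elim conjE, assumption)+
  \<comment> \<open>the \<open>\<kk>\<close>-component is mapped to an operator that is skew and Hermitian at once\<close>
  have ker_p: "z \<in> \<pp>" if z: "d\<tau> z = 0" for z
  proof -
    obtain x y where xy: "x \<in> ?k" "y \<in> \<pp>" "z = x + y"
      using dec by blast
    then have neg: "d\<tau> x = - d\<tau> y"
      using z linear_add[OF linear_d\<tau>, of x y] by (simp add: eq_neg_iff_add_eq_0)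
    have "d\<tau> x *v v = 0 *v v" for v
    proof -
      have "h (d\<tau> y *v v) w = 0" for w
        using differential_skew[OF xy(1), of v w] herm_endosD[OF herm[OF xy(2)], of v w]
        by (simp add: neg matrix_vector_mult.minus_left h.minus_left h.minus_right)
      then have "hn (d\<tau> y *v v) = 0" by (simp add: hn_def)
      then show ?thesis by (simp add: neg matrix_vector_mult.minus_left)
    qed
    then have "d\<tau> x = 0" by (rule matrix_eqI)
    then have "x = 0" using differential_injective_on_subgroup xy(1) fin by blast
    then show "z \<in> \<pp>" using xy by simp
  qed
  have "lie_bracket G c \<beta> (lie_bracket G c \<beta> y) = 0" for y
  proof -
    let ?y = "lie_bracket G c \<beta> y"
    have "?y \<in> \<pp>" by (intro ker_p differential_bracket_zero \<beta>)
    then have "lie_bracket G c \<beta> ?y \<in> ?k" using pp \<beta>(1) by blast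
    then show ?thesis
      using differential_injective_on_subgroup[OF _ differential_bracket_zero[OF \<beta>(2)] fin] by blast
  qed
  then have "killing_form G c \<beta> \<beta> = 0" by (simp add: killing_form_def)
  then show "\<beta> = 0" using pos \<beta>(1) by force
qed

end

section \<open>Polar decomposition, cosets and the scalar product\<close>

text \<open>Gradients for two scalar products on \<open>P\<close> differ by a linear automorphism of \<open>P\<close>. Such an automorphism
  respects convex hulls, integrals, interiors and frontiers, so it reduces the case of a general
  scalar product to the Euclidean one.\<close>

lemma scalar_product_isomorphism:
  fixes ip :: "'a::euclidean_space \<Rightarrow> 'a \<Rightarrow> real"
  assumes P: "subspace P"
    and add: "\<forall>x\<in>P. \<forall>y\<in>P. \<forall>z\<in>P. ip (x + y) z = ip x z + ip y z"
    and scale: "\<forall>r. \<forall>x\<in>P. \<forall>y\<in>P. ip (r *\<^sub>R x) y = r * ip x y"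
    and sym: "\<forall>x\<in>P. \<forall>y\<in>P. ip x y = ip y x"
    and pos: "\<forall>x\<in>P. x \<noteq> 0 \<longrightarrow> ip x x > 0"
  obtains J where "linear J" "\<And>y. J y \<in> P" "homeomorphic_map (top_of_set P) (top_of_set P) J"
    "\<forall>y\<in>P. \<forall>x\<in>P. ip (J y) x = y \<bullet> x"
proof -
  note add = add[rule_format] and scale = scale[rule_format] and sym = sym[rule_format]
    and pos = pos[rule_format]
  obtain B where B0: "B \<subseteq> P" "pairwise orthogonal B" "\<And>x. x \<in> B \<Longrightarrow> norm x = 1" "independent B"
    "card B = dim P" "span B = P"
    using orthonormal_basis_subspace[OF P] by metis
  then have finB: "finite B" using independent_imp_finite by blast
  have expand: "(\<Sum>b\<in>B. (x \<bullet> b) *\<^sub>R b) = x" if "x \<in> P" for x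
    using that B0 finB by (intro orthonormal_basis_expand) auto
  have zero: "ip 0 z = 0" if "z \<in> P" for z
    using scale[of z z 0] that by simp
  have ip_sum: "ip (\<Sum>b\<in>A. f b *\<^sub>R b) z = (\<Sum>b\<in>A. f b * ip b z)" if "z \<in> P" "finite A" "A \<subseteq> P" for A z f
    using that(2,3)
  proof (induction rule: finite_induct)
    case (insert b A)
    have "(\<Sum>b\<in>A. f b *\<^sub>R b) \<in> P" using insert.prems by (auto intro!: subspace_sum[OF P] subspace_scale[OF P])
    then show ?case using insert that(1) P by (simp add: add scale subspace_scale)
  qed (simp add: zero[OF that(1)])
  define m where "m b = (\<Sum>b'\<in>B. ip b b' *\<^sub>R b')" for b
  define M where "M x = (\<Sum>b\<in>B. (x \<bullet> b) *\<^sub>R m b)" for x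
  have linM: "linear M"
    by (rule linearI) (simp_all add: M_def inner_add_left scaleR_add_left sum.distrib scaleR_right.sum)
  have MP: "M x \<in> P" for x
    unfolding M_def m_def using B0(1) by (auto intro!: subspace_sum[OF P] subspace_scale[OF P])
  have M_ip: "M x \<bullet> z = ip x z" if x: "x \<in> P" and z: "z \<in> P" for x z
  proof -
    have "m b \<bullet> z = ip b z" if b: "b \<in> B" for b
    proof -
      have "ip b z = ip (\<Sum>b'\<in>B. (z \<bullet> b') *\<^sub>R b') b" using expand[OF z] sym z b B0(1) by auto
      also have "\<dots> = (\<Sum>b'\<in>B. (z \<bullet> b') * ip b' b)" using b B0(1) finB by (intro ip_sum) auto
      also have "\<dots> = (\<Sum>b'\<in>B. (z \<bullet> b') * ip b b')" using b B0(1) sym by (intro sum.cong refl) (metis subsetD)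
      finally show ?thesis by (simp add: m_def inner_sum_left inner_commute[of z] mult.commute)
    qed
    then have "M x \<bullet> z = (\<Sum>b\<in>B. (x \<bullet> b) * ip b z)" by (simp add: M_def inner_sum_left)
    also have "\<dots> = ip (\<Sum>b\<in>B. (x \<bullet> b) *\<^sub>R b) z" using z B0(1) finB by (intro ip_sum[symmetric]) auto
    finally show ?thesis by (simp add: expand[OF x])
  qed
  have injM: "inj_on M P"
  proof (subst linear_inj_on_iff_eq_0[OF linM P], intro ballI impI)
    fix x assume x: "x \<in> P" "M x = 0"
    then have "ip x x = 0" using M_ip[OF x(1) x(1)] by simp
    then show "x = 0" using pos[OF x(1)] by force
  qed
  obtain J where J: "range J \<subseteq> P" "linear J" "\<forall>v\<in>P. J (M v) = v"
    using linear_exists_left_inverse_on[OF linM P injM] by blast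
  have "M ` P = P"
  proof (rule subspace_dim_equal)
    show "subspace (M ` P)" by (rule linear_subspace_image[OF linM P])
    show "M ` P \<subseteq> P" using MP by auto
    have "inj_on M (span P)" using injM by (simp only: span_eq_iff[THEN iffD2, OF P])
    then show "dim P \<le> dim (M ` P)" using dim_image_eq[OF linM, of P] by simp
  qed (rule P)
  then have MJ: "M (J y) = y" if "y \<in> P" for y using that J(3) by force
  have cont: "continuous_on P f" if "linear f" for f :: "'a \<Rightarrow> 'a"
    using that linear_continuous_on linear_conv_bounded_linear by blast
  have "homeomorphic_maps (top_of_set P) (top_of_set P) J M"
    unfolding homeomorphic_maps_def using J MJ MP cont[OF linM] cont[OF J(2)] by auto
  then have hom: "homeomorphic_map (top_of_set P) (top_of_set P) J"
    by (auto simp: homeomorphic_map_maps)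
  show thesis
  proof (rule that[OF J(2) _ hom])
    show JP: "J y \<in> P" for y using J(1) by auto
    show "\<forall>y\<in>P. \<forall>x\<in>P. ip (J y) x = y \<bullet> x"
    proof (intro ballI)
      fix y x assume "y \<in> P" "x \<in> P"
      then show "ip (J y) x = y \<bullet> x" using M_ip[OF JP[of y], of x] MJ[of y] by simp
    qed
  qed
qed

locale compatible_rep = unitary_lie_rep G T A c \<tau> h K
  for G :: "('g, 'm) monoid_scheme" and T :: "'g topology"
    and A :: "('g, 'e::euclidean_space) chart set" and c :: "('g, 'e) chart"
    and \<tau> :: "'g \<Rightarrow> complex^'n^'n" and h :: "complex^'n \<Rightarrow> complex^'n \<Rightarrow> complex"
    and K :: "'g set" +
  fixes \<pp> :: "'e set"
  assumes subgroup_K: "subgroup K G" and subspace_p: "subspace \<pp>"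
    and herm_p: "\<beta> \<in> \<pp> \<Longrightarrow> d\<tau> \<beta> \<in> herm_endos h"
    and polar: "\<tau> ` carrier G = {\<tau> k ** mat_exp (d\<tau> \<beta>) | k \<beta>. k \<in> K \<and> \<beta> \<in> \<pp>}"
begin

lemma K_carrier: "k \<in> K \<Longrightarrow> k \<in> carrier G"
  using subgroup.mem_carrier[OF subgroup_K] .

lemma unitaryD: "k \<in> K \<Longrightarrow> h (\<tau> k *v v) (\<tau> k *v w) = h v w"
  using unitary by (auto simp: special_unitary_def)

lemma exp_in_image:
  assumes "\<beta> \<in> \<pp>"
  obtains g where "g \<in> carrier G" "\<tau> g = mat_exp (d\<tau> \<beta>)"
proof -
  have "\<tau> \<one>\<^bsub>G\<^esub> ** mat_exp (d\<tau> \<beta>) \<in> \<tau> ` carrier G"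
    unfolding polar using assms subgroup.one_closed[OF subgroup_K] by blast
  then show thesis using that by auto
qed

lemma polar_decomposition:
  assumes "g \<in> carrier G"
  obtains k \<beta> where "k \<in> K" "\<beta> \<in> \<pp>" "\<tau> g = \<tau> k ** mat_exp (d\<tau> \<beta>)"
  using assms polar by blast

lemma h_adjoint_eqI:
  assumes "\<And>v w. h (M *v v) w = h v (B *v w)"
  shows "h_adjoint h M = B"
  unfolding h_adjoint_def
proof (rule the_equality)
  show "\<forall>v w. h (M *v v) w = h v (B *v w)" using assms by blast
  fix B' assume B': "\<forall>v w. h (M *v v) w = h v (B' *v w)"
  have "B' *v w = B *v w" for w
  proof -
    let ?u = "B' *v w - B *v w"
    have "h ?u ?u = 0" using B' assms[of ?u w] by (simp add: h.diff_right)
    then show ?thesis by (simp add: h_self)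
  qed
  then show "B' = B" by (rule matrix_eqI)
qed

text \<open>The adjoint of \<open>\<tau> k exp (d\<tau> \<beta>)\<close> is \<open>exp (d\<tau> \<beta>) \<tau> k\<^sup>-\<^sup>1\<close>, so the image of the group is closed under
  adjoints.\<close>

lemma adjoint_in_image:
  assumes g: "g \<in> carrier G"
  obtains g' where "g' \<in> carrier G" "h_adjoint h (\<tau> g) = \<tau> g'"
    "\<And>v w. h (\<tau> g *v v) w = h v (\<tau> g' *v w)"
proof -
  obtain k \<beta> where k: "k \<in> K" "\<beta> \<in> \<pp>" "\<tau> g = \<tau> k ** mat_exp (d\<tau> \<beta>)"
    using polar_decomposition[OF g] .
  obtain a where a: "a \<in> carrier G" "\<tau> a = mat_exp (d\<tau> \<beta>)" using exp_in_image[OF k(2)] .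
  have kc: "k \<in> carrier G" "inv\<^bsub>G\<^esub> k \<in> carrier G" using K_carrier[OF k(1)] by auto
  have adj: "h (\<tau> g *v v) w = h v (\<tau> (a \<otimes>\<^bsub>G\<^esub> inv\<^bsub>G\<^esub> k) *v w)" for v w
  proof -
    have "w = \<tau> k *v (\<tau> (inv\<^bsub>G\<^esub> k) *v w)"
      by (simp add: matrix_vector_mul_assoc \<tau>_inv_right kc)
    then have "h (\<tau> g *v v) w = h (\<tau> k *v (mat_exp (d\<tau> \<beta>) *v v)) (\<tau> k *v (\<tau> (inv\<^bsub>G\<^esub> k) *v w))"
      by (simp add: k(3) matrix_vector_mul_assoc)
    also have "\<dots> = h (mat_exp (d\<tau> \<beta>) *v v) (\<tau> (inv\<^bsub>G\<^esub> k) *v w)" by (rule unitaryD[OF k(1)])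
    also have "\<dots> = h v (mat_exp (d\<tau> \<beta>) *v (\<tau> (inv\<^bsub>G\<^esub> k) *v w))"
      by (rule herm_endosD[OF herm_endos_mat_exp[OF herm_p[OF k(2)]]])
    finally show ?thesis using a kc by (simp add: \<tau>_mult matrix_vector_mul_assoc)
  qed
  show thesis by (rule that[OF _ h_adjoint_eqI[OF adj] adj]) (use a kc in simp)
qed

text \<open>The positive operator \<open>P = \<tau> g (\<tau> g)\<^sup>*\<close> is again in the image of the group, so \<open>P = \<tau> k exp (d\<tau> \<beta>)\<close>. Then
  \<open>P\<^sup>2 = P\<^sup>* P = exp (d\<tau> \<beta>)\<^sup>2\<close>, and uniqueness of square roots gives \<open>P = exp (d\<tau> \<beta>)\<close>.\<close>

lemma positive_part:
  assumes g: "g \<in> carrier G"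
  obtains \<beta> where "\<beta> \<in> \<pp>" "\<tau> g ** h_adjoint h (\<tau> g) = mat_exp (d\<tau> \<beta>) ** mat_exp (d\<tau> \<beta>)"
proof -
  obtain g' where g': "g' \<in> carrier G" "h_adjoint h (\<tau> g) = \<tau> g'"
    "\<And>v w. h (\<tau> g *v v) w = h v (\<tau> g' *v w)"
    using adjoint_in_image[OF g] by metis
  define P where "P = \<tau> g ** \<tau> g'"
  have g'_adj: "h (\<tau> g' *v v) w = h v (\<tau> g *v w)" for v w
    using g'(3)[of w v] h_cnj by metis
  have herm_P: "P \<in> herm_endos h"
    by (simp add: herm_endos_def P_def matrix_vector_mul_assoc[symmetric] g'(3) g'_adj)
  have "0 \<le> Re (h (P *v v) v)" for v
    using hn_nonneg[of "\<tau> g' *v v"]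
    by (simp add: P_def matrix_vector_mul_assoc[symmetric] g'(3) hn_def)
  then have psd_P: "P \<in> psd" using herm_P by (simp add: psd_def)
  have "P = \<tau> (g \<otimes>\<^bsub>G\<^esub> g')" by (simp add: P_def \<tau>_mult g g')
  then obtain k \<beta> where k: "k \<in> K" "\<beta> \<in> \<pp>" "P = \<tau> k ** mat_exp (d\<tau> \<beta>)"
    using polar_decomposition[of "g \<otimes>\<^bsub>G\<^esub> g'"] g g' by auto
  let ?E = "mat_exp (d\<tau> \<beta>)"
  note hE = herm_endosD[OF herm_endos_mat_exp[OF herm_p[OF k(2)]]]
  have "(P ** P) *v v = (?E ** ?E) *v v" for v
  proof -
    have eq: "h ((P ** P) *v v) w = h ((?E ** ?E) *v v) w" for w
    proof -
      have "h ((P ** P) *v v) w = h (P *v v) (P *v w)"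
        by (simp add: matrix_vector_mul_assoc[symmetric] herm_endosD[OF herm_P])
      also have "\<dots> = h (?E *v v) (?E *v w)"
        unfolding k(3) by (simp only: matrix_vector_mul_assoc[symmetric] unitaryD[OF k(1)])
      finally show ?thesis by (simp add: matrix_vector_mul_assoc[symmetric] hE)
    qed
    let ?u = "(P ** P) *v v - (?E ** ?E) *v v"
    have "h ?u ?u = 0" using eq[of ?u] by (simp add: h.diff_left)
    then show ?thesis by (simp add: h_self)
  qed
  then have "P ** P = ?E ** ?E" by (rule matrix_eqI)
  then have "P = ?E" by (rule psd_sqrt_unique[OF psd_P mat_exp_psd[OF herm_p[OF k(2)]]])
  moreover have "?E = mat_exp (d\<tau> ((1/2) *\<^sub>R \<beta>)) ** mat_exp (d\<tau> ((1/2) *\<^sub>R \<beta>))"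
    by (simp only: linear_scale[OF linear_d\<tau>] mat_exp_half)
  ultimately show thesis
    using that[of "(1/2) *\<^sub>R \<beta>"] k(2) subspace_scale[OF subspace_p] g'(2) by (simp add: P_def)
qed

lemma positive_part_exists:
  assumes \<beta>: "\<beta> \<in> \<pp>"
  obtains g where "g \<in> carrier G" "\<tau> g ** h_adjoint h (\<tau> g) = mat_exp (d\<tau> \<beta>) ** mat_exp (d\<tau> \<beta>)"
proof -
  obtain g where g: "g \<in> carrier G" "\<tau> g = mat_exp (d\<tau> \<beta>)" using exp_in_image[OF \<beta>] .
  have "h_adjoint h (\<tau> g) = \<tau> g"
    unfolding g(2) by (intro h_adjoint_eqI herm_endosD herm_endos_mat_exp herm_p \<beta>)
  then show thesis using that g by simp
qed

lemma gram_coset_invariant: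
  assumes g: "g \<in> carrier G" and k: "k \<in> K"
  shows "\<tau> (g \<otimes>\<^bsub>G\<^esub> k) ** h_adjoint h (\<tau> (g \<otimes>\<^bsub>G\<^esub> k)) = \<tau> g ** h_adjoint h (\<tau> g)"
proof -
  obtain g' where g': "g' \<in> carrier G" "h_adjoint h (\<tau> g) = \<tau> g'"
    "\<And>v w. h (\<tau> g *v v) w = h v (\<tau> g' *v w)"
    using adjoint_in_image[OF g] by metis
  have kc: "k \<in> carrier G" "inv\<^bsub>G\<^esub> k \<in> carrier G" using K_carrier[OF k] by auto
  have "h (\<tau> k *v v) w = h v (\<tau> (inv\<^bsub>G\<^esub> k) *v w)" for v w
    using unitaryD[OF k, of v "\<tau> (inv\<^bsub>G\<^esub> k) *v w"]
    by (simp add: matrix_vector_mul_assoc \<tau>_inv_right kc)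
  then have "h_adjoint h (\<tau> (g \<otimes>\<^bsub>G\<^esub> k)) = \<tau> (inv\<^bsub>G\<^esub> k) ** \<tau> g'"
    by (intro h_adjoint_eqI)
      (simp add: \<tau>_mult g kc matrix_vector_mul_assoc[symmetric] g'(3))
  then have "\<tau> (g \<otimes>\<^bsub>G\<^esub> k) ** h_adjoint h (\<tau> (g \<otimes>\<^bsub>G\<^esub> k)) = \<tau> g ** (\<tau> k ** \<tau> (inv\<^bsub>G\<^esub> k)) ** \<tau> g'"
    by (simp add: \<tau>_mult g kc matrix_mul_assoc)
  then show ?thesis by (simp add: \<tau>_inv_right kc g'(2))
qed

text \<open>Both maps are defined through the image of a coset under a function that is constant on it.\<close>

lemma coset_values:
  assumes g: "g \<in> carrier G"
  shows "satake_embedding h \<tau> (g <#\<^bsub>G\<^esub> K) = span {\<tau> g ** h_adjoint h (\<tau> g)}"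
    and "bly_map h \<tau> \<mu> \<gamma> (g <#\<^bsub>G\<^esub> K) =
      (\<integral>x. \<mu> (proj_act (pos_sqrt h (\<tau> g ** h_adjoint h (\<tau> g))) x) \<partial>\<gamma>)"
proof -
  have ne: "g <#\<^bsub>G\<^esub> K \<noteq> {}" using subgroup.one_closed[OF subgroup_K] by (auto simp: l_coset_def)
  have inv: "\<tau> g' ** h_adjoint h (\<tau> g') = \<tau> g ** h_adjoint h (\<tau> g)" if "g' \<in> g <#\<^bsub>G\<^esub> K" for g'
    using that gram_coset_invariant[OF g] by (auto simp: l_coset_def)
  show "satake_embedding h \<tau> (g <#\<^bsub>G\<^esub> K) = span {\<tau> g ** h_adjoint h (\<tau> g)}"
    unfolding satake_embedding_def by (rule the_elem_image_unique[OF ne]) (simp only: inv)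
  show "bly_map h \<tau> \<mu> \<gamma> (g <#\<^bsub>G\<^esub> K) =
      (\<integral>x. \<mu> (proj_act (pos_sqrt h (\<tau> g ** h_adjoint h (\<tau> g))) x) \<partial>\<gamma>)"
    unfolding bly_map_def by (rule the_elem_image_unique[OF ne]) (simp only: inv)
qed

text \<open>The vectors whose whole orbit is orthogonal to \<open>w\<close> form an invariant subspace that does not contain
  \<open>w\<close>; by irreducibility it is \<open>0\<close>.\<close>

lemma orbit_spans:
  assumes irr: "irreducible_representation G \<tau>" and x0: "x0 \<in> topspace proj_space" and w: "w \<noteq> 0"
  shows "\<exists>x\<in>(\<lambda>A. proj_act A x0) ` \<tau> ` carrier G. \<exists>v\<in>x. h v w \<noteq> 0"
proof -
  define W where "W = {v. \<forall>g\<in>carrier G. h (\<tau> g *v v) w = 0}"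
  have "vec.subspace W"
    unfolding vec.subspace_def W_def
    by (auto simp: h.zero_left matrix_vector_right_distrib h_add_left vec.scale h_scale_left)
  moreover have "\<tau> g *v v \<in> W" if "g \<in> carrier G" "v \<in> W" for g v
    using that by (auto simp: W_def matrix_vector_mul_assoc \<tau>_mult[symmetric])
  ultimately have "W = {0} \<or> W = UNIV" using irr unfolding irreducible_representation_def by blast
  moreover have "w \<notin> W"
  proof
    assume "w \<in> W"
    then have "h (\<tau> \<one>\<^bsub>G\<^esub> *v w) w = 0" unfolding W_def by blast
    then show False using w by (simp add: h_self)
  qed
  ultimately have "rep x0 \<notin> W" using rep_props(1)[OF x0] by auto
  then obtain g where g: "g \<in> carrier G" "h (\<tau> g *v rep x0) w \<noteq> 0" by (auto simp: W_def)
  moreover have "\<tau> g *v rep x0 \<in> proj_act (\<tau> g) x0" using rep_props(2)[OF x0] by (auto simp: proj_act_def)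
  ultimately show ?thesis by blast
qed

end

text \<open>The definite description in the definition of the gradient map has a unique solution, given by the moment map
  and the change of scalar product.\<close>

lemma gradient_map_eq:
  fixes ip :: "'e::euclidean_space \<Rightarrow> 'e \<Rightarrow> real"
  assumes M: "moment_setting h \<pp> d \<O> \<gamma>"
    and add: "\<forall>x\<in>\<pp>. \<forall>y\<in>\<pp>. \<forall>z\<in>\<pp>. ip (x + y) z = ip x z + ip y z"
    and scale: "\<forall>r. \<forall>x\<in>\<pp>. \<forall>y\<in>\<pp>. ip (r *\<^sub>R x) y = r * ip x y"
    and pos: "\<forall>x\<in>\<pp>. x \<noteq> 0 \<longrightarrow> ip x x > 0"
    and J: "\<And>y. J y \<in> \<pp>" "\<forall>y\<in>\<pp>. \<forall>x\<in>\<pp>. ip (J y) x = y \<bullet> x"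
    and v: "v \<noteq> 0"
  shows "gradient_map h ip \<pp> d (vec.span {v}) = J (moment_setting.moment h \<pp> d v)"
proof -
  interpret moment_setting h \<pp> d \<O> \<gamma> by (rule M)
  have eq: "complex_of_real (ip (J (moment v)) \<beta>) = h (d \<beta> *v u) u / h u u"
    if u: "u \<in> vec.span {v} - {0}" and \<beta>: "\<beta> \<in> \<pp>" for u \<beta>
  proof -
    obtain k where k: "u = k *s v" using u by (auto simp: vec.span_singleton)
    then have "k \<noteq> 0" using u by auto
    then have "moment v = moment u" using k by (simp add: moment_scale)
    then have "ip (J (moment v)) \<beta> = Re (h (d \<beta> *v u) u) / hn u"
      using \<beta> by (simp add: J(2) moment_in moment_inner)
    then show ?thesis using herm_form_real[OF d_herm[OF \<beta>], of u] h_self[of u] by simp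
  qed
  show ?thesis
    unfolding gradient_map_def
  proof (rule the_equality)
    show "J (moment v) \<in> \<pp> \<and> (\<forall>u\<in>vec.span {v} - {0}. \<forall>\<beta>\<in>\<pp>.
        complex_of_real (ip (J (moment v)) \<beta>) = h (d \<beta> *v u) u / h u u)"
      using J(1) eq by blast
    fix \<mu> assume \<mu>: "\<mu> \<in> \<pp> \<and> (\<forall>u\<in>vec.span {v} - {0}. \<forall>\<beta>\<in>\<pp>. complex_of_real (ip \<mu> \<beta>) = h (d \<beta> *v u) u / h u u)"
    let ?\<delta> = "\<mu> + (- 1) *\<^sub>R J (moment v)"
    have \<delta>: "?\<delta> \<in> \<pp>" using \<mu> J(1) subspace by (intro subspace_add subspace_scale) auto
    have vv: "v \<in> vec.span {v} - {0}" using v vec.span_base by blast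
    have "complex_of_real (ip \<mu> ?\<delta>) = complex_of_real (ip (J (moment v)) ?\<delta>)"
      using eq[OF vv \<delta>] \<mu> vv \<delta> by metis
    then have "ip \<mu> ?\<delta> = ip (J (moment v)) ?\<delta>" by (simp only: of_real_eq_iff)
    moreover have "ip ?\<delta> ?\<delta> = ip \<mu> ?\<delta> + (- 1) * ip (J (moment v)) ?\<delta>"
      using \<mu> J(1) \<delta>
      by (simp only: add[rule_format] scale[rule_format] subspace_scale[OF subspace])
    ultimately have "ip ?\<delta> ?\<delta> = 0" by simp
    then have "?\<delta> = 0" using pos \<delta> by force
    then show "\<mu> = J (moment v)" by simp
  qed
qed

lemma imaginary_skew_hermitian:
  assumes h: "hermitian_scalar_product h" and B: "B \<in> special_unitary_lie h"
  shows "map_matrix ((*) \<i>) B \<in> herm_endos h" "trace (map_matrix ((*) \<i>) B) = 0"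
proof -
  interpret hermitian_form h by unfold_locales (rule h)
  have iB: "map_matrix ((*) \<i>) B *v v = \<i> *s (B *v v)" for v
    by (simp add: vec_eq_iff matrix_vector_mult_def sum_distrib_left mult.assoc)
  have skew: "h (B *v v) w = - h v (B *v w)" for v w
    using B by (simp add: special_unitary_lie_def eq_neg_iff_add_eq_0)
  show "map_matrix ((*) \<i>) B \<in> herm_endos h"
    by (simp add: herm_endos_def iB h_scale_left h_scale_right skew)
  have "trace (map_matrix ((*) \<i>) B) = \<i> * trace B" by (simp add: trace_def sum_distrib_left)
  then show "trace (map_matrix ((*) \<i>) B) = 0" using B by (simp add: special_unitary_lie_def)
qed

section \<open>The Bourguignon-Li-Yau map on the Satake compactification\<close>

theorem theorem4:
  fixes G :: "('g, 'm) monoid_scheme"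
    and T :: "'g topology"
    and A :: "('g, 'e::euclidean_space) chart set"
    and c :: "('g, 'e) chart"
    and K :: "'g set"
    and \<pp> :: "'e set"
    and ip :: "'e \<Rightarrow> 'e \<Rightarrow> real"
    and \<tau> :: "'g \<Rightarrow> complex^'n^'n"
    and h :: "complex^'n \<Rightarrow> complex^'n \<Rightarrow> complex"
    and \<O>' \<O> :: "(complex^'n) set set"
    and \<gamma> :: "(complex^'n) set measure"
  defines "\<mu> \<equiv> gradient_map h ip \<pp> (differential G c \<tau>)"
  defines "\<E> \<equiv> convex hull (\<mu> ` \<O>)"
  defines "X \<equiv> lcosets\<^bsub>G\<^esub> K"
  defines "\<Psi> \<equiv> bly_map h \<tau> \<mu> \<gamma>"
  assumes "lie_group G T A" and "chart_at_one G A c"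
    and "connected_space T" and "\<not> compact_space T"
    and "semisimple_lie_algebra G c" and "finite (group_center G)"
    and "maximal_compact_subgroup G T K"
    and "cartan_decomposition G c (lie_algebra_of G T c K) \<pp>"
    and "Ad_invariant_scalar_product G c K \<pp> ip"
    and "sl_representation G A \<tau>" and "irreducible_representation G \<tau>"
    and "finite (representation_kernel G \<tau>)"
    and "hermitian_scalar_product h" and "compatible G c K \<pp> \<tau> h"
    and "closed_proj_orbit (zariski_closure_SL (\<tau> ` carrier G)) \<O>'"
    and "closed_proj_orbit (\<tau> ` carrier G) \<O>" and "\<O> \<subseteq> \<O>'"
    and "borel_probability_on \<O> \<gamma>" and "admissible \<O> \<gamma>"
  shows "\<exists>\<Psi>'. continuous_map
                (subtopology (herm_proj_space h) (satake_compactification G K h \<tau>)) (top_of_set \<pp>) \<Psi>' \<and>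
              (\<forall>x\<in>X. \<Psi>' (satake_embedding h \<tau> x) = \<Psi> x) \<and>
              \<Psi>' ` satake_boundary G K h \<tau> \<subseteq> (top_of_set \<pp>) frontier_of \<E> \<and>
              \<Psi>' ` satake_compactification G K h \<tau> = \<E> \<and>
              \<Psi> ` X = (top_of_set \<pp>) interior_of \<E>"
proof -
  let ?d = "differential G c \<tau>"
  have K: "subgroup K G"
    using \<open>maximal_compact_subgroup G T K\<close> by (simp add: maximal_compact_subgroup_def)
  have comp: "\<tau> ` K \<subseteq> special_unitary h"
    "?d ` \<pp> \<subseteq> (\<lambda>B. map_matrix ((*) \<i>) B) ` special_unitary_lie h"
    "\<tau> ` carrier G = {\<tau> k ** mat_exp (?d \<beta>) | k \<beta>. k \<in> K \<and> \<beta> \<in> \<pp>}"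
    using \<open>compatible G c K \<pp> \<tau> h\<close> unfolding compatible_def by blast+
  have sub: "subspace \<pp>"
    using \<open>cartan_decomposition G c (lie_algebra_of G T c K) \<pp>\<close> by (simp add: cartan_decomposition_def)
  have herm: "?d \<beta> \<in> herm_endos h" and tr: "trace (?d \<beta>) = 0" if "\<beta> \<in> \<pp>" for \<beta>
    using comp(2) that imaginary_skew_hermitian[OF \<open>hermitian_scalar_product h\<close>] by auto
  interpret R: compatible_rep G T A c \<tau> h K \<pp>
    using assms(5,6) \<open>sl_representation G A \<tau>\<close> \<open>hermitian_scalar_product h\<close> comp K sub herm
    by (intro compatible_rep.intro compatible_rep_axioms.intro unitary_lie_rep.intro
        unitary_lie_rep_axioms.intro lie_rep.intro hermitian_form.intro) auto
  obtain x0 where x0: "x0 \<in> topspace proj_space" "\<O> = (\<lambda>A. proj_act A x0) ` \<tau> ` carrier G"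
    and closed: "closedin proj_space \<O>"
    using \<open>closed_proj_orbit (\<tau> ` carrier G) \<O>\<close> unfolding closed_proj_orbit_def by blast
  interpret M: moment_setting h \<pp> ?d \<O> \<gamma>
  proof (intro moment_setting.intro hermitian_form.intro moment_setting_axioms.intro)
    show "\<beta> = 0" if "\<beta> \<in> \<pp>" "?d \<beta> = 0" for \<beta>
      by (rule R.differential_injective_on_p
          [OF \<open>cartan_decomposition G c (lie_algebra_of G T c K) \<pp>\<close>
            \<open>finite (representation_kernel G \<tau>)\<close> herm that])
    show "proj_act (mat_exp (?d \<beta>)) x \<in> \<O>" if \<beta>: "\<beta> \<in> \<pp>" and x: "x \<in> \<O>" for \<beta> x
    proof -
      obtain g where g: "g \<in> carrier G" "x = proj_act (\<tau> g) x0" using x x0(2) by blast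
      obtain a where a: "a \<in> carrier G" "\<tau> a = mat_exp (?d \<beta>)" using R.exp_in_image[OF \<beta>] .
      have "proj_act (mat_exp (?d \<beta>)) x = proj_act (\<tau> (a \<otimes>\<^bsub>G\<^esub> g)) x0"
        by (simp add: g a(1) a(2)[symmetric] R.\<tau>_mult proj_act_def image_image matrix_vector_mul_assoc)
      then show ?thesis unfolding x0(2) using a g by simp
    qed
    show "\<exists>x\<in>\<O>. \<exists>v\<in>x. h v w \<noteq> 0" if "w \<noteq> 0" for w
      unfolding x0(2) by (rule R.orbit_spans[OF \<open>irreducible_representation G \<tau>\<close> x0(1) that])
  qed (use sub \<open>hermitian_scalar_product h\<close> R.linear_d\<tau> herm tr closed \<open>borel_probability_on \<O> \<gamma>\<close> \<open>admissible \<O> \<gamma>\<close> in auto)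
  have ip: "\<forall>x\<in>\<pp>. \<forall>y\<in>\<pp>. \<forall>z\<in>\<pp>. ip (x + y) z = ip x z + ip y z"
    "\<forall>r. \<forall>x\<in>\<pp>. \<forall>y\<in>\<pp>. ip (r *\<^sub>R x) y = r * ip x y"
    "\<forall>x\<in>\<pp>. \<forall>y\<in>\<pp>. ip x y = ip y x"
    "\<forall>x\<in>\<pp>. x \<noteq> 0 \<longrightarrow> ip x x > 0"
    using \<open>Ad_invariant_scalar_product G c K \<pp> ip\<close>
    unfolding Ad_invariant_scalar_product_def by - (elim conjE, assumption)+
  obtain J where J: "linear J" "\<And>y. J y \<in> \<pp>" "homeomorphic_map (top_of_set \<pp>) (top_of_set \<pp>) J"
    "\<forall>y\<in>\<pp>. \<forall>x\<in>\<pp>. ip (J y) x = y \<bullet> x"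
    using scalar_product_isomorphism[OF sub ip] by metis
  have \<mu>: "\<mu> (vec.span {v}) = J (M.moment v)" if "v \<noteq> 0" for v
    unfolding \<mu>_def by (rule gradient_map_eq[OF M.moment_setting_axioms ip(1,2,4) J(2,4) that])
  have \<mu>_O: "\<mu> x = J (M.moment (rep x))" if "x \<in> \<O>" for x
    using \<mu>[of "rep x"] rep_props(1) span_rep M.O_sub[OF that] by metis
  have \<E>: "\<E> = J ` M.body"
  proof -
    have "\<mu> ` \<O> = J ` ((\<lambda>x. M.moment (rep x)) ` \<O>)" using \<mu>_O by (simp add: image_image)
    then show ?thesis by (simp add: \<E>_def M.body_def convex_hull_linear_image[OF J(1)])
  qed
  have orbit_value: "satake_embedding h \<tau> (g <#\<^bsub>G\<^esub> K) = span {mat_exp (?d \<beta>) ** mat_exp (?d \<beta>)}"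
    "\<Psi> (g <#\<^bsub>G\<^esub> K) = J (M.bary (mat_exp (?d \<beta>)))"
    if g: "g \<in> carrier G" and \<beta>: "\<beta> \<in> \<pp>"
      and gram: "\<tau> g ** h_adjoint h (\<tau> g) = mat_exp (?d \<beta>) ** mat_exp (?d \<beta>)" for g \<beta>
  proof -
    show "satake_embedding h \<tau> (g <#\<^bsub>G\<^esub> K) = span {mat_exp (?d \<beta>) ** mat_exp (?d \<beta>)}"
      by (simp add: R.coset_values(1)[OF g] gram)
    have "\<Psi> (g <#\<^bsub>G\<^esub> K) = (\<integral>x. \<mu> (proj_act (mat_exp (?d \<beta>)) x) \<partial>\<gamma>)"
      by (simp add: \<Psi>_def R.coset_values(2)[OF g] gram R.pos_sqrt_mat_exp[OF herm[OF \<beta>]])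
    also have "\<dots> = (\<integral>x. J (M.moment (mat_exp (?d \<beta>) *v rep x)) \<partial>\<gamma>)"
    proof (rule Bochner_Integration.integral_cong[OF refl])
      fix x assume "x \<in> space \<gamma>"
      then have x: "x \<in> topspace proj_space" using M.O_sub by (simp add: M.space_gamma)
      have "proj_act (mat_exp (?d \<beta>)) x = vec.span {mat_exp (?d \<beta>) *v rep x}"
        using span_rep[OF x] proj_act_span by metis
      moreover have "mat_exp (?d \<beta>) *v rep x \<noteq> 0"
        using rep_props(1)[OF x] by (simp add: R.mat_exp_vec_eq_0)
      ultimately show "\<mu> (proj_act (mat_exp (?d \<beta>)) x) = J (M.moment (mat_exp (?d \<beta>) *v rep x))"
        using \<mu> by simp
    qed
    also have "\<dots> = J (M.bary (mat_exp (?d \<beta>)))"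
      unfolding M.bary_def using J(1)
      by (intro integral_bounded_linear M.moment_integrable) (simp add: linear_conv_bounded_linear)
    finally show "\<Psi> (g <#\<^bsub>G\<^esub> K) = J (M.bary (mat_exp (?d \<beta>)))" .
  qed
  have X_value: "\<exists>\<beta>\<in>\<pp>. satake_embedding h \<tau> x = span {mat_exp (?d \<beta>) ** mat_exp (?d \<beta>)} \<and>
      \<Psi> x = J (M.bary (mat_exp (?d \<beta>)))" if xX: "x \<in> X" for x
  proof -
    obtain g where g: "g \<in> carrier G" "x = g <#\<^bsub>G\<^esub> K" using xX by (auto simp: X_def LCOSETS_def)
    obtain \<beta> where "\<beta> \<in> \<pp>" "\<tau> g ** h_adjoint h (\<tau> g) = mat_exp (?d \<beta>) ** mat_exp (?d \<beta>)"
      using R.positive_part[OF g(1)] .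
    then show ?thesis using orbit_value[OF g(1)] g(2) by blast
  qed
  have X_hits: "\<exists>x\<in>X. satake_embedding h \<tau> x = span {mat_exp (?d \<beta>) ** mat_exp (?d \<beta>)} \<and>
      \<Psi> x = J (M.bary (mat_exp (?d \<beta>)))" if \<beta>: "\<beta> \<in> \<pp>" for \<beta>
  proof -
    obtain g where g: "g \<in> carrier G" "\<tau> g ** h_adjoint h (\<tau> g) = mat_exp (?d \<beta>) ** mat_exp (?d \<beta>)"
      using R.positive_part_exists[OF \<beta>] .
    then have "g <#\<^bsub>G\<^esub> K \<in> X" by (auto simp: X_def LCOSETS_def)
    then show ?thesis using orbit_value[OF g(1) \<beta> g(2)] by blast
  qed
  have embedding: "satake_embedding h \<tau> ` X = M.interior_points"
    unfolding M.interior_points_def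
  proof (rule equalityI; rule subsetI)
    fix L assume "L \<in> satake_embedding h \<tau> ` X"
    then show "L \<in> (\<lambda>\<beta>. span {mat_exp (?d \<beta>) ** mat_exp (?d \<beta>)}) ` \<pp>" using X_value by auto
  next
    fix L assume "L \<in> (\<lambda>\<beta>. span {mat_exp (?d \<beta>) ** mat_exp (?d \<beta>)}) ` \<pp>"
    then obtain \<beta> where "\<beta> \<in> \<pp>" "L = span {mat_exp (?d \<beta>) ** mat_exp (?d \<beta>)}" by blast
    then show "L \<in> satake_embedding h \<tau> ` X" using X_hits by (metis imageI)
  qed
  have Sat: "satake_compactification G K h \<tau> = herm_proj_space h closure_of M.interior_points"
    "satake_boundary G K h \<tau> = herm_proj_space h closure_of M.interior_points - M.interior_points"
    using embedding by (simp_all add: satake_boundary_def satake_compactification_def X_def)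
  obtain \<Psi>0 where \<Psi>0: "continuous_map (subtopology (herm_proj_space h)
        (herm_proj_space h closure_of M.interior_points)) (top_of_set \<pp>) \<Psi>0"
    "\<And>\<beta>. \<beta> \<in> \<pp> \<Longrightarrow> \<Psi>0 (span {mat_exp (?d \<beta>) ** mat_exp (?d \<beta>)}) = M.bary (mat_exp (?d \<beta>))"
    "\<Psi>0 ` (herm_proj_space h closure_of M.interior_points - M.interior_points)
      \<subseteq> top_of_set \<pp> frontier_of M.body"
    "\<Psi>0 ` (herm_proj_space h closure_of M.interior_points) = M.body"
    using M.bary_extends_to_closure by metis
  have body_top: "M.body \<subseteq> topspace (top_of_set \<pp>)" using M.body_sub by simp
  show ?thesis
  proof (intro exI conjI)
    show "continuous_map (subtopology (herm_proj_space h) (satake_compactification G K h \<tau>))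
        (top_of_set \<pp>) (J \<circ> \<Psi>0)"
      unfolding Sat by (rule continuous_map_compose[OF \<Psi>0(1) homeomorphic_imp_continuous_map[OF J(3)]])
    show "\<forall>x\<in>X. (J \<circ> \<Psi>0) (satake_embedding h \<tau> x) = \<Psi> x"
      using X_value \<Psi>0(2) by fastforce
    show "(J \<circ> \<Psi>0) ` satake_boundary G K h \<tau> \<subseteq> top_of_set \<pp> frontier_of \<E>"
      unfolding Sat \<E> homeomorphic_map_frontier_of[OF J(3) body_top] image_comp[symmetric]
      by (rule image_mono[OF \<Psi>0(3)])
    show "(J \<circ> \<Psi>0) ` satake_compactification G K h \<tau> = \<E>"
      unfolding Sat \<E> image_comp[symmetric] \<Psi>0(4) ..
    show "\<Psi> ` X = top_of_set \<pp> interior_of \<E>"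
    proof -
      have "\<Psi> ` X = J ` (\<lambda>\<beta>. M.bary (mat_exp (?d \<beta>))) ` \<pp>"
      proof (rule equalityI; rule subsetI)
        fix y assume "y \<in> \<Psi> ` X"
        then obtain \<beta> where "\<beta> \<in> \<pp>" "y = J (M.bary (mat_exp (?d \<beta>)))" using X_value by blast
        then show "y \<in> J ` (\<lambda>\<beta>. M.bary (mat_exp (?d \<beta>))) ` \<pp>" by blast
      next
        fix y assume "y \<in> J ` (\<lambda>\<beta>. M.bary (mat_exp (?d \<beta>))) ` \<pp>"
        then obtain \<beta> where "\<beta> \<in> \<pp>" "y = J (M.bary (mat_exp (?d \<beta>)))" by blast
        then show "y \<in> \<Psi> ` X" using X_hits by (metis imageI)
      qed
      then show ?thesis
        unfolding \<E> homeomorphic_map_interior_of[OF J(3) body_top] M.bary_exp_image .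
    qed
  qed
qed

end
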